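(* Let $f_1,f_2$ be tempered distributions on $\mathbb{R}^d$ with discrete relatively dense supports $\Lambda_1,\Lambda_2$ and discrete spectrums $\Gamma_1,\Gamma_2$ (i.e. $\Gamma_j$ is the support of $\hat f_j$). Let $\Lambda_1-\Lambda_2=\{\lambda-\lambda':\lambda\in\Lambda_1,\ \lambda'\in\Lambda_2\}$ be a discrete set, and let, for some $T<\infty$, $$n_{\Gamma_1}(r)+n_{\Gamma_2}(r)=O(r^T),\qquad r\to\infty.$$ If $$\inf_{\lambda\in\Lambda_j}\kappa_{f_j}(\lambda)>0\quad\text{and}\quad \sup_{\lambda\in\Lambda_j}\kappa_{f_j}(\lambda)<\infty,\qquad j=1,2,$$ then there is one and the same full-rank lattice $L\subset\mathbb{R}^d$ such that both $\Lambda_1$ and $\Lambda_2$ are pure crystals with respect to $L$.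
   Context: $S(\mathbb{R}^d)$ is the Schwartz space, $S^*(\mathbb{R}^d)$ the space of tempered distributions. Fourier transform: $\hat\varphi(y)=\int_{\mathbb{R}^d}\varphi(x)e^{-2\pi i\langle x,y\rangle}dx$ and $\hat f(\varphi)=f(\hat\varphi)$ for $\varphi\in S(\mathbb{R}^d)$. The spectrum of $f$ is the support of $\hat f$. A set $A\subset\mathbb{R}^d$ is discrete if it has no finite limit points; it is relatively dense if there is $R<\infty$ such that every ball of radius $R$ intersects $A$. For discrete $A$, $n_A(r)=\#(A\cap B(0,r))$, where $B(x,r)$ is the ball of radius $r$ centered at $x$. For a multi-index $k\in(\mathbb{N}\cup\{0\})^d$, $\|k\|=k_1+\dots+k_d$; $\delta_\lambda$ is the unit mass at $\lambda$. Every tempered distribution $f$ with discrete support $\Lambda$ has the form $f=\sum_{\lambda\in\Lambda}\sum_{\|k\|\le m}p_{\lambda,k}D^k\delta_\lambda$ with $p_{\lambda,k}\in\mathbb{C}$ and some finite $m$ ($m=\operatorname{ord} f$ is the smallest such number). For such $f$ put $\kappa_f(\lambda)=\sup_{\|k\|\le m}|p_{\lambda,k}|$. A full-rank lattice is a set $L=T\mathbb{Z}^d$ with $T$ a nondegenerate linear operator on $\mathbb{R}^d$. A set $A\subset\mathbb{R}^d$ is a pure crystal with respect to $L$ if it is a finite union of cosets (translates) of $L$. *)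

theory Defs
  imports "HOL-Analysis.Analysis" "HOL-Library.Landau_Symbols"
begin

section \<open>Multi-indices and partial derivatives\<close>

definition mi_abs :: "('d::finite \<Rightarrow> nat) \<Rightarrow> nat" where
  "mi_abs k = (\<Sum>i\<in>UNIV. k i)"

definition partial_deriv ::
    "'d::finite \<Rightarrow> (real^'d \<Rightarrow> complex) \<Rightarrow> real^'d \<Rightarrow> complex" where
  "partial_deriv i \<phi> = (\<lambda>x. frechet_derivative \<phi> (at x) (axis i 1))"

text \<open>Differentiability of all iterated partial derivatives, in every order, makes all of
  them continuous, so this is \<open>C\<^sup>\<infinity>\<close>.\<close>

definition smooth :: "(real^'d::finite \<Rightarrow> complex) \<Rightarrow> bool" where
  "smooth \<phi> \<longleftrightarrow> (\<forall>is x. foldr partial_deriv is \<phi> differentiable (at x))"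

text \<open>The index type carries no order, so an arbitrary enumeration of the coordinates is fixed.
  On smooth functions partial derivatives commute and the choice is irrelevant.\<close>

definition coords :: "'d::finite list" where
  "coords = (SOME is. distinct is \<and> set is = UNIV)"

definition multi_deriv ::
    "('d::finite \<Rightarrow> nat) \<Rightarrow> (real^'d \<Rightarrow> complex) \<Rightarrow> real^'d \<Rightarrow> complex" where
  "multi_deriv k \<phi> = foldr (\<lambda>i. partial_deriv i ^^ k i) coords \<phi>"


section \<open>The Schwartz space and tempered distributions\<close>

definition schwartz :: "(real^'d::finite \<Rightarrow> complex) set" where
  "schwartz = {\<phi>. smooth \<phi> \<and>
     (\<forall>n k. bdd_above (range (\<lambda>x. (1 + norm x) ^ n * cmod (multi_deriv k \<phi> x))))}"

definition schwartz_seminorm ::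
    "nat \<Rightarrow> ('d::finite \<Rightarrow> nat) \<Rightarrow> (real^'d \<Rightarrow> complex) \<Rightarrow> real" where
  "schwartz_seminorm n k \<phi> = (SUP x. (1 + norm x) ^ n * cmod (multi_deriv k \<phi> x))"

definition schwartz_topology :: "(real^'d::finite \<Rightarrow> complex) topology" where
  "schwartz_topology = topology_generated_by
     {{\<psi> \<in> schwartz. schwartz_seminorm n k (\<lambda>x. \<psi> x - \<phi> x) < r} | \<phi> n k r.
        \<phi> \<in> schwartz \<and> 0 < r}"

text \<open>Functionals are total functions in HOL; only their values on \<^const>\<open>schwartz\<close> are
  meaningful, and nothing below depends on the other values.\<close>

definition tempered_distribution ::
    "((real^'d::finite \<Rightarrow> complex) \<Rightarrow> complex) \<Rightarrow> bool" where
  "tempered_distribution f \<longleftrightarrow>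
     (\<forall>\<phi>\<in>schwartz. \<forall>\<psi>\<in>schwartz. \<forall>a b.
        f (\<lambda>x. a * \<phi> x + b * \<psi> x) = a * f \<phi> + b * f \<psi>) \<and>
     continuous_map schwartz_topology euclidean f"

definition fourier :: "(real^'d::finite \<Rightarrow> complex) \<Rightarrow> real^'d \<Rightarrow> complex" where
  "fourier \<phi> y = (LINT x|lborel. \<phi> x * exp (- 2 * of_real pi * \<i> * of_real (x \<bullet> y)))"

definition dist_fourier ::
    "((real^'d::finite \<Rightarrow> complex) \<Rightarrow> complex) \<Rightarrow> (real^'d \<Rightarrow> complex) \<Rightarrow> complex" where
  "dist_fourier f \<phi> = f (fourier \<phi>)"

definition fun_supp :: "(real^'d::finite \<Rightarrow> complex) \<Rightarrow> (real^'d) set" where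
  "fun_supp \<phi> = closure {x. \<phi> x \<noteq> 0}"

definition test_functions :: "(real^'d::finite \<Rightarrow> complex) set" where
  "test_functions = {\<phi>. smooth \<phi> \<and> compact (fun_supp \<phi>)}"

text \<open>The complement of the largest open set on which \<open>f\<close> vanishes.\<close>

definition dist_supp ::
    "((real^'d::finite \<Rightarrow> complex) \<Rightarrow> complex) \<Rightarrow> (real^'d) set" where
  "dist_supp f =
     - \<Union>{U. open U \<and> (\<forall>\<phi>\<in>test_functions. fun_supp \<phi> \<subseteq> U \<longrightarrow> f \<phi> = 0)}"

definition dirac :: "real^'d::finite \<Rightarrow> (real^'d \<Rightarrow> complex) \<Rightarrow> complex" where
  "dirac a \<phi> = \<phi> a"

definition dist_deriv ::
    "('d::finite \<Rightarrow> nat) \<Rightarrow> ((real^'d \<Rightarrow> complex) \<Rightarrow> complex) \<Rightarrow> (real^'d \<Rightarrow> complex) \<Rightarrow> complex"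
  where "dist_deriv k f \<phi> = (-1) ^ mi_abs k * f (multi_deriv k \<phi>)"


section \<open>Distributions with discrete support\<close>

text \<open>Stronger than the topological notion of a discrete subspace: limit points outside the set
  are excluded as well.\<close>

definition discrete_set :: "(real^'d::finite) set \<Rightarrow> bool" where
  "discrete_set A \<longleftrightarrow> (\<forall>x. \<not> x islimpt A)"

definition relatively_dense :: "(real^'d::finite) set \<Rightarrow> bool" where
  "relatively_dense A \<longleftrightarrow> (\<exists>R. \<forall>x. ball x R \<inter> A \<noteq> {})"

definition counting :: "(real^'d::finite) set \<Rightarrow> real \<Rightarrow> nat" where
  "counting A r = card (A \<inter> ball 0 r)"

text \<open>The identity
  \<open>f = (\<Sum>a\<in>dist_supp f. \<Sum>\<parallel>k\<parallel>\<le>m. p a k D\<^sup>k\<delta>\<^sub>a)\<close>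
  between distributions, i.e. tested on compactly supported smooth functions. Terms with
  \<open>a\<close> outside the support of \<open>\<phi>\<close> vanish, so for discrete support of \<open>f\<close> the
  sum below is the full, finite one. (On a general Schwartz function the series need not converge
  absolutely.)\<close>

definition dirac_expansion ::
    "((real^'d::finite \<Rightarrow> complex) \<Rightarrow> complex) \<Rightarrow> nat \<Rightarrow> (real^'d \<Rightarrow> ('d \<Rightarrow> nat) \<Rightarrow> complex) \<Rightarrow> bool"
  where "dirac_expansion f m p \<longleftrightarrow>
     (\<forall>\<phi>\<in>test_functions.
        f \<phi> = (\<Sum>a\<in>dist_supp f \<inter> fun_supp \<phi>. \<Sum>k | mi_abs k \<le> m.
                 p a k * dist_deriv k (dirac a) \<phi>))"

definition dist_ord :: "((real^'d::finite \<Rightarrow> complex) \<Rightarrow> complex) \<Rightarrow> nat" where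
  "dist_ord f = (LEAST m. \<exists>p. dirac_expansion f m p)"

text \<open>For a tempered distribution with discrete support an expansion exists, and its coefficients
  are unique at the points of the support and for multi-indices of length at most the order.
  Only these coefficients are used.\<close>

definition dirac_coeff ::
    "((real^'d::finite \<Rightarrow> complex) \<Rightarrow> complex) \<Rightarrow> real^'d \<Rightarrow> ('d \<Rightarrow> nat) \<Rightarrow> complex" where
  "dirac_coeff f = (SOME p. dirac_expansion f (dist_ord f) p)"

definition kappa :: "((real^'d::finite \<Rightarrow> complex) \<Rightarrow> complex) \<Rightarrow> real^'d \<Rightarrow> real" where
  "kappa f a = (SUP k\<in>{k. mi_abs k \<le> dist_ord f}. cmod (dirac_coeff f a k))"


section \<open>Lattices and pure crystals\<close>

definition full_rank_lattice :: "(real^'d::finite) set \<Rightarrow> bool" where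
  "full_rank_lattice L \<longleftrightarrow>
     (\<exists>T::real^'d \<Rightarrow> real^'d. linear T \<and> inj T \<and> L = T ` {x. \<forall>i. x $ i \<in> \<int>})"

definition pure_crystal :: "(real^'d::finite) set \<Rightarrow> (real^'d) set \<Rightarrow> bool" where
  "pure_crystal L A \<longleftrightarrow> (\<exists>F. finite F \<and> A = (\<Union>a\<in>F. (+) a ` L))"

end

theory Submission
  imports Defs
begin

text \<open>
  Since the supports \<open>\<Lambda>\<^sub>j\<close> are uniformly discrete and the coefficients are bounded, the function
  \<open>t \<mapsto> f\<^sub>j(\<phi>(\<cdot> - t))\<close> is bounded for every rapidly decreasing \<open>\<phi>\<close>, uniformly in terms of
  finitely many seminorms of \<open>\<phi>\<close>. A scaling argument then shows that the transform of \<open>f\<^sub>j\<close> has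
  order zero at each point of the discrete set \<open>\<Gamma>\<^sub>j\<close>, so for \<open>\<phi>\<close> the transform of a test function
  this is a trigonometric polynomial in \<open>t\<close>. Such \<open>\<phi>\<close> are dense, hence for every test function the
  above function of \<open>t\<close> is uniformly almost periodic, and relatively dense sets of common
  almost periods \<open>\<tau>\<close> exist. Testing against jets concentrated near \<open>\<lambda> \<in> \<Lambda>\<^sub>j\<close>, where some
  coefficient is bounded from below, gives a point of \<open>\<Lambda>\<^sub>j\<close> close to \<open>\<lambda> + \<tau>\<close>. As
  \<open>\<Lambda>\<^sub>1 - \<Lambda>\<^sub>2\<close> is discrete, the error is the same for neighbouring points of \<open>\<Lambda>\<^sub>1\<close> and \<open>\<Lambda>\<^sub>2\<close>,
  hence for all of them, and \<open>\<tau>\<close> can be corrected to a common exact period. These periods are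
  relatively dense and therefore contain a full-rank lattice.
\<close>

subsection \<open>Iterated partial derivatives along lists of coordinates\<close>

text \<open>The obstacle is that temperedness bounds \<open>f\<close> only through an unknown
  polynomial weight, useless under large translations, while the Dirac expansion is available on
  test functions only. \<open>translation_bounded\<close> reconciles both: the expansion bounds
  cut-off functions, and temperedness removes the cut-off in the limit. The exponent d + 2 makes the
  weight summable over a separated set, with a sum of size \<epsilon>^(-d) at scale 1/\<epsilon>.
  The transform of a bump of size \<epsilon> carries a factor \<epsilon>^d, which offsets this
  exactly, so the one factor \<epsilon> gained from a zero at a spectral point survives and forces
  order zero there. Uniform discreteness holds because two close points of one support see a common
  nearby point of the other, which gives two close elements of the discrete difference set.
  Simultaneous almost periods come from a pigeonhole argument on fractional parts. Passing from
  neighbouring points to all points uses connectedness of the space, and treating \<tau> and -\<tau>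
  together makes the exact periods a group.\<close>

definition pderivs :: "'d::finite list \<Rightarrow> (real^'d \<Rightarrow> complex) \<Rightarrow> real^'d \<Rightarrow> complex" where
  "pderivs is \<phi> = foldr partial_deriv is \<phi>"

lemma pderivs_Nil [simp]: "pderivs [] \<phi> = \<phi>"
  and pderivs_Cons: "pderivs (i # is) \<phi> = partial_deriv i (pderivs is \<phi>)"
  and pderivs_append: "pderivs (is @ js) \<phi> = pderivs is (pderivs js \<phi>)"
  by (simp_all add: pderivs_def)

lemma smooth_iff: "smooth \<phi> \<longleftrightarrow> (\<forall>is x. pderivs is \<phi> differentiable (at x))"
  by (simp add: smooth_def pderivs_def)

lemma partial_deriv_eq:
  assumes "(\<phi> has_derivative F) (at x)"
  shows "partial_deriv i \<phi> x = F (axis i 1)"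
  unfolding partial_deriv_def using frechet_derivative_at[OF assms] by simp

lemma smooth_pderivs: "smooth \<phi> \<Longrightarrow> smooth (pderivs is \<phi>)"
  unfolding smooth_iff pderivs_append[symmetric] by blast

lemma smooth_partial_deriv: "smooth \<phi> \<Longrightarrow> smooth (partial_deriv i \<phi>)"
  using smooth_pderivs[of \<phi> "[i]"] by (simp add: pderivs_Cons)

lemma smooth_differentiable: "smooth \<phi> \<Longrightarrow> \<phi> differentiable (at x)"
  unfolding smooth_iff by (metis pderivs_Nil)

lemma linear_vec_expand:
  fixes F :: "real^'d::finite \<Rightarrow> 'b::real_vector"
  assumes "linear F"
  shows "F h = (\<Sum>i\<in>UNIV. (h $ i) *\<^sub>R F (axis i 1))"
proof -
  have "F h = F (\<Sum>i\<in>UNIV. (h $ i) *\<^sub>R axis i 1)"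
    by (simp add: basis_expansion[of h, unfolded scalar_mult_eq_scaleR])
  also have "\<dots> = (\<Sum>i\<in>UNIV. (h $ i) *\<^sub>R F (axis i 1))"
    using assms by (simp add: linear_sum linear_scale)
  finally show ?thesis .
qed

lemma smooth_has_derivative:
  assumes "smooth \<phi>"
  shows "(\<phi> has_derivative (\<lambda>h. \<Sum>i\<in>UNIV. (h $ i) *\<^sub>R partial_deriv i \<phi> x)) (at x)"
proof -
  obtain F where F: "(\<phi> has_derivative F) (at x)"
    using smooth_differentiable[OF assms, of x] unfolding differentiable_def by blast
  have "F = (\<lambda>h. \<Sum>i\<in>UNIV. (h $ i) *\<^sub>R partial_deriv i \<phi> x)"
    unfolding partial_deriv_eq[OF F]
    by (rule ext) (rule linear_vec_expand[OF has_derivative_linear[OF F]])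
  with F show ?thesis by simp
qed

lemma smooth_continuous_on: "smooth \<phi> \<Longrightarrow> continuous_on S \<phi>"
  by (intro continuous_at_imp_continuous_on ballI differentiable_imp_continuous_within
      smooth_differentiable)

text \<open>Every iterated derivative stays in \<open>P\<close> by induction on the list. Later
  smoothness proofs therefore only name a class closed under differentiation, instead of computing
  derivatives of all orders.\<close>

lemma smooth_coinduct:
  assumes "P \<phi>" and "\<And>\<phi> x. P \<phi> \<Longrightarrow> \<phi> differentiable (at x)"
    and "\<And>\<phi> i. P \<phi> \<Longrightarrow> P (partial_deriv i \<phi>)"
  shows "smooth \<phi>"
proof -
  have "P (pderivs is \<phi>)" for "is"
    by (induction "is") (use assms in \<open>auto simp: pderivs_Cons\<close>)
  then show ?thesis using assms(2) by (auto simp: smooth_iff)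
qed

lemma has_derivative_lin:
  fixes \<phi> \<psi> :: "real^'d::finite \<Rightarrow> complex"
  assumes "(\<phi> has_derivative F) (at x)" "(\<psi> has_derivative G) (at x)"
  shows "((\<lambda>x. a * \<phi> x + b * \<psi> x) has_derivative (\<lambda>h. a * F h + b * G h)) (at x)"
  by (intro has_derivative_add has_derivative_mult_right assms)

lemma partial_deriv_lin:
  assumes "smooth \<phi>" "smooth \<psi>"
  shows "partial_deriv i (\<lambda>x. a * \<phi> x + b * \<psi> x)
    = (\<lambda>x. a * partial_deriv i \<phi> x + b * partial_deriv i \<psi> x)"
proof
  fix x
  obtain F G where FG: "(\<phi> has_derivative F) (at x)" "(\<psi> has_derivative G) (at x)"
    using assms[THEN smooth_differentiable, of x] by (auto simp: differentiable_def)
  show "partial_deriv i (\<lambda>x. a * \<phi> x + b * \<psi> x) x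
      = a * partial_deriv i \<phi> x + b * partial_deriv i \<psi> x"
    by (simp add: partial_deriv_eq[OF has_derivative_lin[OF FG]] partial_deriv_eq[OF FG(1)]
        partial_deriv_eq[OF FG(2)])
qed

lemma pderivs_lin:
  assumes "smooth \<phi>" "smooth \<psi>"
  shows "pderivs is (\<lambda>x. a * \<phi> x + b * \<psi> x)
    = (\<lambda>x. a * pderivs is \<phi> x + b * pderivs is \<psi> x)"
  by (induction "is") (simp_all add: pderivs_Cons partial_deriv_lin assms smooth_pderivs)

lemma smooth_lin:
  assumes "smooth \<phi>" "smooth \<psi>"
  shows "smooth (\<lambda>x. a * \<phi> x + b * \<psi> x)"
  unfolding smooth_iff pderivs_lin[OF assms]
  using assms[THEN smooth_pderivs, THEN smooth_differentiable]
  by (auto intro!: derivative_intros)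

lemma partial_deriv_const [simp]: "partial_deriv i (\<lambda>x. c) = (\<lambda>x. 0)"
  by (auto simp: partial_deriv_def)

lemma smooth_const: "smooth (\<lambda>x. c)"
  by (rule smooth_coinduct[where P = "\<lambda>\<phi>. \<exists>c. \<phi> = (\<lambda>x. c)"])
    (blast, force, force)

lemma smooth_add: "smooth \<phi> \<Longrightarrow> smooth \<psi> \<Longrightarrow> smooth (\<lambda>x. \<phi> x + \<psi> x)"
  and smooth_diff: "smooth \<phi> \<Longrightarrow> smooth \<psi> \<Longrightarrow> smooth (\<lambda>x. \<phi> x - \<psi> x)"
  and smooth_cmult: "smooth \<phi> \<Longrightarrow> smooth (\<lambda>x. a * \<phi> x)"
  using smooth_lin[of \<phi> \<psi> 1 1] smooth_lin[of \<phi> \<psi> 1 "-1"] smooth_lin[of \<phi> \<phi> a 0] by simp_all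

lemma pderivs_diff: "smooth \<phi> \<Longrightarrow> smooth \<psi> \<Longrightarrow>
    pderivs is (\<lambda>x. \<phi> x - \<psi> x) = (\<lambda>x. pderivs is \<phi> x - pderivs is \<psi> x)"
  and pderivs_cmult: "smooth \<phi> \<Longrightarrow> pderivs is (\<lambda>x. a * \<phi> x) = (\<lambda>x. a * pderivs is \<phi> x)"
  and pderivs_add: "smooth \<phi> \<Longrightarrow> smooth \<psi> \<Longrightarrow>
    pderivs is (\<lambda>x. \<phi> x + \<psi> x) = (\<lambda>x. pderivs is \<phi> x + pderivs is \<psi> x)"
  using pderivs_lin[of \<phi> \<psi> "is" 1 "-1"] pderivs_lin[of \<phi> \<phi> "is" a 0] pderivs_lin[of \<phi> \<psi> "is" 1 1]
  by simp_all

lemma pderivs_zero [simp]: "pderivs is (\<lambda>x. 0) = (\<lambda>x. 0)"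
  by (induction "is") (auto simp: pderivs_Cons)

lemma pderivs_const: "is \<noteq> [] \<Longrightarrow> pderivs is (\<lambda>x. c) = (\<lambda>x. 0)"
proof (induction "is" rule: rev_induct)
  case (snoc i "is")
  then show ?case by (simp add: pderivs_append pderivs_Cons)
qed simp

lemma smooth_sum: "(\<And>a. a \<in> A \<Longrightarrow> smooth (\<phi> a)) \<Longrightarrow> smooth (\<lambda>x. \<Sum>a\<in>A. \<phi> a x)"
  by (induction A rule: infinite_finite_induct) (auto intro: smooth_const smooth_add)

lemma pderivs_sum: "(\<And>a. a \<in> A \<Longrightarrow> smooth (\<phi> a)) \<Longrightarrow>
    pderivs is (\<lambda>x. \<Sum>a\<in>A. \<phi> a x) = (\<lambda>x. \<Sum>a\<in>A. pderivs is (\<phi> a) x)"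
  by (induction A rule: infinite_finite_induct) (simp_all add: pderivs_add smooth_sum)

section \<open>The Leibniz rule\<close>

lemma partial_deriv_mult:
  assumes "smooth \<phi>" "smooth \<psi>"
  shows "partial_deriv i (\<lambda>x. \<phi> x * \<psi> x)
    = (\<lambda>x. partial_deriv i \<phi> x * \<psi> x + \<phi> x * partial_deriv i \<psi> x)"
proof
  fix x
  obtain F G where FG: "(\<phi> has_derivative F) (at x)" "(\<psi> has_derivative G) (at x)"
    using assms[THEN smooth_differentiable, of x] by (auto simp: differentiable_def)
  show "partial_deriv i (\<lambda>x. \<phi> x * \<psi> x) x
      = partial_deriv i \<phi> x * \<psi> x + \<phi> x * partial_deriv i \<psi> x"
    by (simp add: partial_deriv_eq[OF has_derivative_mult[OF FG]] partial_deriv_eq[OF FG(1)]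
        partial_deriv_eq[OF FG(2)])
qed

text \<open>Each differentiation of a product falls on the left or on the right factor. Listing all
  2^n choices with repetition keeps binomial coefficients out of the Leibniz rule.\<close>

fun splits :: "'a list \<Rightarrow> ('a list \<times> 'a list) list" where
  "splits [] = [([], [])]"
| "splits (i # is) = map (\<lambda>(a, b). (i # a, b)) (splits is) @ map (\<lambda>(a, b). (a, i # b)) (splits is)"

lemma length_splits: "length (splits is) = 2 ^ length is"
  by (induction "is") auto

lemma splits_length: "(a, b) \<in> set (splits is) \<Longrightarrow> length a + length b = length is"
  by (induction "is" arbitrary: a b) auto

lemma smooth_sum_list:
  "(\<And>p. p \<in> set ps \<Longrightarrow> smooth (\<phi> p)) \<Longrightarrow> smooth (\<lambda>x. \<Sum>p\<leftarrow>ps. \<phi> p x)"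
  by (induction ps) (auto intro: smooth_const smooth_add)

lemma partial_deriv_sum_list:
  "(\<And>p. p \<in> set ps \<Longrightarrow> smooth (\<phi> p)) \<Longrightarrow>
    partial_deriv i (\<lambda>x. \<Sum>p\<leftarrow>ps. \<phi> p x) = (\<lambda>x. \<Sum>p\<leftarrow>ps. partial_deriv i (\<phi> p) x)"
proof (induction ps)
  case (Cons p ps)
  then have "partial_deriv i (\<lambda>x. 1 * \<phi> p x + 1 * (\<Sum>p\<leftarrow>ps. \<phi> p x))
    = (\<lambda>x. 1 * partial_deriv i (\<phi> p) x + 1 * partial_deriv i (\<lambda>x. \<Sum>p\<leftarrow>ps. \<phi> p x) x)"
    by (intro partial_deriv_lin smooth_sum_list) auto
  with Cons show ?case by simp
qed simp

text \<open>Products alone are not closed under differentiation, but finite sums of products of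
  smooth functions are; the list \<open>ps\<close> holds the factors of such a sum.\<close>

lemma smooth_mult:
  assumes "smooth \<phi>" "smooth \<psi>"
  shows "smooth (\<lambda>x. \<phi> x * \<psi> x)"
proof (rule smooth_coinduct[where P = "\<lambda>\<xi>. \<exists>ps. (\<forall>(u, v)\<in>set ps. smooth u \<and> smooth v) \<and>
      \<xi> = (\<lambda>x. \<Sum>(u, v)\<leftarrow>ps. u x * v x)"], goal_cases)
  case 1
  then show ?case using assms by (intro exI[of _ "[(\<phi>, \<psi>)]"]) auto
next
  case (2 \<xi> x)
  then obtain ps where ps: "\<forall>(u, v)\<in>set ps. smooth u \<and> smooth v"
    "\<xi> = (\<lambda>x. \<Sum>(u, v)\<leftarrow>ps. u x * v x)" by blast
  from ps(1) have "(\<lambda>x. \<Sum>(u, v)\<leftarrow>ps. u x * v x) differentiable (at x)"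
    by (induction ps) (auto intro!: differentiable_add differentiable_mult intro: smooth_differentiable)
  with ps show ?case by simp
next
  case (3 \<xi> i)
  then obtain ps where ps: "\<forall>(u, v)\<in>set ps. smooth u \<and> smooth v"
    "\<xi> = (\<lambda>x. \<Sum>(u, v)\<leftarrow>ps. u x * v x)" by blast
  define qs where "qs = concat (map (\<lambda>(u, v). [(partial_deriv i u, v), (u, partial_deriv i v)]) ps)"
  have "\<forall>(u, v)\<in>set qs. smooth u \<and> smooth v"
    using ps(1) by (auto simp: qs_def intro: smooth_partial_deriv)
  moreover have "partial_deriv i (\<lambda>x. \<Sum>(u, v)\<leftarrow>ps. u x * v x) = (\<lambda>x. \<Sum>(u, v)\<leftarrow>qs. u x * v x)
      \<and> (\<forall>x. (\<lambda>x. \<Sum>(u, v)\<leftarrow>ps. u x * v x) differentiable (at x))"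
    unfolding qs_def using ps(1)
  proof (induction ps)
    case (Cons p ps)
    obtain u v where p: "p = (u, v)" by force
    let ?s = "\<lambda>x. \<Sum>(u, v)\<leftarrow>ps. u x * v x"
    have u: "smooth u" and v: "smooth v" using Cons.prems p by auto
    have IH: "partial_deriv i ?s = (\<lambda>x. \<Sum>(u, v)\<leftarrow>concat (map (\<lambda>(u, v). [(partial_deriv i u, v),
        (u, partial_deriv i v)]) ps). u x * v x)" "\<And>x. ?s differentiable (at x)"
      using Cons by auto
    have d: "(\<lambda>x. u x * v x) differentiable (at x)" for x
      using u v by (intro differentiable_mult smooth_differentiable)
    have "partial_deriv i (\<lambda>x. u x * v x + ?s x) x
        = partial_deriv i (\<lambda>x. u x * v x) x + partial_deriv i ?s x" for x
    proof -
      obtain F G where FG: "((\<lambda>x. u x * v x) has_derivative F) (at x)" "(?s has_derivative G) (at x)"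
        using d[of x] IH(2)[of x] by (auto simp: differentiable_def)
      show ?thesis
        by (simp add: partial_deriv_eq[OF has_derivative_add[OF FG]] partial_deriv_eq[OF FG(1)]
            partial_deriv_eq[OF FG(2)])
    qed
    then show ?case
      using d IH by (simp add: p partial_deriv_mult[OF u v] fun_eq_iff differentiable_add)
  qed simp
  ultimately show ?case using ps(2) by blast
qed

lemma pderivs_mult:
  assumes "smooth \<phi>" "smooth \<psi>"
  shows "pderivs is (\<lambda>x. \<phi> x * \<psi> x) = (\<lambda>x. \<Sum>(a, b)\<leftarrow>splits is. pderivs a \<phi> x * pderivs b \<psi> x)"
proof (induction "is")
  case (Cons i "is")
  have "partial_deriv i (\<lambda>x. \<Sum>p\<leftarrow>splits is. pderivs (fst p) \<phi> x * pderivs (snd p) \<psi> x)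
    = (\<lambda>x. \<Sum>p\<leftarrow>splits is. partial_deriv i (\<lambda>x. pderivs (fst p) \<phi> x * pderivs (snd p) \<psi> x) x)"
    by (intro partial_deriv_sum_list smooth_mult smooth_pderivs assms)
  also have "\<dots> = (\<lambda>x. \<Sum>p\<leftarrow>splits is. pderivs (i # fst p) \<phi> x * pderivs (snd p) \<psi> x
      + pderivs (fst p) \<phi> x * pderivs (i # snd p) \<psi> x)"
    by (simp add: partial_deriv_mult smooth_pderivs assms pderivs_Cons)
  finally show ?case
    unfolding pderivs_Cons[of i "is"] Cons
    by (simp add: case_prod_unfold comp_def sum_list_addf)
qed simp

lemma norm_sum_list_le:
  fixes xs :: "'a::real_normed_vector list"
  shows "norm (sum_list xs) \<le> sum_list (map norm xs)"
  by (induction xs) (auto intro: order_trans[OF norm_triangle_ineq])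

text \<open>All 2^n terms of the Leibniz rule are bounded alike. The crude constant depends on the
  order only, and it is in this form that the Leibniz rule enters the later estimates.\<close>

lemma norm_pderivs_mult_le:
  assumes "smooth \<phi>" "smooth \<psi>"
    and "\<And>a. length a \<le> length is \<Longrightarrow> cmod (pderivs a \<phi> x) \<le> A"
    and "\<And>b. length b \<le> length is \<Longrightarrow> cmod (pderivs b \<psi> x) \<le> B"
  shows "cmod (pderivs is (\<lambda>x. \<phi> x * \<psi> x) x) \<le> 2 ^ length is * (A * B)"
proof -
  have A: "0 \<le> A" using assms(3)[of "[]"] norm_ge_zero[of "\<phi> x"] by (simp del: norm_ge_zero)
  have "cmod (pderivs is (\<lambda>x. \<phi> x * \<psi> x) x)
      \<le> (\<Sum>p\<leftarrow>splits is. cmod (pderivs (fst p) \<phi> x * pderivs (snd p) \<psi> x))"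
    unfolding pderivs_mult[OF assms(1,2)] case_prod_unfold
    by (rule order_trans[OF norm_sum_list_le]) (simp add: comp_def)
  also have "\<dots> \<le> (\<Sum>p\<leftarrow>splits is. A * B)"
  proof (rule sum_list_mono)
    fix p assume "p \<in> set (splits is)"
    then have "length (fst p) + length (snd p) = length is"
      by (metis prod.collapse splits_length)
    then show "cmod (pderivs (fst p) \<phi> x * pderivs (snd p) \<psi> x) \<le> A * B"
      unfolding norm_mult by (intro mult_mono assms) (auto simp: A)
  qed
  also have "\<dots> = 2 ^ length is * (A * B)"
    by (simp add: sum_list_triv length_splits)
  finally show ?thesis .
qed

section \<open>Affine substitutions, characters and coordinate functions\<close>

lemma partial_deriv_affine:
  assumes "smooth \<phi>"
  shows "partial_deriv i (\<lambda>x. \<phi> (a + r *\<^sub>R x)) = (\<lambda>x. of_real r * partial_deriv i \<phi> (a + r *\<^sub>R x))"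
proof
  fix x
  obtain F where F: "(\<phi> has_derivative F) (at (a + r *\<^sub>R x))"
    using assms[THEN smooth_differentiable, of "a + r *\<^sub>R x"] by (auto simp: differentiable_def)
  have "((\<lambda>x. a + r *\<^sub>R x) has_derivative (\<lambda>h. r *\<^sub>R h)) (at x)"
    by (auto intro!: derivative_eq_intros)
  from has_derivative_compose[OF this, of \<phi> F] F
  have "((\<lambda>x. \<phi> (a + r *\<^sub>R x)) has_derivative (\<lambda>h. F (r *\<^sub>R h))) (at x)" by simp
  have "partial_deriv i (\<lambda>x. \<phi> (a + r *\<^sub>R x)) x = F (r *\<^sub>R axis i 1)"
    by (rule partial_deriv_eq) fact
  also have "\<dots> = of_real r * F (axis i 1)"
    using linear_scale[OF has_derivative_linear[OF F], of r "axis i 1"]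
    by (simp add: scaleR_conv_of_real[where 'a = complex])
  finally show "partial_deriv i (\<lambda>x. \<phi> (a + r *\<^sub>R x)) x
    = of_real r * partial_deriv i \<phi> (a + r *\<^sub>R x)"
    by (simp only: partial_deriv_eq[OF F])
qed

lemma differentiable_affine:
  assumes "smooth \<phi>"
  shows "(\<lambda>x. \<phi> (a + r *\<^sub>R x)) differentiable (at x)"
proof -
  obtain F where F: "(\<phi> has_derivative F) (at (a + r *\<^sub>R x))"
    using assms[THEN smooth_differentiable, of "a + r *\<^sub>R x"] by (auto simp: differentiable_def)
  have "((\<lambda>x. a + r *\<^sub>R x) has_derivative (\<lambda>h. r *\<^sub>R h)) (at x)"
    by (auto intro!: derivative_eq_intros)
  from has_derivative_compose[OF this, of \<phi> F] F
  have "((\<lambda>x. \<phi> (a + r *\<^sub>R x)) has_derivative (\<lambda>h. F (r *\<^sub>R h))) (at x)" by simp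
  then show ?thesis by (auto simp: differentiable_def)
qed

text \<open>The scalar \<open>c\<close> in the invariant class absorbs the power of \<open>r\<close>
  that the chain rule produces.\<close>

lemma smooth_affine:
  assumes "smooth \<phi>"
  shows "smooth (\<lambda>x. \<phi> (a + r *\<^sub>R x))"
proof (rule smooth_coinduct[where P = "\<lambda>\<xi>. \<exists>c \<phi>. smooth \<phi> \<and> \<xi> = (\<lambda>x. c * \<phi> (a + r *\<^sub>R x))"], goal_cases)
  case 1
  then show ?case using assms by (intro exI[of _ 1] exI[of _ \<phi>]) auto
next
  case (2 \<xi> x)
  then obtain c \<phi> where \<phi>: "smooth \<phi>" "\<xi> = (\<lambda>x. c * \<phi> (a + r *\<^sub>R x))" by blast
  then show ?case
    using differentiable_mult[OF differentiable_const differentiable_affine[OF \<phi>(1)]] by blast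
next
  case (3 \<xi> i)
  then obtain c \<phi> where \<phi>: "smooth \<phi>" "\<xi> = (\<lambda>x. c * \<phi> (a + r *\<^sub>R x))" by blast
  have "partial_deriv i \<xi> = (\<lambda>x. of_real r * partial_deriv i (\<lambda>x. c * \<phi> x) (a + r *\<^sub>R x))"
    unfolding \<phi>(2) using partial_deriv_affine[OF smooth_cmult[OF \<phi>(1)]] .
  also have "partial_deriv i (\<lambda>x. c * \<phi> x) = (\<lambda>x. c * partial_deriv i \<phi> x)"
    using pderivs_cmult[OF \<phi>(1), of "[i]"] by (simp add: pderivs_Cons)
  finally show ?case using \<phi>(1) smooth_partial_deriv
    by (intro exI[of _ "of_real r * c"] exI[of _ "partial_deriv i \<phi>"]) (auto simp: mult.assoc)
qed

lemma pderivs_affine: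
  assumes "smooth \<phi>"
  shows "pderivs is (\<lambda>x. \<phi> (a + r *\<^sub>R x)) = (\<lambda>x. of_real (r ^ length is) * pderivs is \<phi> (a + r *\<^sub>R x))"
proof (induction "is")
  case (Cons i "is")
  have "partial_deriv i (\<lambda>x. of_real (r ^ length is) * pderivs is \<phi> (a + r *\<^sub>R x))
    = (\<lambda>x. of_real (r ^ length is) * partial_deriv i (\<lambda>x. pderivs is \<phi> (a + r *\<^sub>R x)) x)"
    using pderivs_cmult[OF smooth_affine[OF smooth_pderivs[OF assms]], of "[i]"]
    by (simp add: pderivs_Cons)
  then show ?case
    by (simp add: pderivs_Cons Cons partial_deriv_affine smooth_pderivs assms mult_ac)
qed simp

text \<open>The sign is opposite to that of the Fourier kernel, which is therefore
  \<open>character (- y)\<close>. Naming the exponential turns modulations, translations and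
  trigonometric polynomials into statements about one object.\<close>

definition character :: "real^'d::finite \<Rightarrow> real^'d \<Rightarrow> complex" where
  "character t y = exp (2 * of_real pi * \<i> * of_real (t \<bullet> y))"

lemma character_has_derivative:
  "((\<lambda>y. c * character t y) has_derivative
     (\<lambda>h. 2 * of_real pi * \<i> * of_real (t \<bullet> h) * (c * character t y))) (at y)"
proof -
  have *: "((\<lambda>y. 2 * of_real pi * \<i> * complex_of_real (t \<bullet> y)) has_derivative
     (\<lambda>h. 2 * of_real pi * \<i> * complex_of_real (t \<bullet> h))) (at y)"
    by (intro has_derivative_mult_right has_derivative_of_real has_derivative_inner_right
        has_derivative_ident)
  have "((\<lambda>y. c * exp (2 * of_real pi * \<i> * complex_of_real (t \<bullet> y))) has_derivative
     (\<lambda>h. c * (2 * of_real pi * \<i> * complex_of_real (t \<bullet> h)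
       * exp (2 * of_real pi * \<i> * complex_of_real (t \<bullet> y))))) (at y)"
    using has_derivative_compose[OF * DERIV_exp[unfolded has_field_derivative_def]]
    by (intro has_derivative_mult_right) (simp add: mult.commute)
  then show ?thesis by (simp add: character_def mult_ac)
qed

lemma partial_deriv_character:
  "partial_deriv i (\<lambda>y. c * character t y)
    = (\<lambda>y. 2 * of_real pi * \<i> * of_real (t $ i) * c * character t y)"
  using partial_deriv_eq[OF character_has_derivative, of i]
  by (auto simp: inner_axis mult_ac)

lemma smooth_character: "smooth (character t)"
proof (rule smooth_coinduct[where P = "\<lambda>\<xi>. \<exists>c. \<xi> = (\<lambda>y. c * character t y)"], goal_cases)
  case 1
  then show ?case by (intro exI[of _ 1]) auto
next
  case (2 \<xi> x)
  then show ?case using character_has_derivative by (auto simp: differentiable_def)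
next
  case (3 \<xi> i)
  then show ?case using partial_deriv_character by blast
qed

lemma norm_character [simp]: "cmod (character t y) = 1"
  by (simp add: character_def)

lemma character_add: "character (s + t) y = character s y * character t y"
  by (simp add: character_def inner_add_left exp_add[symmetric] algebra_simps)

lemma character_commute: "character t y = character y t"
  by (simp add: character_def inner_commute)

lemma character_zero [simp]: "character 0 y = 1"
  by (simp add: character_def)

lemma continuous_character [continuous_intros]: "continuous_on S (character t)"
  by (rule smooth_continuous_on[OF smooth_character])

lemma norm_pderivs_character: "\<exists>A. \<forall>y. cmod (pderivs is (character t) y) \<le> A"
proof -
  have "\<exists>c. pderivs is (character t) = (\<lambda>y. c * character t y)"
  proof (induction "is")
    case Nil
    then show ?case by (intro exI[of _ 1]) simp
  next
    case (Cons i "is")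
    then obtain c where "pderivs is (character t) = (\<lambda>y. c * character t y)" by blast
    then show ?case by (auto simp: pderivs_Cons partial_deriv_character)
  qed
  then show ?thesis by (force simp: norm_mult)
qed

lemma coord_has_derivative:
  "((\<lambda>x::real^'d::finite. complex_of_real (x $ j)) has_derivative (\<lambda>h. complex_of_real (h $ j))) (at x)"
  using bounded_linear_compose[OF bounded_linear_of_real bounded_linear_vec_nth]
  by (rule bounded_linear_imp_has_derivative)

lemma partial_deriv_coord:
  "partial_deriv i (\<lambda>x::real^'d::finite. of_real (x $ j)) = (\<lambda>x. if i = j then 1 else 0)"
  using partial_deriv_eq[OF coord_has_derivative, of i] by (auto simp: axis_def fun_eq_iff)

lemma smooth_coord: "smooth (\<lambda>x::real^'d::finite. of_real (x $ j))"
  unfolding smooth_iff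
proof (intro allI)
  fix "is" x
  show "pderivs is (\<lambda>x::real^'d::finite. of_real (x $ j)) differentiable (at x)"
  \<comment> \<open>The last list entry is the derivative taken first, and it already turns the
    coordinate into a constant.\<close>
  proof (cases "is" rule: rev_exhaust)
    case Nil
    then show ?thesis using coord_has_derivative by (auto simp: differentiable_def)
  next
    case (snoc js i)
    have "smooth (\<lambda>x::real^'d. if i = j then 1 else 0)" by (rule smooth_const)
    then show ?thesis
      by (simp only: snoc smooth_iff pderivs_append pderivs_Cons partial_deriv_coord pderivs_Nil)
  qed
qed

subsection \<open>Symmetry of the partial derivatives\<close>

lemma has_vector_derivative_bound:
  fixes g :: "real \<Rightarrow> 'a::real_normed_vector"
  assumes "0 \<le> h" "\<And>s. 0 \<le> s \<Longrightarrow> s \<le> h \<Longrightarrow> (g has_vector_derivative g' s) (at s)"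
    and "\<And>s. 0 \<le> s \<Longrightarrow> s \<le> h \<Longrightarrow> norm (g' s) \<le> B"
  shows "norm (g h - g 0) \<le> B * h"
proof -
  have "norm (g h - g 0) \<le> B * norm (h - 0)"
  proof (rule differentiable_bound[where S = "{0..h}" and f' = "\<lambda>s t. t *\<^sub>R g' s"])
    fix s assume "s \<in> {0..h}"
    then show "(g has_derivative (\<lambda>t. t *\<^sub>R g' s)) (at s within {0..h})"
      using assms(2)[of s] by (auto simp: has_vector_derivative_def intro: has_derivative_at_withinI)
    show "onorm (\<lambda>t. t *\<^sub>R g' s) \<le> B"
      using assms(3)[of s] \<open>s \<in> {0..h}\<close>
      by (intro onorm_le) (auto simp: mult.commute[of B] intro: mult_left_mono)
  qed (use assms(1) in auto)
  then show ?thesis using assms(1) by simp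
qed

lemma partial_deriv_line:
  assumes "smooth \<phi>"
  shows "((\<lambda>s. \<phi> (p + s *\<^sub>R axis i 1)) has_vector_derivative partial_deriv i \<phi> (p + s *\<^sub>R axis i 1)) (at s)"
proof -
  let ?q = "p + s *\<^sub>R axis i 1"
  obtain F where F: "(\<phi> has_derivative F) (at ?q)"
    using smooth_differentiable[OF assms, of ?q] unfolding differentiable_def by blast
  have "((\<lambda>s. p + s *\<^sub>R axis i 1) has_derivative (\<lambda>t. t *\<^sub>R axis i 1)) (at s)"
    by (auto intro!: derivative_eq_intros)
  from has_derivative_compose[OF this, of \<phi> F] F
  have "((\<lambda>s. \<phi> (p + s *\<^sub>R axis i 1)) has_derivative (\<lambda>t. F (t *\<^sub>R axis i 1))) (at s)" by simp
  moreover have "F (t *\<^sub>R axis i 1) = t *\<^sub>R partial_deriv i \<phi> ?q" for t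
    using linear_scale[OF has_derivative_linear[OF F]] partial_deriv_eq[OF F] by simp
  ultimately show ?thesis by (simp add: has_vector_derivative_def)
qed

text \<open>Two nested mean value estimates, along \<open>i\<close> and then along \<open>j\<close>.
  The second difference is symmetric in \<open>i\<close> and \<open>j\<close>, so it can be compared
  with both mixed derivatives.\<close>

lemma second_difference_bound:
  assumes "smooth \<phi>" "0 \<le> h"
    and "\<And>s u. 0 \<le> s \<Longrightarrow> s \<le> h \<Longrightarrow> 0 \<le> u \<Longrightarrow> u \<le> h \<Longrightarrow>
      cmod (partial_deriv j (partial_deriv i \<phi>) (x + s *\<^sub>R axis i 1 + u *\<^sub>R axis j 1) - c) \<le> \<epsilon>"
  shows "cmod (\<phi> (x + h *\<^sub>R axis i 1 + h *\<^sub>R axis j 1) - \<phi> (x + h *\<^sub>R axis i 1)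
      - \<phi> (x + h *\<^sub>R axis j 1) + \<phi> x - of_real (h * h) * c) \<le> \<epsilon> * h * h"
proof -
  \<comment> \<open>The term linear in \<open>s\<close> is subtracted so that the derivative of
    \<open>?G\<close> is small rather than close to \<open>h * c\<close>.\<close>
  let ?G = "\<lambda>s. \<phi> ((x + h *\<^sub>R axis j 1) + s *\<^sub>R axis i 1) - \<phi> (x + s *\<^sub>R axis i 1) - s *\<^sub>R (of_real h * c)"
  let ?G' = "\<lambda>s. partial_deriv i \<phi> ((x + h *\<^sub>R axis j 1) + s *\<^sub>R axis i 1)
      - partial_deriv i \<phi> (x + s *\<^sub>R axis i 1) - of_real h * c"
  have "norm (?G h - ?G 0) \<le> (\<epsilon> * h) * h"
  proof (rule has_vector_derivative_bound[where g' = ?G'])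
    fix s :: real assume s: "0 \<le> s" "s \<le> h"
    show "(?G has_vector_derivative ?G' s) (at s)"
      by (intro has_vector_derivative_diff partial_deriv_line assms)
        (auto intro!: derivative_eq_intros)
    let ?H = "\<lambda>u. partial_deriv i \<phi> ((x + s *\<^sub>R axis i 1) + u *\<^sub>R axis j 1) - u *\<^sub>R c"
    have "norm (?H h - ?H 0) \<le> \<epsilon> * h"
    proof (rule has_vector_derivative_bound[where
          g' = "\<lambda>u. partial_deriv j (partial_deriv i \<phi>) ((x + s *\<^sub>R axis i 1) + u *\<^sub>R axis j 1) - c"])
      fix u :: real assume "0 \<le> u" "u \<le> h"
      then show "cmod (partial_deriv j (partial_deriv i \<phi>) ((x + s *\<^sub>R axis i 1) + u *\<^sub>R axis j 1) - c) \<le> \<epsilon>"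
        using assms(3) s by blast
      show "(?H has_vector_derivative
          partial_deriv j (partial_deriv i \<phi>) ((x + s *\<^sub>R axis i 1) + u *\<^sub>R axis j 1) - c) (at u)"
        by (intro has_vector_derivative_diff partial_deriv_line smooth_partial_deriv assms)
          (auto intro!: derivative_eq_intros)
    qed (use assms in auto)
    then show "norm (?G' s) \<le> \<epsilon> * h"
      by (simp add: algebra_simps scaleR_conv_of_real[where 'a = complex])
  qed (use assms in auto)
  then show ?thesis
    by (simp add: algebra_simps scaleR_conv_of_real[where 'a = complex])
qed

text \<open>Schwarz's theorem: after division by h^2 the second difference over a small square is
  within \<epsilon>/2 of either mixed derivative, both being continuous.\<close>

lemma partial_deriv_commute:
  assumes "smooth \<phi>"
  shows "partial_deriv i (partial_deriv j \<phi>) = partial_deriv j (partial_deriv i \<phi>)"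
proof
  fix x
  let ?a = "partial_deriv i (partial_deriv j \<phi>)" and ?b = "partial_deriv j (partial_deriv i \<phi>)"
  have "cmod (?a x - ?b x) \<le> \<epsilon>" if \<epsilon>: "0 < \<epsilon>" for \<epsilon>
  proof -
    have "isCont ?a x" "isCont ?b x"
      using smooth_partial_deriv[OF smooth_partial_deriv[OF assms]]
      by (auto intro: differentiable_imp_continuous_within smooth_differentiable)
    then obtain d1 d2 where d: "0 < d1" "\<And>y. dist y x < d1 \<Longrightarrow> dist (?a y) (?a x) < \<epsilon> / 2"
       "0 < d2" "\<And>y. dist y x < d2 \<Longrightarrow> dist (?b y) (?b x) < \<epsilon> / 2"
      using \<epsilon> unfolding continuous_at_eps_delta by (metis half_gt_zero)
    \<comment> \<open>Points of the square move by at most 2h, so a third of the radius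
      suffices.\<close>
    define h where "h = min d1 d2 / 3"
    have h: "0 < h" using d by (simp add: h_def)
    have near: "dist (x + s *\<^sub>R axis i 1 + u *\<^sub>R axis j 1) x < min d1 d2"
      if "0 \<le> s" "s \<le> h" "0 \<le> u" "u \<le> h" for s u i j
    proof -
      have "dist (x + s *\<^sub>R axis i 1 + u *\<^sub>R axis j 1) x \<le> norm (s *\<^sub>R axis i (1::real)) + norm (u *\<^sub>R axis j (1::real))"
        unfolding dist_norm by (simp only: add.assoc add_diff_cancel_left') (rule norm_triangle_ineq)
      also have "\<dots> \<le> h + h" using that by simp
      also have "\<dots> < min d1 d2" using d by (simp add: h_def min_def)
      finally show ?thesis .
    qed
    let ?D = "\<phi> (x + h *\<^sub>R axis i 1 + h *\<^sub>R axis j 1) - \<phi> (x + h *\<^sub>R axis i 1)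
      - \<phi> (x + h *\<^sub>R axis j 1) + \<phi> x"
    have 1: "cmod (?D - of_real (h * h) * ?b x) \<le> (\<epsilon> / 2) * h * h"
    proof (rule second_difference_bound[OF assms])
      fix s u assume "0 \<le> s" "s \<le> h" "0 \<le> u" "u \<le> h"
      from near[OF this] show "cmod (?b (x + s *\<^sub>R axis i 1 + u *\<^sub>R axis j 1) - ?b x) \<le> \<epsilon> / 2"
        using d(4)[of "x + s *\<^sub>R axis i 1 + u *\<^sub>R axis j 1"] by (auto simp: dist_norm)
    qed (use h in simp)
    have 2: "cmod (\<phi> (x + h *\<^sub>R axis j 1 + h *\<^sub>R axis i 1) - \<phi> (x + h *\<^sub>R axis j 1)
      - \<phi> (x + h *\<^sub>R axis i 1) + \<phi> x - of_real (h * h) * ?a x) \<le> (\<epsilon> / 2) * h * h"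
    proof (rule second_difference_bound[OF assms])
      fix s u assume "0 \<le> s" "s \<le> h" "0 \<le> u" "u \<le> h"
      from near[OF this] show "cmod (?a (x + s *\<^sub>R axis j 1 + u *\<^sub>R axis i 1) - ?a x) \<le> \<epsilon> / 2"
        using d(2)[of "x + s *\<^sub>R axis j 1 + u *\<^sub>R axis i 1"] by (auto simp: dist_norm)
    qed (use h in simp)
    have eq: "of_real (h * h) * (?a x - ?b x) = (?D - of_real (h * h) * ?b x)
      - (\<phi> (x + h *\<^sub>R axis j 1 + h *\<^sub>R axis i 1) - \<phi> (x + h *\<^sub>R axis j 1)
      - \<phi> (x + h *\<^sub>R axis i 1) + \<phi> x - of_real (h * h) * ?a x)"
      by (simp add: algebra_simps)
    have "cmod (of_real (h * h) * (?a x - ?b x)) \<le> (\<epsilon> / 2) * h * h + (\<epsilon> / 2) * h * h"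
      unfolding eq by (rule order_trans[OF norm_triangle_ineq4 add_mono[OF 1 2]])
    moreover have "cmod (of_real (h * h) * (?a x - ?b x)) = (h * h) * cmod (?a x - ?b x)"
      unfolding norm_mult[of "of_real (h * h)"] norm_of_real using h by simp
    ultimately have "(h * h) * cmod (?a x - ?b x) \<le> (h * h) * \<epsilon>"
      by (simp add: mult_ac)
    then show ?thesis using h by simp
  qed
  then have "cmod (?a x - ?b x) \<le> 0" by (rule field_le_epsilon) simp
  then show "?a x = ?b x" by simp
qed

lemma pderivs_move:
  "smooth \<phi> \<Longrightarrow> pderivs (a @ i # b) \<phi> = pderivs (i # a @ b) \<phi>"
proof (induction a)
  case (Cons j a)
  then show ?case
    by (simp add: pderivs_Cons pderivs_append partial_deriv_commute smooth_pderivs)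
qed simp

lemma pderivs_cong_mset:
  assumes "smooth \<phi>" "mset is = mset js"
  shows "pderivs is \<phi> = pderivs js \<phi>"
  using assms(2)
proof (induction "is" arbitrary: js)
  case (Cons i "is")
  then have "i \<in> set js" by (metis list.set_intros(1) mset_eq_setD)
  then obtain a b where js: "js = a @ i # b" by (meson split_list)
  with Cons.prems have "mset is = mset (a @ b)" by simp
  from Cons.IH[OF this] show ?case
    unfolding js pderivs_move[OF assms(1)] by (simp add: pderivs_Cons)
qed simp

subsection \<open>Multi-indices as lists\<close>

text \<open>The word of coordinates along which \<open>multi_deriv k\<close> differentiates. Lists
  suit induction on the order of a derivative; \<open>mi_list\<close> and \<open>count_list\<close>
  translate between them and the multi-indices of the definitions.\<close>

definition mi_list :: "('d::finite \<Rightarrow> nat) \<Rightarrow> 'd list" where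
  "mi_list k = concat (map (\<lambda>i. replicate (k i) i) coords)"

lemma coords: "distinct (coords :: 'd::finite list)" "set (coords :: 'd list) = UNIV"
proof -
  have "\<exists>xs::'d list. distinct xs \<and> set xs = UNIV"
    using finite_distinct_list[OF finite_class.finite_UNIV] by blast
  then have "distinct (coords :: 'd::finite list) \<and> set (coords :: 'd list) = UNIV"
    unfolding coords_def by (rule someI_ex)
  then show "distinct (coords :: 'd::finite list)" "set (coords :: 'd list) = UNIV" by auto
qed

lemma multi_deriv_eq: "multi_deriv k \<phi> = pderivs (mi_list k) \<phi>"
proof -
  have *: "(partial_deriv i ^^ n) \<psi> = pderivs (replicate n i) \<psi>" for n i and \<psi> :: "real^'a \<Rightarrow> complex"
    by (induction n) (auto simp: pderivs_Cons)
  have "foldr (\<lambda>i. partial_deriv i ^^ k i) xs \<phi> = pderivs (concat (map (\<lambda>i. replicate (k i) i) xs)) \<phi>" for xs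
    by (induction xs) (auto simp: pderivs_append *)
  then show ?thesis by (simp add: multi_deriv_def mi_list_def)
qed

lemma length_mi_list: "length (mi_list k) = mi_abs k"
  unfolding mi_list_def mi_abs_def
  by (simp add: length_concat comp_def sum_list_distinct_conv_sum_set coords)

lemma count_mi_list: "count_list (mi_list k) i = k i"
proof -
  have *: "count_list (replicate n j) i = (if i = j then n else 0)" for n and j :: 'a
    by (induction n) auto
  have "count_list (concat xss) i = (\<Sum>xs\<leftarrow>xss. count_list xs i)" for xss
    by (induction xss) auto
  then show ?thesis
    by (simp add: mi_list_def comp_def * sum_list_distinct_conv_sum_set coords)
qed

lemma mset_mi_list_count_list: "mset (mi_list (count_list is)) = mset is"
  by (rule multiset_eqI) (simp add: count_mset count_mi_list)

text \<open>The two words agree as multisets, so symmetry of the partial derivatives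
  applies.\<close>

lemma pderivs_eq_multi_deriv:
  "smooth \<phi> \<Longrightarrow> pderivs is \<phi> = multi_deriv (count_list is) \<phi>"
  unfolding multi_deriv_eq by (rule pderivs_cong_mset) (simp_all add: mset_mi_list_count_list)

lemma mi_abs_count_list: "mi_abs (count_list is) = length is"
  by (metis length_mi_list mset_mi_list_count_list size_mset)

lemma finite_mi_abs_le: "finite {k::'d::finite \<Rightarrow> nat. mi_abs k \<le> m}"
proof (rule finite_subset)
  show "{k::'d \<Rightarrow> nat. mi_abs k \<le> m} \<subseteq> count_list ` {is. set is \<subseteq> UNIV \<and> length is \<le> m}"
  proof
    fix k :: "'d \<Rightarrow> nat" assume "k \<in> {k. mi_abs k \<le> m}"
    moreover have "k = count_list (mi_list k)" by (simp add: count_mi_list fun_eq_iff)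
    ultimately show "k \<in> count_list ` {is. set is \<subseteq> UNIV \<and> length is \<le> m}"
      by (metis (mono_tags, lifting) imageI length_mi_list mem_Collect_eq subset_UNIV)
  qed
qed (intro finite_imageI finite_lists_length_le finite_class.finite_UNIV)

subsection \<open>Smooth functions of one variable\<close>

text \<open>One-variable bricks for explicit test functions: in a product over the coordinates each
  partial derivative acts on one factor only.\<close>

definition smooth1 :: "(real \<Rightarrow> real) \<Rightarrow> bool" where
  "smooth1 u \<longleftrightarrow> (\<forall>n x. (deriv ^^ n) u differentiable (at x))"

lemma smooth1_coinduct:
  assumes "P u" and "\<And>u. P u \<Longrightarrow> \<exists>u'. (\<forall>x. (u has_real_derivative u' x) (at x)) \<and> P u'"
  shows "smooth1 u"
proof -
  have D: "P (deriv u)" if Pu: "P u" for u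
  proof -
    obtain u' where u': "\<forall>x. (u has_real_derivative u' x) (at x)" "P u'" using assms(2)[OF Pu] by blast
    then have "deriv u = u'" by (auto intro: DERIV_imp_deriv)
    with u' show ?thesis by simp
  qed
  have "P ((deriv ^^ n) u)" for n
    by (induction n) (use assms(1) D in auto)
  then show ?thesis unfolding smooth1_def
    by (metis assms(2) real_differentiable_def)
qed

lemma smooth1_has_deriv: "smooth1 u \<Longrightarrow> (u has_real_derivative deriv u x) (at x)"
  unfolding smooth1_def by (metis DERIV_deriv_iff_real_differentiable funpow_0)

lemma smooth1_deriv: "smooth1 u \<Longrightarrow> smooth1 (deriv u)"
  unfolding smooth1_def by (metis funpow_swap1 funpow_simps_right(2) comp_apply)

lemma smooth1_power: "smooth1 (\<lambda>x. c * x ^ n)"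
proof (rule smooth1_coinduct[where P = "\<lambda>u. \<exists>c n. u = (\<lambda>x. c * x ^ n)"], goal_cases)
  case (2 u)
  then obtain c n where u: "u = (\<lambda>x. c * x ^ n)" by blast
  then show ?case
    by (intro exI[of _ "\<lambda>x. (c * real n) * x ^ (n - 1)"]) (auto intro!: derivative_eq_intros)
qed blast

lemma smooth1_add: "smooth1 u \<Longrightarrow> smooth1 v \<Longrightarrow> smooth1 (\<lambda>x. u x + v x)"
proof (rule smooth1_coinduct[where P = "\<lambda>w. \<exists>u v. smooth1 u \<and> smooth1 v \<and> w = (\<lambda>x. u x + v x)"],
    goal_cases)
  case (2 w)
  then obtain u v where w: "w = (\<lambda>x. u x + v x)" "smooth1 u" "smooth1 v" by blast
  then show ?case
    by (intro exI[of _ "\<lambda>x. deriv u x + deriv v x"])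
      (auto intro!: derivative_eq_intros smooth1_has_deriv intro: smooth1_deriv)
qed blast

lemma smooth1_mult:
  assumes "smooth1 u" "smooth1 v" shows "smooth1 (\<lambda>x. u x * v x)"
proof (rule smooth1_coinduct[where P = "\<lambda>w. \<exists>ps. (\<forall>(u, v)\<in>set ps. smooth1 u \<and> smooth1 v) \<and>
      w = (\<lambda>x. \<Sum>(u, v)\<leftarrow>ps. u x * v x)"], goal_cases)
  case 1
  then show ?case using assms by (intro exI[of _ "[(u, v)]"]) auto
next
  case (2 w)
  then obtain ps where ps: "\<forall>(u, v)\<in>set ps. smooth1 u \<and> smooth1 v"
    "w = (\<lambda>x. \<Sum>(u, v)\<leftarrow>ps. u x * v x)" by blast
  define qs where "qs = concat (map (\<lambda>(u, v). [(deriv u, v), (u, deriv v)]) ps)"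
  have "\<forall>(u, v)\<in>set qs. smooth1 u \<and> smooth1 v"
    using ps(1) by (auto simp: qs_def intro: smooth1_deriv)
  moreover have "((\<lambda>x. \<Sum>(u, v)\<leftarrow>ps. u x * v x) has_real_derivative (\<Sum>(u, v)\<leftarrow>qs. u x * v x)) (at x)" for x
    unfolding qs_def using ps(1)
    by (induction ps) (auto intro!: derivative_eq_intros smooth1_has_deriv)
  ultimately show ?case unfolding ps(2)
    by (intro exI[of _ "\<lambda>x. \<Sum>(u, v)\<leftarrow>qs. u x * v x"] conjI allI exI[of _ qs]) auto
qed

lemma smooth1_affine: "smooth1 u \<Longrightarrow> smooth1 (\<lambda>x. u (a + b * x))"
proof (rule smooth1_coinduct[where P = "\<lambda>w. \<exists>c u. smooth1 u \<and> w = (\<lambda>x. c * u (a + b * x))"], goal_cases)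
  case 1
  then show ?case by (intro exI[of _ 1]) auto
next
  case (2 w)
  then obtain c u where w: "w = (\<lambda>x. c * u (a + b * x))" "smooth1 u" by blast
  have "((\<lambda>x. c * u (a + b * x)) has_real_derivative (c * b) * deriv u (a + b * x)) (at x)" for x
  proof -
    have "((\<lambda>x. a + b * x) has_real_derivative b) (at x)" by (auto intro!: derivative_eq_intros)
    from DERIV_cmult[OF DERIV_chain2[OF smooth1_has_deriv[OF w(2)] this], of c]
    show ?thesis by (simp add: mult_ac)
  qed
  then show ?case using w smooth1_deriv
    by (intro exI[of _ "\<lambda>x. (c * b) * deriv u (a + b * x)"] conjI allI exI[of _ "c * b"]
        exI[of _ "deriv u"]) auto
qed

text \<open>The quotients u / v^n with varying numerator and exponent are closed under
  differentiation: the new numerator is u' v - n u v' and the exponent grows by one.\<close>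

lemma smooth1_divide:
  assumes "smooth1 u" "smooth1 v" "\<And>x. v x \<noteq> 0"
  shows "smooth1 (\<lambda>x. u x / v x)"
proof (rule smooth1_coinduct[where P = "\<lambda>w. \<exists>u n. smooth1 u \<and> w = (\<lambda>x. u x / v x ^ n)"], goal_cases)
  case 1
  then show ?case using assms by (intro exI[of _ u] exI[of _ 1]) auto
next
  case (2 w)
  then obtain u n where w: "w = (\<lambda>x. u x / v x ^ n)" "smooth1 u" by blast
  \<comment> \<open>The factor \<open>x ^ 0\<close> gives the constant the shape required by
    \<open>smooth1_power\<close>.\<close>
  let ?n = "\<lambda>x. deriv u x * v x + (- real n * x ^ 0) * (u x * deriv v x)"
  have "(w has_real_derivative
      (\<lambda>x. deriv u x * v x + (- real n * x ^ 0) * (u x * deriv v x)) x / v x ^ Suc n) (at x)" for x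
  proof -
    have "(w has_real_derivative (deriv u x * v x ^ n - u x * (real n * v x ^ (n - 1) * deriv v x))
        / (v x ^ n * v x ^ n)) (at x)"
      unfolding w(1) using smooth1_has_deriv[OF w(2), of x] smooth1_has_deriv[OF assms(2), of x] assms(3)[of x]
      by (auto intro!: derivative_eq_intros)
    also have "(deriv u x * v x ^ n - u x * (real n * v x ^ (n - 1) * deriv v x)) / (v x ^ n * v x ^ n)
      = ?n x / v x ^ Suc n"
      using assms(3)[of x] by (cases n) (auto simp: field_simps)
    finally show ?thesis .
  qed
  moreover have "smooth1 (\<lambda>x. deriv u x * v x + (- real n * x ^ 0) * (u x * deriv v x))"
    by (intro smooth1_add smooth1_mult[of _ v] smooth1_mult[of _ "\<lambda>x. u x * deriv v x"]
        smooth1_mult[of u] smooth1_power smooth1_deriv assms w)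
  ultimately show ?case
    by (intro exI[of _ "\<lambda>x. (deriv u x * v x + (- real n * x ^ 0) * (u x * deriv v x)) / v x ^ Suc n"]
        conjI allI exI[of _ "\<lambda>x. deriv u x * v x + (- real n * x ^ 0) * (u x * deriv v x)"]
        exI[of _ "Suc n"]) auto
qed

section \<open>A smooth step and a plateau on the line\<close>

lemma poly_div_exp_tendsto_0: "((\<lambda>y::real. poly q y / exp y) \<longlongrightarrow> 0) at_top"
proof -
  have "((\<lambda>y::real. \<Sum>i\<le>degree q. coeff q i * (y ^ i / exp y)) \<longlongrightarrow> (\<Sum>i\<le>degree q. coeff q i * 0)) at_top"
    by (intro tendsto_sum tendsto_mult tendsto_const tendsto_power_div_exp_0)
  then show ?thesis by (simp add: poly_altdef sum_divide_distrib)
qed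

text \<open>The classical flat function exp(-1/x), with a polynomial in 1/x in front so that the
  class is closed under differentiation.\<close>

definition flat :: "real poly \<Rightarrow> real \<Rightarrow> real" where
  "flat p x = (if x \<le> 0 then 0 else poly p (1 / x) * exp (- 1 / x))"

text \<open>For x > 0 the derivative of p(1/x) exp(-1/x) is q(1/x) exp(-1/x) with q = X^2 (p - p');
  each \<open>pCons 0\<close> multiplies by X. At 0 the difference quotient tends to 0 from both
  sides.\<close>

lemma flat_has_derivative:
  "(flat p has_real_derivative flat (pCons 0 (pCons 0 (p - pderiv p))) x) (at x)"
proof -
  consider "x < 0" | "x = 0" | "x > 0" by linarith
  then show ?thesis
  proof cases
    case 1
    have "((\<lambda>x. 0) has_real_derivative 0) (at x)" by simp
    then have "(flat p has_real_derivative 0) (at x)"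
      by (rule has_field_derivative_transform_within_open[where S = "{..<0}"])
        (use 1 in \<open>auto simp: flat_def\<close>)
    then show ?thesis using 1 by (simp add: flat_def)
  next
    case 3
    have "((\<lambda>x. poly p (1 / x) * exp (- 1 / x)) has_real_derivative
      poly (pCons 0 (pCons 0 (p - pderiv p))) (1 / x) * exp (- 1 / x)) (at x)"
      using 3 by (auto intro!: derivative_eq_intros DERIV_chain2[OF poly_DERIV] simp: field_simps power2_eq_square)
    then have "(flat p has_real_derivative poly (pCons 0 (pCons 0 (p - pderiv p))) (1 / x) * exp (- 1 / x)) (at x)"
      by (rule has_field_derivative_transform_within_open[where S = "{0<..}"])
        (use 3 in \<open>auto simp: flat_def\<close>)
    then show ?thesis using 3 by (simp add: flat_def)
  next
    case 2
    have "((\<lambda>h. flat p h / h) \<longlongrightarrow> 0) (at_left 0)"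
      by (rule tendsto_eventually) (auto simp: eventually_at_filter flat_def)
    moreover have "((\<lambda>h. flat p h / h) \<longlongrightarrow> 0) (at_right 0)"
    proof -
      \<comment> \<open>With y = 1/h the difference quotient is y p(y) / exp y, and
        \<open>pCons 0 p\<close> is X p.\<close>
      have "((\<lambda>h. poly (pCons 0 p) (inverse h) / exp (inverse h)) \<longlongrightarrow> 0) (at_right (0::real))"
        by (rule filterlim_compose[OF poly_div_exp_tendsto_0 filterlim_inverse_at_top_right])
      then show ?thesis
        by (rule Lim_transform_eventually)
          (auto simp: eventually_at_filter flat_def exp_minus field_simps)
    qed
    ultimately have "((\<lambda>h. flat p h / h) \<longlongrightarrow> 0) (at 0)"
      by (simp add: filterlim_split_at)
    then show ?thesis using 2 by (simp add: DERIV_def flat_def)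
  qed
qed

lemma smooth1_flat: "smooth1 (flat p)"
  by (rule smooth1_coinduct[where P = "\<lambda>u. \<exists>p. u = flat p"]) (use flat_has_derivative in blast)+

text \<open>Equal to 0 for x <= 0 and to 1 for x >= 1. The denominator is positive because x and 1 -
  x are never both nonpositive.\<close>

definition step1 :: "real \<Rightarrow> real" where
  "step1 x = flat 1 x / (flat 1 x + flat 1 (1 - x))"

lemma flat_pos: "0 < x \<Longrightarrow> 0 < flat 1 x" "0 \<le> flat 1 x" "x \<le> 0 \<Longrightarrow> flat 1 x = 0"
  by (auto simp: flat_def)

lemma step1_denominator: "0 < flat 1 x + flat 1 (1 - x)"
  using flat_pos(1)[of x] flat_pos(1)[of "1 - x"] flat_pos(2)[of x] flat_pos(2)[of "1 - x"] by linarith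

lemma smooth1_step1: "smooth1 step1"
proof -
  have "smooth1 (\<lambda>x. flat 1 (1 + (-1) * x))" by (rule smooth1_affine[OF smooth1_flat])
  then have "smooth1 (\<lambda>x. flat 1 (1 - x))" by simp
  then show ?thesis unfolding step1_def[abs_def]
    using step1_denominator by (intro smooth1_divide smooth1_add smooth1_flat) (metis less_irrefl)+
qed

lemma step1_simps: "x \<le> 0 \<Longrightarrow> step1 x = 0" "1 \<le> x \<Longrightarrow> step1 x = 1" "0 \<le> step1 x"
  using step1_denominator[of x] flat_pos(2)[of x] by (auto simp: step1_def flat_pos(3))

text \<open>Equal to 1 on [-1, 1] and to 0 outside (-2, 2); these radii are the source of the factor
  2 in the support bounds below.\<close>

definition plateau1 :: "real \<Rightarrow> real" where
  "plateau1 x = step1 (2 - x) * step1 (2 + x)"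

lemma smooth1_plateau1: "smooth1 plateau1"
  unfolding plateau1_def[abs_def]
  using smooth1_affine[OF smooth1_step1, of 2 "-1"] smooth1_affine[OF smooth1_step1, of 2 1]
  by (intro smooth1_mult) simp_all

lemma plateau1_simps: "\<bar>x\<bar> \<le> 1 \<Longrightarrow> plateau1 x = 1" "2 \<le> \<bar>x\<bar> \<Longrightarrow> plateau1 x = 0" "0 \<le> plateau1 x"
proof -
  show "plateau1 x = 1" if "\<bar>x\<bar> \<le> 1"
    using that by (simp add: plateau1_def step1_simps(2) abs_le_iff)
  show "plateau1 x = 0" if "2 \<le> \<bar>x\<bar>"
  proof (cases "0 \<le> x")
    case True
    then show ?thesis using that step1_simps(1)[of "2 - x"] by (simp add: plateau1_def)
  next
    case False
    then show ?thesis using that step1_simps(1)[of "2 + x"] by (simp add: plateau1_def)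
  qed
  show "0 \<le> plateau1 x"
    by (simp add: plateau1_def step1_simps(3))
qed

lemma higher_deriv_monomial:
  "(deriv ^^ n) (\<lambda>x::real. x ^ k / fact k) = (\<lambda>x. if n \<le> k then x ^ (k - n) / fact (k - n) else 0)"
proof (induction n)
  case (Suc n)
  have "((\<lambda>x::real. if n \<le> k then x ^ (k - n) / fact (k - n) else 0) has_real_derivative
     (if Suc n \<le> k then x ^ (k - Suc n) / fact (k - Suc n) else 0)) (at x)" for x
  proof (cases "Suc n \<le> k")
    case True
    from le_Suc_ex[OF this] obtain j where k: "k = n + Suc j" by auto
    have "((\<lambda>x::real. x ^ Suc j / fact (Suc j)) has_real_derivative x ^ j / fact j) (at x)"
      using DERIV_cdivide[OF DERIV_pow[of "Suc j" x], of "fact (Suc j)"]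
      by (simp add: fact_Suc del: of_nat_Suc)
    then show ?thesis by (simp add: k del: fact_Suc)
  next
    case False
    then show ?thesis by (cases "k = n") auto
  qed
  then show ?case unfolding funpow.simps comp_apply Suc by (auto intro: DERIV_imp_deriv)
qed simp

text \<open>A Taylor monomial cut off away from 0: near 0 the plateau is 1, so the derivatives at 0
  single out the order \<open>k\<close>.\<close>

definition jet1 :: "nat \<Rightarrow> real \<Rightarrow> real" where
  "jet1 k x = x ^ k / fact k * plateau1 x"

lemma smooth1_jet1: "smooth1 (jet1 k)"
  unfolding jet1_def[abs_def]
  using smooth1_mult[OF smooth1_power[of "1 / fact k" k] smooth1_plateau1] by simp

lemma higher_deriv_jet1_0: "(deriv ^^ n) (jet1 k) 0 = (if n = k then 1 else 0)"
proof -
  have "eventually (\<lambda>x::real. x \<in> {-1<..<1}) (nhds 0)"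
    by (rule eventually_nhds_in_open) auto
  then have "eventually (\<lambda>x. jet1 k x = x ^ k / fact k) (nhds 0)"
    by (rule eventually_mono) (auto simp: jet1_def plateau1_simps)
  then have "(deriv ^^ n) (jet1 k) 0 = (deriv ^^ n) (\<lambda>x. x ^ k / fact k) 0"
    by (intro higher_deriv_cong_ev) auto
  then show ?thesis by (auto simp: higher_deriv_monomial)
qed

subsection \<open>Products of functions of one variable\<close>

definition tens :: "('d::finite \<Rightarrow> real \<Rightarrow> real) \<Rightarrow> real^'d \<Rightarrow> complex" where
  "tens u x = (\<Prod>i\<in>UNIV. of_real (u i (x $ i)))"

lemma tens_has_derivative:
  assumes "\<And>i. smooth1 (u i)"
  shows "(tens u has_derivative (\<lambda>h. \<Sum>i\<in>UNIV. of_real (h $ i * deriv (u i) (x $ i))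
      * (\<Prod>j\<in>UNIV - {i}. of_real (u j (x $ j))))) (at x)"
  unfolding tens_def[abs_def]
proof (rule has_derivative_prod)
  fix i :: 'a
  have "((\<lambda>x. u i (x $ i)) has_derivative (\<lambda>h. deriv (u i) (x $ i) * h $ i)) (at x)"
    using has_derivative_compose[OF bounded_linear_imp_has_derivative[OF bounded_linear_vec_nth]
        smooth1_has_deriv[OF assms, unfolded has_field_derivative_def]] .
  from has_derivative_of_real[OF this]
  show "((\<lambda>x. complex_of_real (u i (x $ i))) has_derivative
      (\<lambda>h. of_real (h $ i * deriv (u i) (x $ i)))) (at x)" by (simp only: mult.commute)
qed

lemma partial_deriv_tens:
  assumes "\<And>i. smooth1 (u i)"
  shows "partial_deriv i (tens u) = tens (u(i := deriv (u i)))"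
proof
  fix x
  have "partial_deriv i (tens u) x = (\<Sum>j\<in>UNIV. of_real (axis i 1 $ j * deriv (u j) (x $ j))
      * (\<Prod>l\<in>UNIV - {j}. of_real (u l (x $ l))))"
    by (rule partial_deriv_eq[OF tens_has_derivative[OF assms]])
  also have "\<dots> = (\<Sum>j\<in>UNIV. if j = i then of_real (deriv (u i) (x $ i))
      * (\<Prod>l\<in>UNIV - {i}. of_real (u l (x $ l))) else 0)"
    by (rule sum.cong) (auto simp: axis_def)
  also have "\<dots> = of_real (deriv (u i) (x $ i)) * (\<Prod>l\<in>UNIV - {i}. of_real (u l (x $ l)))" by simp
  also have "\<dots> = tens (u(i := deriv (u i))) x"
    unfolding tens_def prod.remove[OF finite_class.finite_UNIV UNIV_I[of i]] by (auto intro!: prod.cong)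
  finally show "partial_deriv i (tens u) x = tens (u(i := deriv (u i))) x" .
qed

lemma smooth_tens: "(\<And>i. smooth1 (u i)) \<Longrightarrow> smooth (tens u)"
proof (rule smooth_coinduct[where P = "\<lambda>\<xi>. \<exists>u. (\<forall>i. smooth1 (u i)) \<and> \<xi> = tens u"], goal_cases)
  case (2 \<xi> x)
  then show ?case using tens_has_derivative unfolding differentiable_def by blast
next
  case (3 \<xi> i)
  then obtain u where u: "\<forall>i. smooth1 (u i)" "\<xi> = tens u" by blast
  then have "partial_deriv i \<xi> = tens (u(i := deriv (u i)))" using partial_deriv_tens[of u] by blast
  moreover have "\<forall>j. smooth1 ((u(i := deriv (u i))) j)" using u(1) smooth1_deriv by simp
  ultimately show ?case by blast
qed blast

lemma smooth1_higher_deriv: "smooth1 u \<Longrightarrow> smooth1 ((deriv ^^ n) u)"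
  by (induction n) (auto intro: smooth1_deriv)

lemma pderivs_tens:
  assumes "\<And>i. smooth1 (u i)"
  shows "pderivs is (tens u) = tens (\<lambda>i. (deriv ^^ count_list is i) (u i))"
proof (induction "is")
  case (Cons j "is")
  have "pderivs (j # is) (tens u) = tens ((\<lambda>i. (deriv ^^ count_list is i) (u i))
      (j := deriv ((deriv ^^ count_list is j) (u j))))"
    unfolding pderivs_Cons Cons by (rule partial_deriv_tens) (intro smooth1_higher_deriv assms)
  also have "(\<lambda>i. (deriv ^^ count_list is i) (u i)) (j := deriv ((deriv ^^ count_list is j) (u j)))
      = (\<lambda>i. (deriv ^^ count_list (j # is) i) (u i))"
    by (auto simp: fun_eq_iff)
  finally show ?case .
qed simp

subsection \<open>Cutoff functions and test functions\<close>

text \<open>These functions are dual to the derivatives at the origin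
  (\<open>pderivs_jet_0\<close>), so pairing with them reads off single coefficients of a sum of
  derivatives of point masses.\<close>

definition jet :: "('d::finite \<Rightarrow> nat) \<Rightarrow> real^'d \<Rightarrow> complex" where
  "jet k = tens (\<lambda>i. jet1 (k i))"

lemma smooth_jet: "smooth (jet k)"
  unfolding jet_def by (intro smooth_tens smooth1_jet1)

lemma pderivs_jet_0: "pderivs is (jet k) 0 = (if count_list is = k then 1 else 0)"
proof -
  have "pderivs is (jet k) 0 = (\<Prod>i\<in>UNIV. of_real (if count_list is i = k i then 1 else 0))"
    unfolding jet_def pderivs_tens[OF smooth1_jet1] tens_def
    by (intro prod.cong) (auto simp: higher_deriv_jet1_0)
  also have "\<dots> = (if count_list is = k then 1 else 0)"
    by (auto simp: fun_eq_iff prod_zero_iff)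
  finally show ?thesis .
qed

text \<open>If all coordinates were below 2 in absolute value, the l1 norm and hence the norm would
  be at most 2d. The radius \<open>2 * real CARD('d)\<close> recurs with every cutoff.\<close>

lemma jet_eq_0:
  fixes x :: "real^'d::finite"
  assumes "2 * real CARD('d) < norm x"
  shows "jet k x = 0"
proof -
  have "\<exists>i. 2 \<le> \<bar>x $ i\<bar>"
  proof (rule ccontr)
    assume "\<nexists>i. 2 \<le> \<bar>x $ i\<bar>"
    then have "(\<Sum>i\<in>UNIV. \<bar>x $ i\<bar>) \<le> (\<Sum>i\<in>(UNIV::'d set). 2)"
      by (intro sum_mono) (meson linear)
    with norm_le_l1_cart[of x] assms show False by simp
  qed
  then obtain i where "2 \<le> \<bar>x $ i\<bar>" by blast
  from plateau1_simps(2)[OF this] have "jet1 (k i) (x $ i) = 0" by (simp add: jet1_def)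
  then show ?thesis
    unfolding jet_def tens_def by (intro prod_zero) auto
qed

text \<open>\<open>jet\<close> with index 0 is the plain plateau, so this is 1 on the ball of radius
  \<open>r\<close> around \<open>a\<close> and 0 beyond \<open>2 * real CARD('d) * r\<close>. The
  argument is written as an affine map to match \<open>pderivs_affine\<close>.\<close>

definition cutoff :: "real^'d::finite \<Rightarrow> real \<Rightarrow> real^'d \<Rightarrow> complex" where
  "cutoff a r x = jet (\<lambda>_. 0) (- (1 / r) *\<^sub>R a + (1 / r) *\<^sub>R x)"

lemma jet_0_eq_1: "norm x \<le> 1 \<Longrightarrow> jet (\<lambda>_. 0) x = 1"
  using component_le_norm_cart[of x] unfolding jet_def tens_def
  by (intro prod.neutral) (auto simp: jet1_def intro!: plateau1_simps intro: order_trans)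

lemma cutoff_arg: "- (1 / r) *\<^sub>R a + (1 / r) *\<^sub>R x = (1 / r) *\<^sub>R (x - a :: real^'d::finite)"
  by (simp add: scaleR_diff_right)

lemma cutoff_eq_1: "0 < r \<Longrightarrow> dist a x \<le> r \<Longrightarrow> cutoff a r x = 1"
  unfolding cutoff_def cutoff_arg
  by (rule jet_0_eq_1) (simp add: dist_norm norm_minus_commute)

lemma cutoff_eq_0:
  fixes x :: "real^'d::finite"
  shows "0 < r \<Longrightarrow> 2 * real CARD('d) * r < dist a x \<Longrightarrow> cutoff a r x = 0"
  unfolding cutoff_def cutoff_arg
  by (rule jet_eq_0) (simp add: dist_norm norm_minus_commute pos_less_divide_eq)

lemma smooth_cutoff: "smooth (cutoff a r)"
  unfolding cutoff_def[abs_def] by (rule smooth_affine[OF smooth_jet])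

lemma fun_supp_subset: "closed S \<Longrightarrow> (\<And>x. x \<notin> S \<Longrightarrow> \<phi> x = 0) \<Longrightarrow> fun_supp \<phi> \<subseteq> S"
  unfolding fun_supp_def by (rule closure_minimal) auto

lemma not_in_fun_supp: "x \<notin> fun_supp \<phi> \<Longrightarrow> \<phi> x = 0"
  unfolding fun_supp_def using closure_subset[of "{x. \<phi> x \<noteq> 0}"] by blast

lemma not_in_fun_suppI:
  assumes "open U" "x \<in> U" "\<And>y. y \<in> U \<Longrightarrow> \<phi> y = 0"
  shows "x \<notin> fun_supp \<phi>"
  using fun_supp_subset[of "- U" \<phi>] assms by auto

lemma closed_fun_supp: "closed (fun_supp \<phi>)"
  by (simp add: fun_supp_def)

lemma test_functions_iff:
  "\<phi> \<in> test_functions \<longleftrightarrow> smooth \<phi> \<and> (\<exists>R. \<forall>x. R < norm x \<longrightarrow> \<phi> x = 0)"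
proof
  assume "\<phi> \<in> test_functions"
  then have s: "smooth \<phi>" and "bounded (fun_supp \<phi>)"
    by (auto simp: test_functions_def compact_imp_bounded)
  then obtain R where "\<And>x. x \<in> fun_supp \<phi> \<Longrightarrow> norm x \<le> R" unfolding bounded_iff by blast
  then have "\<forall>x. R < norm x \<longrightarrow> \<phi> x = 0" using not_in_fun_supp[of _ \<phi>] by (meson linorder_not_le)
  with s show "smooth \<phi> \<and> (\<exists>R. \<forall>x. R < norm x \<longrightarrow> \<phi> x = 0)" by blast
next
  assume "smooth \<phi> \<and> (\<exists>R. \<forall>x. R < norm x \<longrightarrow> \<phi> x = 0)"
  then obtain R where R: "smooth \<phi>" "\<And>x. R < norm x \<Longrightarrow> \<phi> x = 0" by blast
  have "fun_supp \<phi> \<subseteq> cball 0 R"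
    by (rule fun_supp_subset) (use R(2) in \<open>auto simp: not_le\<close>)
  then have "compact (fun_supp \<phi>)"
    by (metis compact_cball compact_Int_closed closed_fun_supp inf.absorb2)
  with R show "\<phi> \<in> test_functions" by (simp add: test_functions_def)
qed

lemma test_smooth: "\<phi> \<in> test_functions \<Longrightarrow> smooth \<phi>"
  by (simp add: test_functions_def)

lemma test_bound:
  assumes "\<phi> \<in> test_functions"
  obtains R where "0 < R" "\<And>x. R < norm x \<Longrightarrow> \<phi> x = 0"
proof -
  obtain R where "\<forall>x. R < norm x \<longrightarrow> \<phi> x = 0" using assms by (auto simp: test_functions_iff)
  then show ?thesis by (intro that[of "max R 1"]) auto
qed

lemma test_lin:
  assumes "\<phi> \<in> test_functions" "\<psi> \<in> test_functions"
  shows "(\<lambda>x. a * \<phi> x + b * \<psi> x) \<in> test_functions"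
proof -
  obtain R S where "\<And>x. R < norm x \<Longrightarrow> \<phi> x = 0" "\<And>x. S < norm x \<Longrightarrow> \<psi> x = 0"
    using test_bound assms by metis
  then have "\<forall>x. max R S < norm x \<longrightarrow> a * \<phi> x + b * \<psi> x = 0" by auto
  then show ?thesis using assms[THEN test_smooth] smooth_lin unfolding test_functions_iff by blast
qed

lemma test_mult:
  assumes "\<phi> \<in> test_functions" "smooth \<psi>"
  shows "(\<lambda>x. \<phi> x * \<psi> x) \<in> test_functions"
proof -
  obtain R where "\<And>x. R < norm x \<Longrightarrow> \<phi> x = 0" using test_bound assms by metis
  then have "\<forall>x. R < norm x \<longrightarrow> \<phi> x * \<psi> x = 0" by auto
  then show ?thesis using assms test_smooth smooth_mult unfolding test_functions_iff by blast
qed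

lemma test_zero: "(\<lambda>x. 0) \<in> test_functions"
  by (auto simp: test_functions_iff smooth_const)

lemma test_cmult: "\<phi> \<in> test_functions \<Longrightarrow> (\<lambda>x. a * \<phi> x) \<in> test_functions"
  and test_diff: "\<phi> \<in> test_functions \<Longrightarrow> \<psi> \<in> test_functions \<Longrightarrow> (\<lambda>x. \<phi> x - \<psi> x) \<in> test_functions"
  and test_add: "\<phi> \<in> test_functions \<Longrightarrow> \<psi> \<in> test_functions \<Longrightarrow> (\<lambda>x. \<phi> x + \<psi> x) \<in> test_functions"
  using test_lin[of \<phi> \<phi> a 0] test_lin[of \<phi> \<psi> 1 "-1"] test_lin[of \<phi> \<psi> 1 1] by simp_all

lemma test_sum: "(\<And>a. a \<in> A \<Longrightarrow> \<phi> a \<in> test_functions) \<Longrightarrow> (\<lambda>x. \<Sum>a\<in>A. \<phi> a x) \<in> test_functions"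
  by (induction A rule: infinite_finite_induct) (auto intro: test_zero test_add)

lemma test_affine:
  assumes "\<phi> \<in> test_functions" "r \<noteq> 0"
  shows "(\<lambda>x. \<phi> (a + r *\<^sub>R x)) \<in> test_functions"
proof -
  obtain R where R: "\<And>x. R < norm x \<Longrightarrow> \<phi> x = 0" using test_bound assms by metis
  have "\<phi> (a + r *\<^sub>R x) = 0" if "(R + norm a) / \<bar>r\<bar> < norm x" for x
  proof (rule R)
    have "R + norm a < norm (r *\<^sub>R x)" using that assms(2) by (simp add: field_simps)
    also have "\<dots> \<le> norm (a + r *\<^sub>R x) + norm a"
      using norm_triangle_ineq4[of "a + r *\<^sub>R x" a] by simp
    finally show "R < norm (a + r *\<^sub>R x)" by simp
  qed
  then show ?thesis using assms test_smooth smooth_affine unfolding test_functions_iff by blast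
qed

lemma test_shift: "\<phi> \<in> test_functions \<Longrightarrow> (\<lambda>x. \<phi> (x - t)) \<in> test_functions"
  using test_affine[of \<phi> 1 "- t"] by simp

lemma test_jet: "jet k \<in> test_functions"
  using smooth_jet jet_eq_0 unfolding test_functions_iff by blast

lemma test_cutoff: "r \<noteq> 0 \<Longrightarrow> cutoff a r \<in> test_functions"
  unfolding cutoff_def[abs_def] by (rule test_affine[OF test_jet]) simp

text \<open>\<open>frechet_derivative\<close> is a choice among the derivatives at the point, so it
  suffices that both functions have the same ones; this covers non-differentiable functions as
  well.\<close>

lemma partial_deriv_cong_open:
  assumes "open U" "x \<in> U" "\<And>y. y \<in> U \<Longrightarrow> \<phi> y = \<psi> y"
  shows "partial_deriv i \<phi> x = partial_deriv i \<psi> x"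
proof -
  have "(\<phi> has_derivative F) (at x) = (\<psi> has_derivative F) (at x)" for F
    using has_derivative_transform_within_open[of \<phi> F x UNIV U \<psi>]
      has_derivative_transform_within_open[of \<psi> F x UNIV U \<phi>] assms by auto
  then show ?thesis by (simp add: partial_deriv_def frechet_derivative_def)
qed

lemma pderivs_cong_open:
  assumes "open U" "x \<in> U" "\<And>y. y \<in> U \<Longrightarrow> \<phi> y = \<psi> y"
  shows "pderivs is \<phi> x = pderivs is \<psi> x"
  using assms(2)
proof (induction "is" arbitrary: x)
  case (Cons i "is")
  then show ?case unfolding pderivs_Cons by (intro partial_deriv_cong_open[OF assms(1)]) auto
qed (use assms in auto)

lemma pderivs_eq_0: "x \<notin> fun_supp \<phi> \<Longrightarrow> pderivs is \<phi> x = 0"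
  using pderivs_cong_open[of "- fun_supp \<phi>" x \<phi> "\<lambda>x. 0" "is"] closed_fun_supp[of \<phi>]
  by (auto simp: not_in_fun_supp)

lemma pderivs_eq_0_norm: "(\<And>x. R < norm x \<Longrightarrow> \<phi> x = 0) \<Longrightarrow> R < norm x \<Longrightarrow> pderivs is \<phi> x = 0"
  using pderivs_cong_open[of "{x. R < norm x}" x \<phi> "\<lambda>x. 0" "is",
      OF open_Collect_less[OF continuous_on_const continuous_on_norm_id]]
  by auto

lemma test_pderivs: "\<phi> \<in> test_functions \<Longrightarrow> pderivs is \<phi> \<in> test_functions"
  unfolding test_functions_iff using smooth_pderivs pderivs_eq_0_norm by blast

lemma finite_lists_le: "finite {is::'d::finite list. length is \<le> m}"
  using finite_lists_length_le[OF finite_class.finite_UNIV[where 'a = 'd], of m] by simp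

lemma smooth_bounded_on_compact:
  fixes \<phi> :: "real^'d::finite \<Rightarrow> complex"
  assumes "smooth \<phi>" "compact K"
  obtains M where "0 < M" "\<And>is x. length is \<le> m \<Longrightarrow> x \<in> K \<Longrightarrow> cmod (pderivs is \<phi> x) \<le> M"
proof -
  have "\<exists>M. \<forall>x\<in>K. cmod (pderivs is \<phi> x) \<le> M" for "is"
  proof -
    have "compact (pderivs is \<phi> ` K)"
      by (intro compact_continuous_image smooth_continuous_on smooth_pderivs assms)
    then show ?thesis using compact_imp_bounded[of "pderivs is \<phi> ` K"] by (auto simp: bounded_iff)
  qed
  then obtain B where B: "\<And>is x. x \<in> K \<Longrightarrow> cmod (pderivs is \<phi> x) \<le> B is" by metis
  \<comment> \<open>A sum over the finitely many lists replaces the maximum; the summand 1 makes the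
    bound positive.\<close>
  define M where "M = 1 + (\<Sum>is\<in>{is. length is \<le> m}. \<bar>B is\<bar>)"
  show thesis
  proof (rule that[of M])
    show "0 < M" unfolding M_def by (intro add_pos_nonneg sum_nonneg) auto
    fix "is" :: "'d list" and x assume "length is \<le> m" "x \<in> K"
    then have "\<bar>B is\<bar> \<le> (\<Sum>is\<in>{is. length is \<le> m}. \<bar>B is\<bar>)"
      using finite_lists_le by (intro member_le_sum) auto
    then show "cmod (pderivs is \<phi> x) \<le> M" using B[OF \<open>x \<in> K\<close>, of "is"] unfolding M_def by linarith
  qed
qed

lemma test_bounded:
  fixes \<phi> :: "real^'d::finite \<Rightarrow> complex"
  assumes "\<phi> \<in> test_functions"
  obtains M where "0 < M" "\<And>is x. length is \<le> m \<Longrightarrow> cmod (pderivs is \<phi> x) \<le> M"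
proof -
  obtain M where M: "0 < M" "\<And>is x. length is \<le> m \<Longrightarrow> x \<in> fun_supp \<phi> \<Longrightarrow> cmod (pderivs is \<phi> x) \<le> M"
    using smooth_bounded_on_compact[of \<phi> "fun_supp \<phi>" m] assms by (auto simp: test_functions_def)
  show thesis
    by (rule that[OF M(1)]) (metis M less_imp_le norm_zero pderivs_eq_0)
qed

subsection \<open>Localization of functionals at their support\<close>

text \<open>Captures what \<open>f\<close> and \<open>dist_fourier f\<close> share, so that
  localization at the support is proved once for both.\<close>

definition lin_on_test :: "((real^'d::finite \<Rightarrow> complex) \<Rightarrow> complex) \<Rightarrow> bool" where
  "lin_on_test F \<longleftrightarrow> (\<forall>\<phi>\<in>test_functions. \<forall>\<psi>\<in>test_functions. \<forall>a b.
     F (\<lambda>x. a * \<phi> x + b * \<psi> x) = a * F \<phi> + b * F \<psi>)"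

lemma lin_on_testD: "lin_on_test F \<Longrightarrow> \<phi> \<in> test_functions \<Longrightarrow> \<psi> \<in> test_functions \<Longrightarrow>
    F (\<lambda>x. a * \<phi> x + b * \<psi> x) = a * F \<phi> + b * F \<psi>"
  unfolding lin_on_test_def by blast

lemma lin_on_test_zero: "lin_on_test F \<Longrightarrow> F (\<lambda>x. 0) = 0"
  using lin_on_testD[of F "\<lambda>x. 0" "\<lambda>x. 0" 0 0] test_zero by simp

lemma lin_on_test_add: "lin_on_test F \<Longrightarrow> \<phi> \<in> test_functions \<Longrightarrow> \<psi> \<in> test_functions \<Longrightarrow>
    F (\<lambda>x. \<phi> x + \<psi> x) = F \<phi> + F \<psi>"
  and lin_on_test_diff: "lin_on_test F \<Longrightarrow> \<phi> \<in> test_functions \<Longrightarrow> \<psi> \<in> test_functions \<Longrightarrow>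
    F (\<lambda>x. \<phi> x - \<psi> x) = F \<phi> - F \<psi>"
  and lin_on_test_cmult: "lin_on_test F \<Longrightarrow> \<phi> \<in> test_functions \<Longrightarrow> F (\<lambda>x. a * \<phi> x) = a * F \<phi>"
  using lin_on_testD[of F \<phi> \<psi> 1 1] lin_on_testD[of F \<phi> \<psi> 1 "-1"] lin_on_testD[of F \<phi> \<phi> a 0] by simp_all

lemma lin_on_test_sum:
  "lin_on_test F \<Longrightarrow> (\<And>a. a \<in> A \<Longrightarrow> \<phi> a \<in> test_functions) \<Longrightarrow>
    F (\<lambda>x. \<Sum>a\<in>A. \<phi> a x) = (\<Sum>a\<in>A. F (\<phi> a))"
  by (induction A rule: infinite_finite_induct)
    (simp_all add: lin_on_test_zero lin_on_test_add[OF _ _ test_sum])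

text \<open>The definition of the support gives vanishing only near each point. A finite subcover of
  the compact support of \<open>\<phi>\<close> is used up one ball at a time, the cutoffs playing
  the role of a partition of unity.\<close>

lemma vanishes_off_dist_supp:
  fixes F :: "(real^'d::finite \<Rightarrow> complex) \<Rightarrow> complex"
  assumes F: "lin_on_test F" and "\<phi> \<in> test_functions" "fun_supp \<phi> \<inter> dist_supp F = {}"
  shows "F \<phi> = 0"
proof -
  let ?\<rho> = "2 * real CARD('d)"
  let ?van = "\<lambda>U. \<forall>\<phi>\<in>test_functions. fun_supp \<phi> \<subseteq> U \<longrightarrow> F \<phi> = 0"
  \<comment> \<open>The radius leaves room for the whole support of the cutoff, which exceeds the
    ball where the cutoff is 1 by the factor \<open>?\<rho>\<close>.\<close>
  have ex: "\<exists>r. 0 < r \<and> ?van (cball x (?\<rho> * r))" if x: "x \<in> fun_supp \<phi>" for x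
  proof -
    obtain U where U: "open U" "x \<in> U" "?van U"
      using x assms(3) unfolding dist_supp_def by blast
    obtain e where e: "0 < e" "cball x e \<subseteq> U" using U by (meson open_contains_cball)
    have "?van (cball x (?\<rho> * (e / ?\<rho>)))" using U(3) e(2) by auto
    moreover have "0 < e / ?\<rho>" using e(1) by simp
    ultimately show ?thesis by blast
  qed
  then obtain r where r: "\<And>x. x \<in> fun_supp \<phi> \<Longrightarrow> 0 < r x \<and> ?van (cball x (?\<rho> * r x))" by metis
  have "compact (fun_supp \<phi>)" using assms(2) by (simp add: test_functions_def)
  then obtain X where X: "X \<subseteq> fun_supp \<phi>" "finite X" "fun_supp \<phi> \<subseteq> (\<Union>x\<in>X. ball x (r x))"
    by (rule compactE_image[where C = "fun_supp \<phi>" and f = "\<lambda>x. ball x (r x)"]) (use r in \<open>auto intro!: bexI\<close>)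
  have "\<forall>\<psi>\<in>test_functions. fun_supp \<psi> \<subseteq> (\<Union>x\<in>X. ball x (r x)) \<longrightarrow> F \<psi> = 0"
    using X(2,1)
  proof (induction X rule: finite_induct)
    case empty
    show ?case
    proof (intro ballI impI)
      fix \<psi> assume "\<psi> \<in> test_functions" "fun_supp \<psi> \<subseteq> (\<Union>x\<in>{}. ball x (r x))"
      then have "\<psi> = (\<lambda>x. 0)" using not_in_fun_supp[of _ \<psi>] by auto
      then show "F \<psi> = 0" using lin_on_test_zero[OF F] by simp
    qed
  next
    case (insert x X)
    show ?case
    proof (intro ballI impI)
      fix \<psi> assume \<psi>: "\<psi> \<in> test_functions" "fun_supp \<psi> \<subseteq> (\<Union>x\<in>insert x X. ball x (r x))"
      have rx: "0 < r x" "?van (cball x (?\<rho> * r x))" using r insert.prems by auto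
      \<comment> \<open>The first piece lives where \<open>F\<close> vanishes; the second is zero on
        the ball around \<open>x\<close>, so the remaining balls cover its support.\<close>
      let ?a = "\<lambda>y. \<psi> y * cutoff x (r x) y" and ?b = "\<lambda>y. \<psi> y * (1 - cutoff x (r x) y)"
      have ab: "?a \<in> test_functions" "?b \<in> test_functions"
        by (intro test_mult \<psi>(1) smooth_cutoff smooth_diff smooth_const)+
      have "fun_supp ?a \<subseteq> cball x (?\<rho> * r x)"
        by (rule fun_supp_subset) (use cutoff_eq_0[OF rx(1)] in \<open>auto simp: not_le\<close>)
      with rx(2) ab(1) have 1: "F ?a = 0" by blast
      have "fun_supp ?b \<subseteq> fun_supp \<psi> \<inter> - ball x (r x)"
        using cutoff_eq_1[OF rx(1), of x] not_in_fun_supp[of _ \<psi>]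
        by (intro fun_supp_subset closed_Int closed_fun_supp) (auto simp: closed_def)
      with \<psi>(2) have "fun_supp ?b \<subseteq> (\<Union>x\<in>X. ball x (r x))" by auto
      with insert ab(2) have 2: "F ?b = 0" by blast
      have "F (\<lambda>y. ?a y + ?b y) = 0" using lin_on_test_add[OF F ab] 1 2 by simp
      then show "F \<psi> = 0" by (simp add: algebra_simps)
    qed
  qed
  with assms(2) X(3) show ?thesis by blast
qed

lemma discrete_set_finite_Int:
  assumes "discrete_set A" "bounded K"
  shows "finite (A \<inter> K)"
proof (rule ccontr)
  assume "infinite (A \<inter> K)"
  then obtain x where "x islimpt (A \<inter> K)"
    using bounded_infinite_imp_islimpt[of "A \<inter> K" "A \<inter> K"] assms(2) by (auto simp: bounded_subset)
  then have "x islimpt A" by (rule islimpt_subset) auto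
  with assms(1) show False by (simp add: discrete_set_def)
qed

text \<open>Chosen so that the whole support of \<open>cutoff a (r a)\<close>, not just the ball
  where it is 1, contains no other point of the set.\<close>

lemma discrete_set_isolating_radius:
  fixes A :: "(real^'d::finite) set"
  assumes "discrete_set A"
  obtains r where "\<And>a. 0 < r a" "\<And>a b. b \<in> A \<Longrightarrow> dist a b \<le> 2 * real CARD('d) * r a \<Longrightarrow> b = a"
proof -
  let ?\<rho> = "2 * real CARD('d)"
  have "\<exists>r>0. \<forall>b\<in>A. dist a b \<le> ?\<rho> * r \<longrightarrow> b = a" for a
  proof -
    obtain e where e: "0 < e" "\<And>b. b \<in> A \<Longrightarrow> b \<noteq> a \<Longrightarrow> \<not> dist b a < e"
      using assms unfolding discrete_set_def islimpt_approachable by blast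
    have "0 < e / (2 * ?\<rho>)" "?\<rho> * (e / (2 * ?\<rho>)) < e" using e(1) by simp_all
    with e(2) show ?thesis by (metis dist_commute order_le_less_trans)
  qed
  then obtain r where "\<And>a. 0 < r a \<and> (\<forall>b\<in>A. dist a b \<le> ?\<rho> * r a \<longrightarrow> b = a)" by metis
  then show thesis using that[of r] by blast
qed

text \<open>Each cutoff is 1 near its own centre and 0 near the other points of \<open>A\<close>, so
  the difference of \<open>\<phi>\<close> and the localized sum vanishes near \<open>A\<close> and
  is annihilated by \<open>F\<close>.\<close>

lemma localize_at_dist_supp:
  fixes F :: "(real^'d::finite \<Rightarrow> complex) \<Rightarrow> complex"
  assumes F: "lin_on_test F" and A: "A = dist_supp F" "discrete_set A" and \<phi>: "\<phi> \<in> test_functions"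
    and r: "\<And>a. 0 < r a" "\<And>a b. b \<in> A \<Longrightarrow> dist a b \<le> 2 * real CARD('d) * r a \<Longrightarrow> b = a"
  shows "F \<phi> = (\<Sum>a\<in>A \<inter> fun_supp \<phi>. F (\<lambda>x. \<phi> x * cutoff a (r a) x))"
proof -
  let ?S = "A \<inter> fun_supp \<phi>" and ?\<rho> = "2 * real CARD('d)"
  have fin: "finite ?S"
    using \<phi> A(2) by (intro discrete_set_finite_Int) (auto simp: test_functions_def compact_imp_bounded)
  have t: "(\<lambda>x. \<phi> x * cutoff a (r a) x) \<in> test_functions" for a
    by (intro test_mult \<phi> smooth_cutoff)
  let ?\<psi> = "\<lambda>x. \<phi> x - (\<Sum>a\<in>?S. \<phi> x * cutoff a (r a) x)"
  have "b \<notin> fun_supp ?\<psi>" if b: "b \<in> A" for b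
  proof (cases "b \<in> fun_supp \<phi>")
    case False
    have "\<phi> y = 0" if "y \<in> - fun_supp \<phi>" for y using that not_in_fun_supp by blast
    then show ?thesis
      using False by (intro not_in_fun_suppI[of "- fun_supp \<phi>"]) (auto simp: open_Compl closed_fun_supp)
  next
    case True
    \<comment> \<open>On this neighbourhood of \<open>b\<close> its own cutoff is 1 and the finitely
      many others vanish.\<close>
    let ?U = "ball b (r b) \<inter> (\<Inter>a\<in>?S - {b}. - cball a (?\<rho> * r a))"
    show ?thesis
    proof (rule not_in_fun_suppI[of ?U])
      show "open ?U" using fin by (intro open_Int open_ball open_INT) auto
      show "b \<in> ?U" using r(1) r(2)[OF b] by auto
      fix y assume y: "y \<in> ?U"
      have "(\<Sum>a\<in>?S. \<phi> y * cutoff a (r a) y) = \<phi> y * cutoff b (r b) y + (\<Sum>a\<in>?S - {b}. \<phi> y * cutoff a (r a) y)"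
        using fin b True by (intro sum.remove) auto
      also have "(\<Sum>a\<in>?S - {b}. \<phi> y * cutoff a (r a) y) = 0"
        using y cutoff_eq_0[OF r(1)] by (intro sum.neutral) (auto simp: not_le)
      also have "cutoff b (r b) y = 1" using y by (intro cutoff_eq_1 r(1)) auto
      finally show "?\<psi> y = 0" by simp
    qed
  qed
  then have "fun_supp ?\<psi> \<inter> dist_supp F = {}" using A by blast
  moreover have "?\<psi> \<in> test_functions" by (intro test_diff test_sum t \<phi>)
  ultimately have "F ?\<psi> = 0" using vanishes_off_dist_supp[OF F] by blast
  moreover have "F ?\<psi> = F \<phi> - (\<Sum>a\<in>?S. F (\<lambda>x. \<phi> x * cutoff a (r a) x))"
    using lin_on_test_diff[OF F \<phi> test_sum[of ?S "\<lambda>a x. \<phi> x * cutoff a (r a) x"]]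
      lin_on_test_sum[OF F, of ?S "\<lambda>a x. \<phi> x * cutoff a (r a) x"] t by simp
  ultimately show ?thesis by simp
qed

subsection \<open>Rapidly decreasing functions and the continuity estimate\<close>

text \<open>Schwartz functions, with derivatives along lists and plain existence of bounds in place
  of multi-indices and \<open>bdd_above\<close>.\<close>

definition rapid :: "(real^'d::finite \<Rightarrow> complex) \<Rightarrow> bool" where
  "rapid \<phi> \<longleftrightarrow> smooth \<phi> \<and> (\<forall>n is. \<exists>M. \<forall>x. (1 + norm x) ^ n * cmod (pderivs is \<phi> x) \<le> M)"

lemma rapid_smooth: "rapid \<phi> \<Longrightarrow> smooth \<phi>"
  by (simp add: rapid_def)

lemma rapid_schwartz: "rapid \<phi> \<Longrightarrow> \<phi> \<in> schwartz"
  unfolding rapid_def schwartz_def multi_deriv_eq bdd_above_def by auto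

lemma rapid_lin:
  assumes "rapid \<phi>" "rapid \<psi>"
  shows "rapid (\<lambda>x. a * \<phi> x + b * \<psi> x)"
  unfolding rapid_def
proof (intro conjI allI)
  show "smooth (\<lambda>x. a * \<phi> x + b * \<psi> x)" using assms rapid_smooth smooth_lin by blast
  fix n "is"
  obtain M N where M: "\<And>x. (1 + norm x) ^ n * cmod (pderivs is \<phi> x) \<le> M"
    and N: "\<And>x. (1 + norm x) ^ n * cmod (pderivs is \<psi> x) \<le> N"
    using assms unfolding rapid_def by metis
  have "(1 + norm x) ^ n * cmod (a * pderivs is \<phi> x + b * pderivs is \<psi> x) \<le> cmod a * M + cmod b * N" for x
  proof -
    have "(1 + norm x) ^ n * cmod (a * pderivs is \<phi> x + b * pderivs is \<psi> x)
        \<le> (1 + norm x) ^ n * (cmod a * cmod (pderivs is \<phi> x) + cmod b * cmod (pderivs is \<psi> x))"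
      by (intro mult_left_mono order_trans[OF norm_triangle_ineq]) (auto simp: norm_mult)
    also have "\<dots> = cmod a * ((1 + norm x) ^ n * cmod (pderivs is \<phi> x))
        + cmod b * ((1 + norm x) ^ n * cmod (pderivs is \<psi> x))" by (simp add: algebra_simps)
    also have "\<dots> \<le> cmod a * M + cmod b * N" by (intro add_mono mult_left_mono M N) auto
    finally show ?thesis .
  qed
  then show "\<exists>M. \<forall>x. (1 + norm x) ^ n * cmod (pderivs is (\<lambda>x. a * \<phi> x + b * \<psi> x) x) \<le> M"
    unfolding pderivs_lin[OF assms[THEN rapid_smooth]] by blast
qed

lemma rapid_diff: "rapid \<phi> \<Longrightarrow> rapid \<psi> \<Longrightarrow> rapid (\<lambda>x. \<phi> x - \<psi> x)"
  using rapid_lin[of \<phi> \<psi> 1 "-1"] by simp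

lemma test_rapid:
  assumes "\<phi> \<in> test_functions" shows "rapid \<phi>"
  unfolding rapid_def
proof (intro conjI allI)
  show "smooth \<phi>" using assms by (rule test_smooth)
  fix n and "is" :: "'a list"
  obtain R where R: "0 < R" "\<And>x. R < norm x \<Longrightarrow> \<phi> x = 0" using test_bound[OF assms] by blast
  obtain M where M: "0 < M" "\<And>js x. length js \<le> length is \<Longrightarrow> cmod (pderivs js \<phi> x) \<le> M"
    using test_bounded[OF assms, of "length is"] by blast
  have "(1 + norm x) ^ n * cmod (pderivs is \<phi> x) \<le> (1 + R) ^ n * M" for x
  proof (cases "R < norm x")
    case True
    have "pderivs is \<phi> x = 0" by (rule pderivs_eq_0_norm[OF _ True]) (rule R(2))
    then show ?thesis using R(1) M(1) by simp
  next
    case False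
    then show ?thesis using M R by (intro mult_mono power_mono) auto
  qed
  then show "\<exists>M. \<forall>x. (1 + norm x) ^ n * cmod (pderivs is \<phi> x) \<le> M" by blast
qed

text \<open>A Peetre type inequality: under a translation the polynomial weights change by a factor
  depending only on \<open>t\<close>.\<close>

lemma one_plus_norm_shift: "1 + norm x \<le> (1 + norm t) * (1 + norm (x - t :: 'a::real_normed_vector))"
proof -
  have "norm x \<le> norm t + norm (x - t)" using norm_triangle_ineq[of t "x - t"] by simp
  moreover have "(1 + norm t) * (1 + norm (x - t)) = 1 + norm t + norm (x - t) + norm t * norm (x - t)"
    by (simp add: algebra_simps)
  ultimately show ?thesis using mult_nonneg_nonneg[OF norm_ge_zero[of t] norm_ge_zero[of "x - t"]]
    by linarith
qed

lemma rapid_shift: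
  assumes "rapid \<phi>" shows "rapid (\<lambda>x. \<phi> (x - t))"
  unfolding rapid_def
proof (intro conjI allI)
  have s: "smooth \<phi>" using assms by (rule rapid_smooth)
  show "smooth (\<lambda>x. \<phi> (x - t))" using smooth_affine[OF s, of "- t" 1] by simp
  fix n "is"
  obtain M where M: "\<And>x. (1 + norm x) ^ n * cmod (pderivs is \<phi> x) \<le> M"
    using assms unfolding rapid_def by metis
  have "(1 + norm x) ^ n * cmod (pderivs is \<phi> (x - t)) \<le> (1 + norm t) ^ n * M" for x
  proof -
    have "(1 + norm x) ^ n * cmod (pderivs is \<phi> (x - t))
        \<le> ((1 + norm t) * (1 + norm (x - t))) ^ n * cmod (pderivs is \<phi> (x - t))"
      by (intro mult_right_mono power_mono one_plus_norm_shift) auto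
    also have "\<dots> = (1 + norm t) ^ n * ((1 + norm (x - t)) ^ n * cmod (pderivs is \<phi> (x - t)))"
      by (simp add: power_mult_distrib)
    also have "\<dots> \<le> (1 + norm t) ^ n * M" by (intro mult_left_mono M) auto
    finally show ?thesis .
  qed
  then show "\<exists>M. \<forall>x. (1 + norm x) ^ n * cmod (pderivs is (\<lambda>x. \<phi> (x - t)) x) \<le> M"
    using pderivs_affine[OF s, of "is" "- t" 1] by auto
qed

section \<open>Neighbourhoods in the Schwartz topology\<close>

lemma schwartz_smooth: "\<phi> \<in> schwartz \<Longrightarrow> smooth \<phi>"
  by (simp add: schwartz_def)

lemma schwartz_add:
  assumes "\<phi> \<in> schwartz" "\<psi> \<in> schwartz"
  shows "(\<lambda>x. \<phi> x + \<psi> x) \<in> schwartz"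
  unfolding schwartz_def
proof (intro CollectI conjI allI)
  have s: "smooth \<phi>" "smooth \<psi>" using assms by (auto intro: schwartz_smooth)
  then show "smooth (\<lambda>x. \<phi> x + \<psi> x)" by (rule smooth_add)
  fix n k
  obtain M N where M: "\<And>x. (1 + norm x) ^ n * cmod (multi_deriv k \<phi> x) \<le> M"
    and N: "\<And>x. (1 + norm x) ^ n * cmod (multi_deriv k \<psi> x) \<le> N"
    using assms unfolding schwartz_def bdd_above_def by fastforce
  have "(1 + norm x) ^ n * cmod (multi_deriv k \<phi> x + multi_deriv k \<psi> x) \<le> M + N" for x
  proof -
    have "(1 + norm x) ^ n * cmod (multi_deriv k \<phi> x + multi_deriv k \<psi> x)
        \<le> (1 + norm x) ^ n * (cmod (multi_deriv k \<phi> x) + cmod (multi_deriv k \<psi> x))"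
      by (intro mult_left_mono norm_triangle_ineq) auto
    then show ?thesis using M[of x] N[of x] by (simp add: algebra_simps)
  qed
  then show "bdd_above (range (\<lambda>x. (1 + norm x) ^ n * cmod (multi_deriv k (\<lambda>x. \<phi> x + \<psi> x) x)))"
    by (intro bdd_aboveI2[where M = "M + N"]) (simp add: multi_deriv_eq pderivs_add s)
qed

lemma schwartz_uminus:
  assumes "\<phi> \<in> schwartz" shows "(\<lambda>x. - \<phi> x) \<in> schwartz"
  using assms smooth_cmult[of \<phi> "-1"] pderivs_cmult[of \<phi> _ "-1"]
  unfolding schwartz_def multi_deriv_eq by auto

lemma schwartz_diff: "\<phi> \<in> schwartz \<Longrightarrow> \<psi> \<in> schwartz \<Longrightarrow> (\<lambda>x. \<phi> x - \<psi> x) \<in> schwartz"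
  using schwartz_add[of \<phi> "\<lambda>x. - \<psi> x"] schwartz_uminus[of \<psi>] by simp

text \<open>Induction over the generation of open sets. A basic set is a seminorm ball whose centre
  may differ from \<open>\<xi>\<close>, so the admissible perturbation is what the triangle
  inequality leaves over; finite intersections take maxima of orders and weights and the minimum of
  the sizes.\<close>

lemma schwartz_topology_nbhd:
  fixes U :: "(real^'d::finite \<Rightarrow> complex) set"
  assumes "openin schwartz_topology U" "\<xi> \<in> U" "\<xi> \<in> schwartz"
  obtains n m \<delta> where "0 < \<delta>"
    "\<And>\<psi>. rapid \<psi> \<Longrightarrow> (\<And>is x. length is \<le> m \<Longrightarrow> (1 + norm x) ^ n * cmod (pderivs is \<psi> x) \<le> \<delta>) \<Longrightarrow>
      (\<lambda>x. \<xi> x + \<psi> x) \<in> U"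
proof -
  let ?P = "\<lambda>U n m \<delta>. \<forall>\<psi>. rapid \<psi> \<longrightarrow>
      (\<forall>is x. length is \<le> m \<longrightarrow> (1 + norm x) ^ n * cmod (pderivs is \<psi> x) \<le> \<delta>) \<longrightarrow>
      (\<lambda>x. \<xi> x + \<psi> x) \<in> U"
  let ?B = "{{\<psi> \<in> schwartz. schwartz_seminorm n k (\<lambda>x. \<psi> x - \<phi> x) < r} | \<phi> n k r.
        \<phi> \<in> schwartz \<and> (0::real) < r} :: (real^'d \<Rightarrow> complex) set set"
  have "generate_topology_on ?B U"
    using assms(1) unfolding schwartz_topology_def openin_topology_generated_by_iff .
  then have "\<xi> \<in> U \<Longrightarrow> \<exists>n m \<delta>. 0 < \<delta> \<and> ?P U n m \<delta>"
  proof (induction rule: generate_topology_on.induct)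
    case Empty
    then show ?case by simp
  next
    case (Int a b)
    then obtain n m \<delta> n' m' \<delta>' where *: "0 < \<delta>" "?P a n m \<delta>" "0 < \<delta>'" "?P b n' m' \<delta>'" by blast
    have "?P (a \<inter> b) (max n n') (max m m') (min \<delta> \<delta>')"
    proof (intro allI impI)
      fix \<psi> :: "real^'d \<Rightarrow> complex"
      assume \<psi>: "rapid \<psi>" "\<forall>is x. length is \<le> max m m' \<longrightarrow>
          (1 + norm x) ^ max n n' * cmod (pderivs is \<psi> x) \<le> min \<delta> \<delta>'"
      have le: "(1 + norm x) ^ q * cmod (pderivs is \<psi> x) \<le> (1 + norm x) ^ max n n' * cmod (pderivs is \<psi> x)"
        if "q \<le> max n n'" for q x "is"
        using that by (intro mult_right_mono power_increasing) auto
      have "(1 + norm x) ^ n * cmod (pderivs is \<psi> x) \<le> \<delta>" if "length is \<le> m" for "is" x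
        using le[of n x "is"] \<psi>(2)[rule_format, of "is" x, OF le_trans[OF that max.cobounded1]]
        by linarith
      moreover have "(1 + norm x) ^ n' * cmod (pderivs is \<psi> x) \<le> \<delta>'" if "length is \<le> m'" for "is" x
        using le[of n' x "is"] \<psi>(2)[rule_format, of "is" x, OF le_trans[OF that max.cobounded2]]
        by linarith
      ultimately show "(\<lambda>x. \<xi> x + \<psi> x) \<in> a \<inter> b" using * \<psi>(1) by blast
    qed
    then show ?case using * by (metis min_less_iff_conj)
  next
    case (UN K)
    then obtain k where k: "k \<in> K" "\<xi> \<in> k" by blast
    with UN obtain n m \<delta> where "0 < \<delta>" "?P k n m \<delta>" by blast
    with k show ?case by blast
  next
    case (Basis s)
    then obtain \<phi> n k r where s: "s = {\<psi> \<in> schwartz. schwartz_seminorm n k (\<lambda>x. \<psi> x - \<phi> x) < r}"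
      "\<phi> \<in> schwartz" "0 < r" by blast
    let ?c = "schwartz_seminorm n k (\<lambda>x. \<xi> x - \<phi> x)"
    have c: "?c < r" using s(1) Basis.prems by simp
    have sm: "(\<lambda>x. \<xi> x - \<phi> x) \<in> schwartz" using assms(3) s(2) by (rule schwartz_diff)
    \<comment> \<open>Half of the room up to \<open>r\<close> keeps the final inequality strict, as
      the perturbation is controlled by a weak one.\<close>
    have "?P s n (mi_abs k) ((r - ?c) / 2)"
    proof (intro allI impI)
      fix \<psi> :: "real^'d \<Rightarrow> complex"
      assume \<psi>: "rapid \<psi>" "\<forall>is x. length is \<le> mi_abs k \<longrightarrow>
          (1 + norm x) ^ n * cmod (pderivs is \<psi> x) \<le> (r - ?c) / 2"
      have "schwartz_seminorm n k (\<lambda>x. \<xi> x + \<psi> x - \<phi> x) \<le> ?c + (r - ?c) / 2"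
        unfolding schwartz_seminorm_def[of n k "\<lambda>x. \<xi> x + \<psi> x - \<phi> x"]
      proof (rule cSUP_least)
        fix x
        have eq: "(\<lambda>x. \<xi> x + \<psi> x - \<phi> x) = (\<lambda>x. (\<xi> x - \<phi> x) + \<psi> x)" by auto
        have "(1 + norm x) ^ n * cmod (multi_deriv k (\<lambda>x. \<xi> x + \<psi> x - \<phi> x) x)
          = (1 + norm x) ^ n * cmod (multi_deriv k (\<lambda>x. \<xi> x - \<phi> x) x + multi_deriv k \<psi> x)"
          unfolding eq multi_deriv_eq
          by (subst pderivs_add[OF schwartz_smooth[OF sm] rapid_smooth[OF \<psi>(1)]]) simp
        also have "\<dots> \<le> (1 + norm x) ^ n * (cmod (multi_deriv k (\<lambda>x. \<xi> x - \<phi> x) x) + cmod (multi_deriv k \<psi> x))"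
          by (intro mult_left_mono norm_triangle_ineq) auto
        also have "\<dots> = (1 + norm x) ^ n * cmod (multi_deriv k (\<lambda>x. \<xi> x - \<phi> x) x)
            + (1 + norm x) ^ n * cmod (multi_deriv k \<psi> x)" by (simp add: algebra_simps)
        also have "(1 + norm x) ^ n * cmod (multi_deriv k (\<lambda>x. \<xi> x - \<phi> x) x) \<le> ?c"
          unfolding schwartz_seminorm_def
          by (rule cSUP_upper) (use sm in \<open>auto simp: schwartz_def\<close>)
        also have "(1 + norm x) ^ n * cmod (multi_deriv k \<psi> x) \<le> (r - ?c) / 2"
          using \<psi>(2) length_mi_list[of k] unfolding multi_deriv_eq by simp
        finally show "(1 + norm x) ^ n * cmod (multi_deriv k (\<lambda>x. \<xi> x + \<psi> x - \<phi> x) x) \<le> ?c + (r - ?c) / 2"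
          by simp
      qed simp
      also have "\<dots> < r" using c by (simp add: field_simps)
      finally show "(\<lambda>x. \<xi> x + \<psi> x) \<in> s"
        unfolding s(1) using schwartz_add[OF assms(3) rapid_schwartz[OF \<psi>(1)]] by simp
    qed
    moreover have "0 < (r - ?c) / 2" using c by simp
    ultimately show ?case by blast
  qed
  with assms(2) obtain n m \<delta> where "0 < \<delta>" "?P U n m \<delta>" by blast
  then show thesis using that[of \<delta> m n] by blast
qed

lemma tempered_lin:
  "tempered_distribution f \<Longrightarrow> rapid \<phi> \<Longrightarrow> rapid \<psi> \<Longrightarrow>
    f (\<lambda>x. a * \<phi> x + b * \<psi> x) = a * f \<phi> + b * f \<psi>"
  unfolding tempered_distribution_def by (meson rapid_schwartz)

lemma tempered_lin_on_test: "tempered_distribution f \<Longrightarrow> lin_on_test f"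
  unfolding lin_on_test_def by (simp add: tempered_lin test_rapid)

lemma tempered_diff: "tempered_distribution f \<Longrightarrow> rapid \<phi> \<Longrightarrow> rapid \<psi> \<Longrightarrow>
    f (\<lambda>x. \<phi> x - \<psi> x) = f \<phi> - f \<psi>"
  using tempered_lin[of f \<phi> \<psi> 1 "-1"] by simp

text \<open>Continuity at 0 gives a bound on one neighbourhood, and homogeneity spreads it to all
  functions. A pointwise bound \<open>M\<close> takes the place of the seminorms, so that no
  supremum has to be formed.\<close>

lemma tempered_seminorm_bound:
  fixes f :: "(real^'d::finite \<Rightarrow> complex) \<Rightarrow> complex"
  assumes "tempered_distribution f"
  obtains C n m where "0 < C" "\<And>\<phi> M. rapid \<phi> \<Longrightarrow> 0 < M \<Longrightarrow>
    (\<And>is x. length is \<le> m \<Longrightarrow> (1 + norm x) ^ n * cmod (pderivs is \<phi> x) \<le> M) \<Longrightarrow> cmod (f \<phi>) \<le> C * M"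
proof -
  let ?z = "(\<lambda>x. 0) :: real^'d \<Rightarrow> complex"
  have zr: "rapid ?z" by (intro test_rapid test_zero)
  have z: "?z \<in> schwartz" using zr by (rule rapid_schwartz)
  have f0: "f ?z = 0" using tempered_lin[OF assms zr zr, of 0 0] by simp
  \<comment> \<open>This set serves to place 0 in the carrier of the topology, which is the union of
    the generators.\<close>
  let ?S = "{\<psi> \<in> schwartz. schwartz_seminorm 0 (\<lambda>_. 0) (\<lambda>x. \<psi> x - ?z x) < 1} :: (real^'d \<Rightarrow> complex) set"
  have "openin schwartz_topology ?S"
    unfolding schwartz_topology_def openin_topology_generated_by_iff
    using z by (intro generate_topology_on.Basis) fastforce
  moreover have "?z \<in> ?S" using z by (simp add: schwartz_seminorm_def multi_deriv_eq)
  ultimately have zt: "?z \<in> topspace schwartz_topology" by (meson openin_subset subsetD)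
  let ?U = "{\<phi> \<in> topspace schwartz_topology. f \<phi> \<in> ball 0 1}"
  have U1: "openin schwartz_topology ?U"
    using assms open_ball[of "0::complex" 1] unfolding tempered_distribution_def continuous_map_def open_openin[symmetric]
    by blast
  have U2: "?z \<in> ?U" using zt f0 by simp
  obtain n m \<delta> where \<delta>: "0 < \<delta>" "\<And>\<psi>. rapid \<psi> \<Longrightarrow>
      (\<And>is x. length is \<le> m \<Longrightarrow> (1 + norm x) ^ n * cmod (pderivs is \<psi> x) \<le> \<delta>) \<Longrightarrow> (\<lambda>x. ?z x + \<psi> x) \<in> ?U"
  proof (rule schwartz_topology_nbhd[OF U1 U2 z], goal_cases)
    case (1 n m \<delta>)
    show ?case by (rule 1(1)[OF 1(2,3)])
  qed
  show thesis
  proof (rule that[of "1 / \<delta>" m n])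
    show "0 < 1 / \<delta>" using \<delta>(1) by simp
    fix \<phi> :: "real^'d \<Rightarrow> complex" and M :: real
    assume \<phi>: "rapid \<phi>" "0 < M"
      "\<And>is x. length is \<le> m \<Longrightarrow> (1 + norm x) ^ n * cmod (pderivs is \<phi> x) \<le> M"
    \<comment> \<open>This multiple makes the weighted derivatives at most
      \<open>\<delta>\<close>.\<close>
    let ?c = "complex_of_real (\<delta> / M)"
    have c: "rapid (\<lambda>x. ?c * \<phi> x)" using rapid_lin[OF \<phi>(1) \<phi>(1), of ?c 0] by simp
    have "(\<lambda>x. ?z x + ?c * \<phi> x) \<in> ?U"
    proof (rule \<delta>(2)[OF c])
      fix "is" :: "'d list" and x :: "real^'d" assume "length is \<le> m"
      from \<phi>(3)[OF this, of x] have "(\<delta> / M) * ((1 + norm x) ^ n * cmod (pderivs is \<phi> x)) \<le> (\<delta> / M) * M"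
        using \<delta>(1) \<phi>(2) by (intro mult_left_mono) auto
      moreover have "cmod ?c = \<delta> / M" using \<delta>(1) \<phi>(2) by (simp only: norm_of_real) simp
      ultimately show "(1 + norm x) ^ n * cmod (pderivs is (\<lambda>x. ?c * \<phi> x) x) \<le> \<delta>"
        using \<phi>(2) by (simp only: pderivs_cmult[OF rapid_smooth[OF \<phi>(1)]] norm_mult) (simp add: mult_ac)
    qed
    then have "cmod (f (\<lambda>x. ?c * \<phi> x)) < 1" by simp
    moreover have "f (\<lambda>x. ?c * \<phi> x) = ?c * f \<phi>" using tempered_lin[OF assms \<phi>(1) \<phi>(1), of ?c 0] by simp
    moreover have "cmod ?c = \<delta> / M" using \<delta>(1) \<phi>(2) by (simp only: norm_of_real) simp
    ultimately have "(\<delta> / M) * cmod (f \<phi>) < 1" by (simp only: norm_mult)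
    then show "cmod (f \<phi>) \<le> 1 / \<delta> * M" using \<delta>(1) \<phi>(2) by (simp add: field_simps)
  qed
qed

subsection \<open>Functions vanishing to high order at a point\<close>

lemma smooth_mean_value_bound:
  fixes \<phi> :: "real^'d::finite \<Rightarrow> complex"
  assumes "smooth \<phi>" "convex S" "x \<in> S" "y \<in> S" "\<And>i z. z \<in> S \<Longrightarrow> cmod (partial_deriv i \<phi> z) \<le> B"
  shows "cmod (\<phi> x - \<phi> y) \<le> real CARD('d) * B * norm (x - y)"
proof (rule differentiable_bound[OF assms(2) _ _ assms(3,4), where
      f' = "\<lambda>z h. \<Sum>i\<in>UNIV. (h $ i) *\<^sub>R partial_deriv i \<phi> z"])
  fix z assume z: "z \<in> S"
  show "(\<phi> has_derivative (\<lambda>h. \<Sum>i\<in>UNIV. (h $ i) *\<^sub>R partial_deriv i \<phi> z)) (at z within S)"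
    by (rule has_derivative_at_withinI[OF smooth_has_derivative[OF assms(1)]])
  show "onorm (\<lambda>h. \<Sum>i\<in>UNIV. (h $ i) *\<^sub>R partial_deriv i \<phi> z) \<le> real CARD('d) * B"
  proof (rule onorm_le)
    fix h :: "real^'d"
    have "cmod (\<Sum>i\<in>UNIV. (h $ i) *\<^sub>R partial_deriv i \<phi> z) \<le> (\<Sum>i\<in>(UNIV::'d set). norm h * B)"
    proof (rule sum_norm_le)
      fix i
      show "cmod ((h $ i) *\<^sub>R partial_deriv i \<phi> z) \<le> norm h * B"
        unfolding norm_scaleR real_norm_def
        by (rule mult_mono[OF component_le_norm_cart assms(5)[OF z]]) auto
    qed
    then show "cmod (\<Sum>i\<in>UNIV. (h $ i) *\<^sub>R partial_deriv i \<phi> z) \<le> real CARD('d) * B * norm h"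
      by (simp add: mult_ac)
  qed
qed

text \<open>A substitute for the Taylor formula: the mean value inequality is applied
  \<open>j\<close> times, from derivatives of order m + 1 downwards, each time gaining a factor
  \<open>real CARD('d) * dist a x\<close>.\<close>

lemma taylor_vanishing:
  fixes \<phi> :: "real^'d::finite \<Rightarrow> complex"
  assumes "smooth \<phi>" "\<And>is. length is \<le> m \<Longrightarrow> pderivs is \<phi> a = 0"
    and "\<And>is x. length is = Suc m \<Longrightarrow> dist a x \<le> r \<Longrightarrow> cmod (pderivs is \<phi> x) \<le> M"
    and "length is + j = Suc m" "dist a x \<le> r"
  shows "cmod (pderivs is \<phi> x) \<le> (real CARD('d)) ^ j * M * dist a x ^ j"
  using assms(4,5)
proof (induction j arbitrary: "is" x)
  case 0
  then show ?case using assms(3) by simp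
next
  case (Suc j)
  have "cmod (pderivs is \<phi> x - pderivs is \<phi> a)
      \<le> real CARD('d) * ((real CARD('d)) ^ j * M * dist a x ^ j) * norm (x - a)"
  \<comment> \<open>On this ball no point is farther from \<open>a\<close> than \<open>x\<close>, so
    the induction hypothesis holds throughout with the distance of \<open>x\<close>.\<close>
  proof (rule smooth_mean_value_bound[where S = "cball a (dist a x)"])
    fix i z assume z: "z \<in> cball a (dist a x)"
    have "cmod (pderivs (i # is) \<phi> z) \<le> (real CARD('d)) ^ j * M * dist a z ^ j"
      using z Suc.prems by (intro Suc.IH) auto
    moreover have "0 \<le> M"
      using order_trans[OF norm_ge_zero assms(3)[of "replicate (Suc m) i" a]]
        order_trans[OF zero_le_dist Suc.prems(2)] by simp
    ultimately show "cmod (partial_deriv i (pderivs is \<phi>) z) \<le> (real CARD('d)) ^ j * M * dist a x ^ j"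
      unfolding pderivs_Cons using z
      by (elim order_trans) (intro mult_left_mono power_mono, auto)
  qed (auto intro: smooth_pderivs assms)
  moreover have "pderivs is \<phi> a = 0" using Suc.prems by (intro assms(2)) auto
  ultimately show ?case by (simp add: dist_norm norm_minus_commute mult_ac)
qed

text \<open>Both cutoffs are 1 near \<open>a\<close> and both vanish near every other point of the
  support, so their difference is not seen by \<open>F\<close>.\<close>

lemma cutoff_shrink:
  fixes F :: "(real^'d::finite \<Rightarrow> complex) \<Rightarrow> complex"
  assumes "lin_on_test F" "\<phi> \<in> test_functions" "0 < \<epsilon>" "\<epsilon> \<le> r"
    and "\<And>b. b \<in> dist_supp F \<Longrightarrow> dist a b \<le> 2 * real CARD('d) * r \<Longrightarrow> b = a"
  shows "F (\<lambda>x. \<phi> x * cutoff a r x) = F (\<lambda>x. \<phi> x * cutoff a \<epsilon> x)"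
proof -
  let ?u = "\<lambda>x. \<phi> x * cutoff a r x" and ?v = "\<lambda>x. \<phi> x * cutoff a \<epsilon> x"
  have t: "?u \<in> test_functions" "?v \<in> test_functions" by (intro test_mult assms smooth_cutoff)+
  have "b \<notin> fun_supp (\<lambda>x. ?u x - ?v x)" if b: "b \<in> dist_supp F" for b
  proof (cases "b = a")
    case True
    show ?thesis
      by (rule not_in_fun_suppI[of "ball a \<epsilon>"]) (use assms True in \<open>auto simp: cutoff_eq_1\<close>)
  next
    case False
    show ?thesis
    proof (rule not_in_fun_suppI[of "- cball a (2 * real CARD('d) * r)"])
      show "b \<in> - cball a (2 * real CARD('d) * r)" using assms(5)[OF b] False by auto
      fix y assume "y \<in> - cball a (2 * real CARD('d) * r)"
      then have 1: "2 * real CARD('d) * r < dist a y" by simp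
      moreover have "2 * real CARD('d) * \<epsilon> \<le> 2 * real CARD('d) * r"
        using assms(4) by (intro mult_left_mono) auto
      ultimately have 2: "2 * real CARD('d) * \<epsilon> < dist a y" by linarith
      have "cutoff a r y = 0" "cutoff a \<epsilon> y = 0"
        using assms(3,4) by (auto intro: cutoff_eq_0 1 2)
      then show "?u y - ?v y = 0" by simp
    qed auto
  qed
  then have "F (\<lambda>x. ?u x - ?v x) = 0"
    by (intro vanishes_off_dist_supp assms test_diff t) blast
  then show ?thesis using lin_on_test_diff[OF assms(1) t] by simp
qed

text \<open>The blow-up \<open>z \<mapsto> \<phi> (a + \<epsilon> z) \<eta> z\<close> keeps all quantities at scale one, so a single
  application of the Leibniz rule suffices.\<close>

lemma pderivs_cutoff_scaled:
  fixes \<phi> :: "real^'d::finite \<Rightarrow> complex"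
  assumes "smooth \<phi>" "\<epsilon> \<noteq> 0"
  shows "pderivs is (\<lambda>x. \<phi> x * cutoff a \<epsilon> x) x = of_real ((1 / \<epsilon>) ^ length is)
    * pderivs is (\<lambda>z. \<phi> (a + \<epsilon> *\<^sub>R z) * jet (\<lambda>_. 0) z) (- (1 / \<epsilon>) *\<^sub>R a + (1 / \<epsilon>) *\<^sub>R x)"
proof -
  let ?\<Psi> = "\<lambda>z. \<phi> (a + \<epsilon> *\<^sub>R z) * jet (\<lambda>_. 0) z"
  have "smooth ?\<Psi>" by (intro smooth_mult smooth_affine smooth_jet assms)
  from pderivs_affine[OF this, of "is" "- (1 / \<epsilon>) *\<^sub>R a" "1 / \<epsilon>"]
  show ?thesis using assms(2)
    by (simp add: cutoff_def fun_eq_iff scaleR_add_right scaleR_diff_right)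
qed

text \<open>The classical fact that a functional of order \<open>m\<close> ignores functions
  vanishing to that order. On a cutoff of size \<epsilon> Taylor gives \<epsilon>^(m+1) and at most
  \<open>m\<close> derivatives cost \<epsilon>^(-m), so the seminorm is O(\<epsilon>), while the
  value does not depend on \<epsilon> by \<open>cutoff_shrink\<close>.\<close>

lemma vanishing_jet_imp_zero:
  fixes f :: "(real^'d::finite \<Rightarrow> complex) \<Rightarrow> complex"
  assumes f: "tempered_distribution f" and \<phi>: "\<phi> \<in> test_functions"
    and C: "0 < C" "\<And>\<phi> M. rapid \<phi> \<Longrightarrow> 0 < M \<Longrightarrow>
      (\<And>is x. length is \<le> m \<Longrightarrow> (1 + norm x) ^ n * cmod (pderivs is \<phi> x) \<le> M) \<Longrightarrow> cmod (f \<phi>) \<le> C * M"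
    and v: "\<And>is. length is \<le> m \<Longrightarrow> pderivs is \<phi> a = 0"
    and r: "0 < r" "\<And>b. b \<in> dist_supp f \<Longrightarrow> dist a b \<le> 2 * real CARD('d) * r \<Longrightarrow> b = a"
  shows "f (\<lambda>x. \<phi> x * cutoff a r x) = 0"
proof -
  let ?\<rho> = "2 * real CARD('d)" and ?d = "real CARD('d)"
  have "0 < CARD('d)" by simp
  then have "1 \<le> ?d" by linarith
  then have \<rho>: "1 \<le> ?\<rho>" "1 \<le> ?d" by linarith+
  have s: "smooth \<phi>" using \<phi> by (rule test_smooth)
  obtain M where M: "0 < M" "\<And>is x. length is \<le> Suc m \<Longrightarrow> cmod (pderivs is \<phi> x) \<le> M"
    using test_bounded[OF \<phi>, of "Suc m"] by blast
  obtain B where B: "0 < B" "\<And>is x. length is \<le> m \<Longrightarrow> cmod (pderivs is (jet (\<lambda>_. 0 :: nat)) (x :: real^'d)) \<le> B"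
    using test_bounded[OF test_jet, of m "\<lambda>_. 0"] by blast
  \<comment> \<open>Polynomial weight on the ball around \<open>a\<close>, times the Leibniz
    constant, the Taylor constant and the bound for the plateau.\<close>
  define K where "K = (1 + norm a + ?\<rho>) ^ n * (2 ^ m * ((?d * ?\<rho>) ^ Suc m * M * B))"
  have K: "0 < K" unfolding K_def using M B \<rho>
    by (intro mult_pos_pos zero_less_power add_nonneg_pos) (auto intro: add_nonneg_pos)
  have bound: "cmod (f (\<lambda>x. \<phi> x * cutoff a r x)) \<le> C * (K * \<epsilon>)" if \<epsilon>: "0 < \<epsilon>" "\<epsilon> \<le> min r 1" for \<epsilon>
  proof -
    let ?\<Psi> = "\<lambda>z. \<phi> (a + \<epsilon> *\<^sub>R z) * jet (\<lambda>_. 0) z"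
    have \<Psi>: "cmod (pderivs is ?\<Psi> z) \<le> 2 ^ m * ((?d * ?\<rho>) ^ Suc m * M * B) * \<epsilon> ^ Suc m"
      if "length is \<le> m" for "is" z
    proof (cases "?\<rho> < norm z")
      case True
      have "pderivs is ?\<Psi> z = 0" by (rule pderivs_eq_0_norm[OF _ True]) (simp add: jet_eq_0)
      then show ?thesis using M B \<epsilon> by simp
    next
      case False
      have "cmod (pderivs is ?\<Psi> z) \<le> 2 ^ length is * (((?d * ?\<rho>) ^ Suc m * M * \<epsilon> ^ Suc m) * B)"
      proof (rule norm_pderivs_mult_le)
        fix c :: "'d list" assume c: "length c \<le> length is"
        then have le: "length c \<le> m" using that by simp
        then obtain j where j: "length c + j = Suc m" using le_Suc_ex by (metis add.commute le_SucI)
        have dist: "dist a (a + \<epsilon> *\<^sub>R z) = \<epsilon> * norm z" using \<epsilon> by (simp add: dist_norm)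
        have "cmod (pderivs c \<phi> (a + \<epsilon> *\<^sub>R z)) \<le> ?d ^ j * M * dist a (a + \<epsilon> *\<^sub>R z) ^ j"
          by (rule taylor_vanishing[OF s v _ j order_refl]) (use M in auto)
        also have "\<dots> \<le> ?d ^ j * M * (\<epsilon> * ?\<rho>) ^ j"
          unfolding dist using False M \<epsilon> by (intro mult_left_mono power_mono) auto
        also have "\<dots> = (?d * ?\<rho>) ^ j * M * \<epsilon> ^ j" by (simp add: power_mult_distrib mult_ac)
        finally have "\<epsilon> ^ length c * cmod (pderivs c \<phi> (a + \<epsilon> *\<^sub>R z)) \<le> \<epsilon> ^ length c * ((?d * ?\<rho>) ^ j * M * \<epsilon> ^ j)"
          using \<epsilon> by (intro mult_left_mono) auto
        also have "\<dots> = (?d * ?\<rho>) ^ j * M * \<epsilon> ^ Suc m" unfolding j[symmetric] by (simp add: power_add mult_ac)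
        also have "\<dots> \<le> (?d * ?\<rho>) ^ Suc m * M * \<epsilon> ^ Suc m"
        proof -
          have "1 \<le> ?d * ?\<rho>" using mult_mono[OF \<rho>(2,1)] by simp
          then show ?thesis using M \<epsilon> j by (intro mult_right_mono power_increasing) auto
        qed
        finally show "cmod (pderivs c (\<lambda>z. \<phi> (a + \<epsilon> *\<^sub>R z)) z) \<le> (?d * ?\<rho>) ^ Suc m * M * \<epsilon> ^ Suc m"
          unfolding pderivs_affine[OF s] using \<epsilon> by (simp add: norm_mult norm_power)
      qed (use that B in \<open>auto intro: smooth_affine s smooth_jet\<close>)
      also have "\<dots> \<le> 2 ^ m * (((?d * ?\<rho>) ^ Suc m * M * \<epsilon> ^ Suc m) * B)"
        using that M B \<epsilon> by (intro mult_right_mono power_increasing) auto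
      finally show ?thesis by (simp add: mult_ac)
    qed
    have "cmod (f (\<lambda>x. \<phi> x * cutoff a \<epsilon> x)) \<le> C * (K * \<epsilon>)"
    proof (rule C(2))
      show "rapid (\<lambda>x. \<phi> x * cutoff a \<epsilon> x)" by (intro test_rapid test_mult \<phi> smooth_cutoff)
      show "0 < K * \<epsilon>" using K \<epsilon> by simp
      fix "is" :: "'d list" and x assume l: "length is \<le> m"
      show "(1 + norm x) ^ n * cmod (pderivs is (\<lambda>x. \<phi> x * cutoff a \<epsilon> x) x) \<le> K * \<epsilon>"
      proof (cases "x \<in> cball a ?\<rho>")
        case False
        have "pderivs is (\<lambda>x. \<phi> x * cutoff a \<epsilon> x) x = pderivs is (\<lambda>x. 0) x"
        proof (rule pderivs_cong_open[of "- cball a ?\<rho>"])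
          fix y assume y: "y \<in> - cball a ?\<rho>"
          have "?\<rho> * \<epsilon> \<le> ?\<rho> * 1" using \<epsilon> by (intro mult_left_mono) auto
          also have "\<dots> < dist a y" using y by simp
          finally have "?\<rho> * \<epsilon> < dist a y" .
          from cutoff_eq_0[OF \<epsilon>(1) this] show "\<phi> y * cutoff a \<epsilon> y = 0" by simp
        qed (use False in auto)
        then show ?thesis using K \<epsilon> by simp
      next
        case True
        have nx: "norm x \<le> norm a + ?\<rho>"
          using True norm_triangle_ineq[of a "x - a"] by (simp add: dist_norm norm_minus_commute)
        have "cmod (pderivs is (\<lambda>x. \<phi> x * cutoff a \<epsilon> x) x)
          \<le> (1 / \<epsilon>) ^ length is * (2 ^ m * ((?d * ?\<rho>) ^ Suc m * M * B) * \<epsilon> ^ Suc m)"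
          unfolding pderivs_cutoff_scaled[OF s less_imp_neq[OF \<epsilon>(1), symmetric]] norm_mult norm_of_real
          using \<epsilon> by (intro mult_mono \<Psi> l) auto
        also have "\<dots> \<le> (1 / \<epsilon>) ^ m * (2 ^ m * ((?d * ?\<rho>) ^ Suc m * M * B) * \<epsilon> ^ Suc m)"
          using l \<epsilon> M B by (intro mult_right_mono power_increasing) auto
        also have "\<dots> = 2 ^ m * ((?d * ?\<rho>) ^ Suc m * M * B) * \<epsilon>"
          using \<epsilon> by (simp add: field_simps)
        finally have "(1 + norm x) ^ n * cmod (pderivs is (\<lambda>x. \<phi> x * cutoff a \<epsilon> x) x)
          \<le> (1 + norm a + ?\<rho>) ^ n * (2 ^ m * ((?d * ?\<rho>) ^ Suc m * M * B) * \<epsilon>)"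
          using nx by (intro mult_mono power_mono) auto
        then show ?thesis unfolding K_def by (simp add: mult_ac)
      qed
    qed
    moreover have "f (\<lambda>x. \<phi> x * cutoff a r x) = f (\<lambda>x. \<phi> x * cutoff a \<epsilon> x)"
      using \<epsilon> by (intro cutoff_shrink tempered_lin_on_test f \<phi> r(2)) auto
    ultimately show ?thesis by simp
  qed
  have "cmod (f (\<lambda>x. \<phi> x * cutoff a r x)) \<le> 0"
  proof (rule field_le_epsilon)
    fix e :: real assume e: "0 < e"
    define \<epsilon> where "\<epsilon> = min (min r 1) (e / (C * K))"
    have "0 < \<epsilon>" "\<epsilon> \<le> min r 1" "\<epsilon> \<le> e / (C * K)" using e r C(1) K by (auto simp: \<epsilon>_def)
    then have "C * (K * \<epsilon>) \<le> e" using C(1) K by (simp add: field_simps)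
    with bound[OF \<open>0 < \<epsilon>\<close> \<open>\<epsilon> \<le> min r 1\<close>]
    show "cmod (f (\<lambda>x. \<phi> x * cutoff a r x)) \<le> 0 + e" by simp
  qed
  then show ?thesis by simp
qed

subsection \<open>Existence of the Dirac expansion\<close>

lemma pderivs_shift: "smooth \<phi> \<Longrightarrow> pderivs is (\<lambda>x. \<phi> (x - t)) = (\<lambda>x. pderivs is \<phi> (x - t))"
  using pderivs_affine[of \<phi> "is" "- t" 1] by simp

text \<open>Near each point \<open>\<phi>\<close> is compared with its Taylor polynomial, realised
  by translated jets so that it remains a test function. The remainder vanishes to order
  \<open>m\<close> there, so only the jets contribute. This \<open>m\<close> is the order in the
  continuity estimate and may exceed \<open>dist_ord f\<close>.\<close>

lemma dirac_expansion_exists: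
  fixes f :: "(real^'d::finite \<Rightarrow> complex) \<Rightarrow> complex"
  assumes f: "tempered_distribution f" and d: "discrete_set (dist_supp f)"
  shows "\<exists>m p. dirac_expansion f m p"
proof -
  obtain C n m where C: "0 < C" "\<And>\<phi> M. rapid \<phi> \<Longrightarrow> 0 < M \<Longrightarrow>
      (\<And>is x. length is \<le> m \<Longrightarrow> (1 + norm x) ^ n * cmod (pderivs is \<phi> x) \<le> M) \<Longrightarrow> cmod (f \<phi>) \<le> C * M"
  proof (rule tempered_seminorm_bound[OF f], goal_cases)
    case (1 C n m)
    show ?case by (rule 1(1)[OF 1(2,3)])
  qed
  obtain r where r: "\<And>a. 0 < r a"
      "\<And>a b. b \<in> dist_supp f \<Longrightarrow> dist a b \<le> 2 * real CARD('d) * r a \<Longrightarrow> b = a"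
    using discrete_set_isolating_radius[OF d] by blast
  note lin = tempered_lin_on_test[OF f]
  define J :: "real^'d \<Rightarrow> ('d \<Rightarrow> nat) \<Rightarrow> real^'d \<Rightarrow> complex" where "J = (\<lambda>a k x. jet k (x - a))"
  \<comment> \<open>The sign cancels the one in \<open>dist_deriv\<close>.\<close>
  define p where "p = (\<lambda>a k. (-1) ^ mi_abs k * f (\<lambda>x. J a k x * cutoff a (r a) x))"
  have J: "J a k \<in> test_functions" for a k unfolding J_def by (intro test_shift test_jet)
  have loc: "f (\<lambda>x. \<phi> x * cutoff a (r a) x)
      = (\<Sum>k | mi_abs k \<le> m. p a k * dist_deriv k (dirac a) \<phi>)" if \<phi>: "\<phi> \<in> test_functions" for \<phi> a
  proof -
    let ?K = "{k :: 'd \<Rightarrow> nat. mi_abs k \<le> m}"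
    let ?\<psi> = "\<lambda>x. \<phi> x - (\<Sum>k\<in>?K. multi_deriv k \<phi> a * J a k x)"
    have t: "?\<psi> \<in> test_functions" by (intro test_diff test_sum test_cmult J \<phi>)
    have "f (\<lambda>x. ?\<psi> x * cutoff a (r a) x) = 0"
    proof (rule vanishing_jet_imp_zero[OF f t C _ r])
      fix "is" :: "'d list" assume l: "length is \<le> m"
      have "pderivs is ?\<psi> a = pderivs is \<phi> a - (\<Sum>k\<in>?K. multi_deriv k \<phi> a * pderivs is (J a k) a)"
      proof -
        have "pderivs is (\<lambda>x. \<Sum>k\<in>?K. multi_deriv k \<phi> a * J a k x)
            = (\<lambda>x. \<Sum>k\<in>?K. pderivs is (\<lambda>x. multi_deriv k \<phi> a * J a k x) x)"
          by (rule pderivs_sum) (intro smooth_cmult test_smooth J)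
        moreover have "smooth (\<lambda>x. \<Sum>k\<in>?K. multi_deriv k \<phi> a * J a k x)"
          by (intro smooth_sum smooth_cmult test_smooth J)
        ultimately show ?thesis
          by (simp add: pderivs_diff pderivs_cmult test_smooth J \<phi>)
      qed
      also have "(\<Sum>k\<in>?K. multi_deriv k \<phi> a * pderivs is (J a k) a)
          = (\<Sum>k\<in>?K. if count_list is = k then multi_deriv k \<phi> a else 0)"
        unfolding J_def by (intro sum.cong) (auto simp: pderivs_shift smooth_jet pderivs_jet_0)
      also have "\<dots> = multi_deriv (count_list is) \<phi> a"
        using l finite_mi_abs_le[where 'd = 'd] by (simp add: mi_abs_count_list)
      also have "\<dots> = pderivs is \<phi> a" by (simp add: pderivs_eq_multi_deriv test_smooth \<phi>)
      finally show "pderivs is ?\<psi> a = 0" by simp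
    qed
    moreover have "(\<lambda>x. ?\<psi> x * cutoff a (r a) x) = (\<lambda>x. \<phi> x * cutoff a (r a) x
        - (\<Sum>k\<in>?K. multi_deriv k \<phi> a * (J a k x * cutoff a (r a) x)))"
      by (simp add: left_diff_distrib sum_distrib_right mult.assoc)
    moreover have "f (\<lambda>x. \<phi> x * cutoff a (r a) x - (\<Sum>k\<in>?K. multi_deriv k \<phi> a * (J a k x * cutoff a (r a) x)))
      = f (\<lambda>x. \<phi> x * cutoff a (r a) x) - (\<Sum>k\<in>?K. multi_deriv k \<phi> a * f (\<lambda>x. J a k x * cutoff a (r a) x))"
      by (subst lin_on_test_diff[OF lin])
        (auto simp: lin_on_test_sum[OF lin] lin_on_test_cmult[OF lin] test_cmult test_mult[OF _ smooth_cutoff] J \<phi>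
          intro!: test_sum)
    ultimately have "f (\<lambda>x. \<phi> x * cutoff a (r a) x)
        = (\<Sum>k\<in>?K. multi_deriv k \<phi> a * f (\<lambda>x. J a k x * cutoff a (r a) x))" by simp
    also have "\<dots> = (\<Sum>k\<in>?K. p a k * dist_deriv k (dirac a) \<phi>)"
      by (intro sum.cong) (auto simp: p_def dist_deriv_def dirac_def power_add[symmetric] mult_ac)
    finally show ?thesis .
  qed
  have "dirac_expansion f m p"
    unfolding dirac_expansion_def
    using localize_at_dist_supp[OF lin refl d _ r] loc by simp
  then show ?thesis by blast
qed

text \<open>Existence is what makes the \<open>LEAST\<close> in \<open>dist_ord\<close> and the
  \<open>SOME\<close> in \<open>dirac_coeff\<close> meaningful.\<close>

lemma dirac_expansion_coeff:
  assumes "tempered_distribution f" "discrete_set (dist_supp f)"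
  shows "dirac_expansion f (dist_ord f) (dirac_coeff f)"
proof -
  have "\<exists>p. dirac_expansion f (dist_ord f) p"
    unfolding dist_ord_def using dirac_expansion_exists[OF assms] by (rule LeastI_ex)
  then show ?thesis unfolding dirac_coeff_def by (rule someI_ex)
qed

lemma kappa_bound: "mi_abs k \<le> dist_ord f \<Longrightarrow> cmod (dirac_coeff f a k) \<le> kappa f a"
  unfolding kappa_def
  by (rule cSUP_upper) (auto intro!: bdd_above_finite finite_imageI finite_mi_abs_le)

text \<open>The supremum runs over a finite nonempty set of multi-indices, so it is a maximum. This
  extracts a concrete derivative to which a lower bound for \<open>kappa\<close> applies.\<close>

lemma kappa_attained:
  obtains k where "mi_abs k \<le> dist_ord f" "cmod (dirac_coeff f a k) = kappa f a"
proof -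
  let ?S = "(\<lambda>k. cmod (dirac_coeff f a k)) ` {k. mi_abs k \<le> dist_ord f}"
  have "finite ?S" by (intro finite_imageI finite_mi_abs_le)
  moreover have "(\<lambda>_. 0) \<in> {k :: 'a \<Rightarrow> nat. mi_abs k \<le> dist_ord f}" by (simp add: mi_abs_def)
  then have "?S \<noteq> {}" by blast
  ultimately have "Sup ?S \<in> ?S" by (metis Max_in cSup_eq_Max)
  then show thesis using that unfolding kappa_def by auto
qed

text \<open>The power of \<open>s\<close> compensates the chain rule, so the derivatives at 0 remain
  0 or 1 at every scale while the support shrinks with \<open>s\<close>. The added 0 matches the
  affine lemmas.\<close>

definition scaled_jet :: "('d::finite \<Rightarrow> nat) \<Rightarrow> real \<Rightarrow> real^'d \<Rightarrow> complex" where
  "scaled_jet k s x = of_real (s ^ mi_abs k) * jet k (0 + (1 / s) *\<^sub>R x)"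

lemma test_scaled_jet: "0 < s \<Longrightarrow> scaled_jet k s \<in> test_functions"
  unfolding scaled_jet_def[abs_def] by (intro test_cmult test_affine test_jet) auto

lemma scaled_jet_eq_0:
  fixes x :: "real^'d::finite"
  shows "0 < s \<Longrightarrow> 2 * real CARD('d) * s < norm x \<Longrightarrow> scaled_jet k s x = 0"
  unfolding scaled_jet_def by (simp add: jet_eq_0 pos_less_divide_eq)

lemma multi_deriv_scaled_jet_0:
  assumes "0 < s"
  shows "multi_deriv j (scaled_jet k s) 0 = (if j = k then 1 else 0)"
proof -
  have "multi_deriv j (scaled_jet k s) 0
      = of_real (s ^ mi_abs k) * (of_real ((1 / s) ^ mi_abs j) * pderivs (mi_list j) (jet k) 0)"
    unfolding multi_deriv_eq scaled_jet_def[abs_def]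
    by (simp only: pderivs_cmult[OF smooth_affine[OF smooth_jet]] pderivs_affine[OF smooth_jet])
      (simp add: length_mi_list)
  also have "pderivs (mi_list j) (jet k) 0 = (if j = k then 1 else 0)"
    using count_mi_list[of j] by (auto simp: pderivs_jet_0 fun_eq_iff)
  finally show ?thesis using assms by (auto simp: power_one_over simp flip: of_real_mult)
qed

text \<open>At a scale where no second support point lies under the jet, the expansion collapses to
  one term; the sign in \<open>dist_deriv\<close> disappears in the modulus.\<close>

lemma coeff_eq_scaled_jet:
  fixes f :: "(real^'d::finite \<Rightarrow> complex) \<Rightarrow> complex"
  assumes "dirac_expansion f m p" "a \<in> dist_supp f" "mi_abs k \<le> m" "0 < s"
    and "\<And>b. b \<in> dist_supp f \<Longrightarrow> dist a b \<le> 2 * real CARD('d) * s \<Longrightarrow> b = a"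
  shows "cmod (f (\<lambda>x. scaled_jet k s (x - a))) = cmod (p a k)"
proof -
  let ?\<phi> = "\<lambda>x. scaled_jet k s (x - a)"
  have t: "?\<phi> \<in> test_functions" by (intro test_shift test_scaled_jet assms)
  have md: "multi_deriv j ?\<phi> a = (if j = k then 1 else 0)" for j
    using multi_deriv_scaled_jet_0[OF assms(4), of j k]
    by (simp add: multi_deriv_eq pderivs_shift test_smooth test_scaled_jet assms)
  have "dist_supp f \<inter> fun_supp ?\<phi> = {a}"
  proof
    \<comment> \<open>For nonzero \<open>k\<close> the function itself vanishes at \<open>a\<close>,
      so membership of \<open>a\<close> in its support is seen from a derivative.\<close>
    have "multi_deriv k ?\<phi> a \<noteq> 0" by (simp add: md)
    then have "a \<in> fun_supp ?\<phi>" using pderivs_eq_0 unfolding multi_deriv_eq by blast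
    then show "{a} \<subseteq> dist_supp f \<inter> fun_supp ?\<phi>" using assms(2) by simp
    have "fun_supp ?\<phi> \<subseteq> cball a (2 * real CARD('d) * s)"
      by (rule fun_supp_subset) (use assms(4) in \<open>auto simp: not_le dist_norm norm_minus_commute intro!: scaled_jet_eq_0\<close>)
    then show "dist_supp f \<inter> fun_supp ?\<phi> \<subseteq> {a}" using assms(5) by auto
  qed
  then have "f ?\<phi> = (\<Sum>j | mi_abs j \<le> m. p a j * dist_deriv j (dirac a) ?\<phi>)"
    using assms(1) t unfolding dirac_expansion_def by simp
  also have "\<dots> = (\<Sum>j | mi_abs j \<le> m. if j = k then (-1) ^ mi_abs k * p a k else 0)"
    by (intro sum.cong) (auto simp: dist_deriv_def dirac_def md)
  also have "\<dots> = (-1) ^ mi_abs k * p a k" using assms(3) finite_mi_abs_le[where 'd = 'd] by simp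
  finally show ?thesis by (simp add: norm_mult norm_power)
qed

lemma meets_support_if_nonzero:
  fixes f :: "(real^'d::finite \<Rightarrow> complex) \<Rightarrow> complex"
  assumes "lin_on_test f" "f (\<lambda>x. scaled_jet k s (x - t)) \<noteq> 0" "0 < s"
  obtains b where "b \<in> dist_supp f" "dist t b \<le> 2 * real CARD('d) * s"
proof -
  let ?\<phi> = "\<lambda>x. scaled_jet k s (x - t)"
  have "?\<phi> \<in> test_functions" by (intro test_shift test_scaled_jet assms)
  with vanishes_off_dist_supp[OF assms(1)] assms(2) obtain b where b: "b \<in> dist_supp f" "b \<in> fun_supp ?\<phi>"
    by blast
  have "fun_supp ?\<phi> \<subseteq> cball t (2 * real CARD('d) * s)"
    by (rule fun_supp_subset) (use assms(3) in \<open>auto simp: not_le dist_norm norm_minus_commute intro!: scaled_jet_eq_0\<close>)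
  with b that show thesis by auto
qed

subsection \<open>Integrals and sums of polynomially decaying functions\<close>

text \<open>Domination by balls: on the layer n <= |x| <= n + 1 the integrand is at most
  (n+1)^(-(d+2)), and the ball of radius n + 1 has volume of order (n+1)^d. The exponent d + 2
  leaves the convergent series of inverse squares.\<close>

lemma integrable_decay:
  "integrable lborel (\<lambda>x::real^'d::finite. 1 / (1 + norm x) ^ (CARD('d) + 2))"
proof (rule integrableI_bounded)
  let ?N = "CARD('d) + 2" and ?V = "unit_ball_vol (real CARD('d))"
  let ?t = "\<lambda>n::nat. \<lambda>x::real^'d. ennreal (1 / real (Suc n) ^ ?N) * indicator (cball 0 (real (Suc n))) x"
  show "(\<lambda>x::real^'d. 1 / (1 + norm x) ^ ?N) \<in> borel_measurable lborel" by measurable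
  have pw: "ennreal (norm (1 / (1 + norm x) ^ ?N)) \<le> (\<Sum>n. ?t n x)" for x :: "real^'d"
  proof -
    define n where "n = nat \<lfloor>norm x\<rfloor>"
    have n: "real n \<le> norm x" "norm x \<le> real (Suc n)" unfolding n_def by (simp_all, linarith)
    have "1 / (1 + norm x) ^ ?N \<le> 1 / real (Suc n) ^ ?N"
      using n by (intro divide_left_mono power_mono mult_pos_pos zero_less_power) (auto intro: add_pos_nonneg)
    then have "ennreal (norm (1 / (1 + norm x) ^ ?N)) \<le> ?t n x"
      using n by (simp add: ennreal_leI)
    also have "\<dots> = sum (\<lambda>n. ?t n x) {n}"
    proof -
      have "sum g {n} = g n" for g :: "nat \<Rightarrow> ennreal" by simp
      from this[symmetric] show ?thesis .
    qed
    also have "\<dots> \<le> (\<Sum>n. ?t n x)" by (rule sum_le_suminf) auto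
    finally show ?thesis .
  qed
  have "(\<integral>\<^sup>+x. ennreal (norm (1 / (1 + norm x) ^ ?N)) \<partial>(lborel :: (real^'d) measure)) \<le> (\<integral>\<^sup>+x. (\<Sum>n. ?t n x) \<partial>lborel)"
    by (rule nn_integral_mono) (rule pw)
  also have "\<dots> = (\<Sum>n. \<integral>\<^sup>+x. ?t n x \<partial>lborel)"
    by (rule nn_integral_suminf)
      (auto intro!: borel_measurable_times_ennreal borel_measurable_const borel_measurable_indicator)
  also have "\<dots> = (\<Sum>n. ennreal (?V * inverse (real (Suc n) ^ 2)))"
  proof (rule suminf_cong)
    fix n
    have "(\<integral>\<^sup>+x. ?t n x \<partial>lborel) = ennreal (1 / real (Suc n) ^ ?N) * emeasure lborel (cball (0::real^'d) (real (Suc n)))"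
      by (simp add: nn_integral_cmult_indicator)
    also have "\<dots> = ennreal (1 / real (Suc n) ^ ?N) * ennreal (?V * real (Suc n) ^ CARD('d))"
      by (simp add: emeasure_cball del: of_nat_Suc)
    also have "\<dots> = ennreal (?V * inverse (real (Suc n) ^ 2))"
      by (simp add: ennreal_mult[symmetric] power_add field_simps power2_eq_square del: of_nat_Suc)
    finally show "(\<integral>\<^sup>+x. ?t n x \<partial>lborel) = ennreal (?V * inverse (real (Suc n) ^ 2))" .
  qed
  also have "\<dots> < \<infinity>"
  proof -
    have "summable (\<lambda>n. inverse (real (Suc n) ^ 2))"
      using inverse_power_summable[of 2, where 'a = real]
      by (subst summable_Suc_iff[where f = "\<lambda>n. inverse (real n ^ 2)"]) simp
    then have "summable (\<lambda>n. ?V * inverse (real (Suc n) ^ 2))" by (rule summable_mult)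
    then have "(\<Sum>n. ennreal (?V * inverse (real (Suc n) ^ 2))) = ennreal (\<Sum>n. ?V * inverse (real (Suc n) ^ 2))"
      by (rule suminf_ennreal2[rotated]) (intro mult_nonneg_nonneg unit_ball_vol_nonneg, auto)
    then show ?thesis by (simp only: infinity_ennreal_def ennreal_less_top)
  qed
  finally show "(\<integral>\<^sup>+x. ennreal (norm (1 / (1 + norm x) ^ ?N)) \<partial>(lborel :: (real^'d) measure)) < \<infinity>" .
qed

lemma integral_lborel_affine:
  fixes f :: "'a::euclidean_space \<Rightarrow> 'b::{banach, second_countable_topology}"
  assumes "f \<in> borel_measurable borel" "r \<noteq> 0"
  shows "(\<integral>x. f x \<partial>lborel) = \<bar>r\<bar> ^ DIM('a) *\<^sub>R (\<integral>x. f (t + r *\<^sub>R x) \<partial>lborel)"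
  using assms by (subst lborel_affine[of r t]) (simp_all add: integral_density integral_distr)

lemma integrable_lborel_affine:
  fixes f :: "'a::euclidean_space \<Rightarrow> 'b::{banach, second_countable_topology}"
  assumes "integrable lborel f" "r \<noteq> 0"
  shows "integrable lborel (\<lambda>x. f (t + r *\<^sub>R x))"
proof -
  have m: "f \<in> borel_measurable borel" using borel_measurable_integrable[OF assms(1)] by simp
  have "integrable (density (distr lborel borel (\<lambda>x. t + r *\<^sub>R x)) (\<lambda>_. ennreal (\<bar>r\<bar> ^ DIM('a)))) f"
    using assms lborel_affine[of r t] by simp
  then have "integrable lborel (\<lambda>x. \<bar>r\<bar> ^ DIM('a) *\<^sub>R f (t + r *\<^sub>R x))"
    using m by (subst (asm) integrable_density) (simp_all add: integrable_distr_eq)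
  from integrable_scaleR_right[OF this, of "inverse (\<bar>r\<bar> ^ DIM('a))"] assms(2)
  show ?thesis by simp
qed

text \<open>Each term is comparable to the integral of the weight over the ball of radius s/2 around
  its point. These balls are disjoint, so the sum is bounded by the full integral, and substitution
  turns that into a multiple of \<epsilon>^(-d), independent of \<open>t\<close>.\<close>

lemma separated_sum_bound:
  fixes A :: "(real^'d::finite) set"
  assumes "0 < s" "\<And>a b. a \<in> A \<Longrightarrow> b \<in> A \<Longrightarrow> a \<noteq> b \<Longrightarrow> s \<le> dist a b"
  obtains C where "0 < C" "\<And>\<epsilon> t F. 0 < \<epsilon> \<Longrightarrow> \<epsilon> \<le> 1 \<Longrightarrow> finite F \<Longrightarrow> F \<subseteq> A \<Longrightarrow>
    (\<Sum>a\<in>F. 1 / (1 + \<epsilon> * norm (a - t)) ^ (CARD('d) + 2)) \<le> C / \<epsilon> ^ CARD('d)"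
proof -
  let ?N = "CARD('d) + 2"
  let ?g = "\<lambda>x::real^'d. 1 / (1 + norm x) ^ ?N"
  define V where "V = measure lborel (ball (0::real^'d) (s / 2))"
  have V: "measure lborel (ball a (s / 2)) = V" for a :: "real^'d"
    unfolding V_def using assms(1) by (simp add: content_ball)
  have "0 < V" unfolding V_def using assms(1) by (simp add: content_ball)
  \<comment> \<open>Since \<epsilon> <= 1, moving a point by s/2 changes 1 + \<epsilon> |x - t| by
    at most the factor 1 + s/2.\<close>
  define c where "c = 1 / (1 + s / 2) ^ ?N"
  have c: "0 < c" unfolding c_def using assms(1) by simp
  define I where "I = (\<integral>x. ?g x \<partial>lborel)"
  have I: "0 \<le> I" unfolding I_def by (intro integral_nonneg_AE) auto
  show thesis
  proof (rule that[of "(I + 1) / (c * V)"])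
    show "0 < (I + 1) / (c * V)" using I c \<open>0 < V\<close> by simp
    fix \<epsilon> t F assume \<epsilon>: "0 < \<epsilon>" "\<epsilon> \<le> (1::real)" and F: "finite F" "F \<subseteq> A"
    let ?h = "\<lambda>x. ?g (- \<epsilon> *\<^sub>R t + \<epsilon> *\<^sub>R x)"
    have arg: "- \<epsilon> *\<^sub>R t + \<epsilon> *\<^sub>R x = \<epsilon> *\<^sub>R (x - t)" for x by (simp add: scaleR_diff_right)
    have h: "?h x = 1 / (1 + \<epsilon> * norm (x - t)) ^ ?N" for x unfolding arg using \<epsilon> by simp
    have ih: "integrable lborel ?h" using \<epsilon> by (intro integrable_lborel_affine integrable_decay) auto
    have iB: "integrable lborel (\<lambda>x. indicator (ball a (s / 2)) x * ?h x)" for a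
      using integrable_mult_indicator[OF _ ih, of "ball a (s / 2)"] by simp
    have one: "c * V * ?h a \<le> (\<integral>x. indicator (ball a (s / 2)) x * ?h x \<partial>lborel)" for a
    proof -
      have "(\<integral>x. c * ?h a * indicator (ball a (s / 2)) x \<partial>lborel)
          \<le> (\<integral>x. indicator (ball a (s / 2)) x * ?h x \<partial>lborel)"
      proof (rule integral_mono[OF _ iB])
        show "integrable lborel (\<lambda>x. c * ?h a * indicator (ball a (s / 2)) x)"
          using emeasure_lborel_ball_finite[of a "s / 2"]
          by (intro integrable_mult_right integrable_real_indicator) auto
        fix x
        show "c * ?h a * indicator (ball a (s / 2)) x \<le> indicator (ball a (s / 2)) x * ?h x"
        proof (cases "x \<in> ball a (s / 2)")
          case True
          have "norm (x - t) \<le> norm (x - a) + norm (a - t)" using norm_triangle_ineq[of "x - a" "a - t"] by simp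
          moreover have "norm (x - a) \<le> s / 2" using True by (simp add: dist_norm norm_minus_commute)
          ultimately have "norm (x - t) \<le> norm (a - t) + s / 2" by linarith
          then have "\<epsilon> * norm (x - t) \<le> \<epsilon> * norm (a - t) + \<epsilon> * (s / 2)"
            using \<epsilon> mult_left_mono[of "norm (x - t)" "norm (a - t) + s / 2" \<epsilon>] by (simp add: algebra_simps)
          also have "\<epsilon> * (s / 2) \<le> s / 2" using \<epsilon> assms(1) by (simp add: mult_left_le_one_le)
          finally have "1 + \<epsilon> * norm (x - t) \<le> 1 + \<epsilon> * norm (a - t) + s / 2" by simp
          also have "\<dots> \<le> (1 + s / 2) * (1 + \<epsilon> * norm (a - t))"
            using mult_nonneg_nonneg[of "s / 2" "\<epsilon> * norm (a - t)"] assms(1) \<epsilon> by (simp add: algebra_simps)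
          finally have "(1 + \<epsilon> * norm (x - t)) ^ ?N \<le> ((1 + s / 2) * (1 + \<epsilon> * norm (a - t))) ^ ?N"
            using \<epsilon> by (intro power_mono) auto
          then have "1 / ((1 + s / 2) * (1 + \<epsilon> * norm (a - t))) ^ ?N \<le> 1 / (1 + \<epsilon> * norm (x - t)) ^ ?N"
            using \<epsilon> assms(1) by (intro divide_left_mono mult_pos_pos zero_less_power add_pos_nonneg) auto
          then have "c * ?h a \<le> ?h x"
            unfolding h c_def by (simp only: power_mult_distrib times_divide_times_eq mult_1_left)
          then show ?thesis using True by (simp only: indicator_simps mult_1_left mult_1_right)
        qed simp
      qed
      note le = this
      have eq: "(\<integral>x. q * indicator (ball a (s / 2)) x \<partial>lborel) = q * V" for q :: real
        unfolding V[of a, symmetric] by simp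
      have "c * ?h a * V \<le> (\<integral>x. indicator (ball a (s / 2)) x * ?h x \<partial>lborel)"
        by (rule ord_eq_le_trans[OF eq[symmetric] le])
      then show ?thesis by (simp only: mult_ac)
    qed
    have "c * V * (\<Sum>a\<in>F. ?h a) = (\<Sum>a\<in>F. c * V * ?h a)" by (rule sum_distrib_left)
    also have "\<dots> \<le> (\<Sum>a\<in>F. \<integral>x. indicator (ball a (s / 2)) x * ?h x \<partial>lborel)"
      by (rule sum_mono) (rule one)
    also have "\<dots> = (\<integral>x. (\<Sum>a\<in>F. indicator (ball a (s / 2)) x * ?h x) \<partial>lborel)"
      by (rule Bochner_Integration.integral_sum[symmetric]) (rule iB)
    also have "\<dots> \<le> (\<integral>x. ?h x \<partial>lborel)"
    proof (rule integral_mono[OF _ ih])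
      show "integrable lborel (\<lambda>x. \<Sum>a\<in>F. indicator (ball a (s / 2)) x * ?h x)"
        by (rule Bochner_Integration.integrable_sum) (rule iB)
      fix x
      \<comment> \<open>Disjointness of the balls: at any \<open>x\<close> at most one indicator is
        nonzero.\<close>
      have "(\<Sum>a\<in>F. indicator (ball a (s / 2)) x :: real) \<le> 1"
      proof (cases "\<exists>a\<in>F. x \<in> ball a (s / 2)")
        case True
        then obtain a where a: "a \<in> F" "x \<in> ball a (s / 2)" by blast
        have uniq: "b = a" if "b \<in> F" "x \<in> ball b (s / 2)" for b
        proof (rule ccontr)
          assume "b \<noteq> a"
          then have "s \<le> dist b a" using assms(2) F(2) a(1) that(1) by blast
          moreover have "dist b a \<le> dist b x + dist a x" by (rule dist_triangle2)
          ultimately show False using a(2) that(2) by simp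
        qed
        have "(\<Sum>b\<in>F. indicator (ball b (s / 2)) x :: real) = (\<Sum>b\<in>F. if b = a then 1 else 0)"
        proof (rule sum.cong[OF refl])
          fix b assume "b \<in> F"
          from uniq[OF this] a(2) show "(indicator (ball b (s / 2)) x :: real) = (if b = a then 1 else 0)"
            by (cases "x \<in> ball b (s / 2)") auto
        qed
        then show ?thesis using F(1) by simp
      next
        case False
        then have "(\<Sum>b\<in>F. indicator (ball b (s / 2)) x :: real) = 0" by (intro sum.neutral) auto
        then show ?thesis by simp
      qed
      then have "(\<Sum>a\<in>F. indicator (ball a (s / 2)) x) * ?h x \<le> 1 * ?h x"
        by (intro mult_right_mono) auto
      then show "(\<Sum>a\<in>F. indicator (ball a (s / 2)) x * ?h x) \<le> ?h x"
        by (simp only: sum_distrib_right mult_1_left)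
    qed
    also have "(\<integral>x. ?h x \<partial>lborel) = I / \<epsilon> ^ CARD('d)"
      using integral_lborel_affine[of ?g \<epsilon> "- \<epsilon> *\<^sub>R t"] \<epsilon> by (simp add: I_def)
    also have "\<dots> \<le> (I + 1) / \<epsilon> ^ CARD('d)" using \<epsilon> by (intro divide_right_mono) auto
    finally have *: "c * V * (\<Sum>a\<in>F. ?h a) \<le> (I + 1) / \<epsilon> ^ CARD('d)" .
    have "X \<le> Y / (c * V)" if "c * V * X \<le> Y" for X Y
      using that c \<open>0 < V\<close> by (simp add: pos_le_divide_eq mult_ac)
    from this[OF *] have "(\<Sum>a\<in>F. ?h a) \<le> (I + 1) / \<epsilon> ^ CARD('d) / (c * V)" .
    then show "(\<Sum>a\<in>F. 1 / (1 + \<epsilon> * norm (a - t)) ^ ?N) \<le> (I + 1) / (c * V) / \<epsilon> ^ CARD('d)"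
      unfolding h by (simp only: divide_divide_eq_left mult.commute[of "\<epsilon> ^ CARD('d)"])
  qed
qed

subsection \<open>The expansion on rapidly decreasing functions\<close>

lemma rapid_uniform:
  fixes \<phi> :: "real^'d::finite \<Rightarrow> complex"
  assumes "rapid \<phi>"
  obtains S where "0 < S" "\<And>is x. length is \<le> m \<Longrightarrow> (1 + norm x) ^ n * cmod (pderivs is \<phi> x) \<le> S"
proof -
  obtain B where B: "\<And>is x. (1 + norm x) ^ n * cmod (pderivs is \<phi> x) \<le> B is"
    using assms unfolding rapid_def by metis
  show thesis
  proof (rule that[of "1 + (\<Sum>is\<in>{is. length is \<le> m}. \<bar>B is\<bar>)"])
    show "0 < 1 + (\<Sum>is\<in>{is. length is \<le> m}. \<bar>B is\<bar>)" by (intro add_pos_nonneg sum_nonneg) auto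
    fix "is" :: "'d list" and x assume "length is \<le> m"
    then have "\<bar>B is\<bar> \<le> (\<Sum>is\<in>{is. length is \<le> m}. \<bar>B is\<bar>)"
      using finite_lists_le by (intro member_le_sum) auto
    then show "(1 + norm x) ^ n * cmod (pderivs is \<phi> x) \<le> 1 + (\<Sum>is\<in>{is. length is \<le> m}. \<bar>B is\<bar>)"
      using B[of x "is"] by linarith
  qed
qed

text \<open>Stretching the plateau by a factor at least 1 only shrinks its derivatives, so the bound
  is uniform in \<open>R\<close>.\<close>

lemma cutoff_0_bound:
  obtains E where "0 < E" "\<And>R is (x::real^'d::finite). 1 \<le> R \<Longrightarrow> length is \<le> m \<Longrightarrow>
    cmod (pderivs is (cutoff 0 R) x) \<le> E"
proof -
  obtain E where E: "0 < E" "\<And>is x. length is \<le> m \<Longrightarrow> cmod (pderivs is (jet (\<lambda>_. 0)) (x::real^'d)) \<le> E"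
    using test_bounded[OF test_jet, of m "\<lambda>_. 0"] by blast
  show thesis
  proof (rule that[OF E(1)])
    fix R :: real and "is" :: "'d list" and x assume R: "1 \<le> R" and l: "length is \<le> m"
    have "cmod (pderivs is (cutoff 0 R) x) \<le> 1 * E"
      unfolding cutoff_def[abs_def] pderivs_affine[OF smooth_jet] norm_mult norm_of_real
      using R by (intro mult_mono E l) (auto intro!: power_le_one)
    then show "cmod (pderivs is (cutoff 0 R) x) \<le> E" by simp
  qed
qed

text \<open>Rapid decay supplies one power of 1 + |x| more than the continuity estimate consumes,
  and on the region where the cutoff differs from 1 this power is worth 1/(1 + R).\<close>

lemma tendsto_cutoff:
  fixes f :: "(real^'d::finite \<Rightarrow> complex) \<Rightarrow> complex"
  assumes f: "tempered_distribution f" and \<xi>: "rapid \<xi>"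
  obtains K where "0 < K" "\<And>R. 1 \<le> R \<Longrightarrow> cmod (f \<xi> - f (\<lambda>x. \<xi> x * cutoff 0 R x)) \<le> K / (1 + R)"
proof -
  obtain C n m where C: "0 < C" "\<And>\<phi> M. rapid \<phi> \<Longrightarrow> 0 < M \<Longrightarrow>
      (\<And>is x. length is \<le> m \<Longrightarrow> (1 + norm x) ^ n * cmod (pderivs is \<phi> x) \<le> M) \<Longrightarrow> cmod (f \<phi>) \<le> C * M"
  proof (rule tempered_seminorm_bound[OF f], goal_cases)
    case (1 C n m)
    show ?case by (rule 1(1)[OF 1(2,3)])
  qed
  obtain S where S: "0 < S" "\<And>is x. length is \<le> m \<Longrightarrow> (1 + norm x) ^ Suc n * cmod (pderivs is \<xi> x) \<le> S"
    using rapid_uniform[OF \<xi>, of m "Suc n"] by blast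
  obtain E where E: "0 < E" "\<And>R is (x::real^'d::finite). 1 \<le> R \<Longrightarrow> length is \<le> m \<Longrightarrow>
      cmod (pderivs is (cutoff 0 R) x) \<le> E"
    using cutoff_0_bound[of m, where 'd = 'd] by blast
  have s: "smooth \<xi>" using \<xi> by (rule rapid_smooth)
  show thesis
  proof (rule that[of "C * (2 ^ m * (S * (1 + E)))"])
    show "0 < C * (2 ^ m * (S * (1 + E)))" using C(1) S(1) E(1) by simp
    fix R :: real assume R: "1 \<le> R"
    let ?e = "\<lambda>x. 1 - cutoff 0 R x"
    have se: "smooth ?e" by (intro smooth_diff smooth_const smooth_cutoff)
    have z: "smooth (cutoff (0::real^'d) R)" "smooth (\<lambda>x::real^'d. 1)" by (intro smooth_const smooth_cutoff)+
    have rap: "rapid (\<lambda>x. \<xi> x * cutoff 0 R x)"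
    proof -
      have "(\<lambda>x. cutoff 0 R x * \<xi> x) \<in> test_functions" using R by (intro test_mult test_cutoff s) auto
      from test_rapid[OF this] show ?thesis by (simp add: mult.commute)
    qed
    have bnd: "cmod (f (\<lambda>x. \<xi> x - \<xi> x * cutoff 0 R x)) \<le> C * (2 ^ m * (S * (1 + E)) / (1 + R))"
    proof (rule C(2)[OF rapid_diff[OF \<xi> rap]])
      show "0 < 2 ^ m * (S * (1 + E)) / (1 + R)" using S(1) E(1) R by simp
      fix "is" :: "'d list" and x :: "real^'d" assume l: "length is \<le> m"
      have eq: "(\<lambda>x. \<xi> x - \<xi> x * cutoff 0 R x) = (\<lambda>x. \<xi> x * ?e x)" by (simp add: algebra_simps)
      show "(1 + norm x) ^ n * cmod (pderivs is (\<lambda>x. \<xi> x - \<xi> x * cutoff 0 R x) x) \<le> 2 ^ m * (S * (1 + E)) / (1 + R)"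
      proof (cases "norm x < R")
        case True
        have "pderivs is (\<lambda>x. \<xi> x * ?e x) x = pderivs is (\<lambda>x. 0) x"
        proof (rule pderivs_cong_open[of "ball 0 R"])
          fix y :: "real^'d" assume "y \<in> ball 0 R"
          then show "\<xi> y * ?e y = 0" using R by (simp add: cutoff_eq_1)
        qed (use True in auto)
        then show ?thesis using eq S(1) E(1) R by simp
      next
        case False
        have "cmod (pderivs is (\<lambda>x. \<xi> x * ?e x) x) \<le> 2 ^ length is * (S / (1 + norm x) ^ Suc n * (1 + E))"
        proof (rule norm_pderivs_mult_le[OF s se])
          fix a :: "'d list" assume "length a \<le> length is"
          then show "cmod (pderivs a \<xi> x) \<le> S / (1 + norm x) ^ Suc n"
            using S(2)[of a x] l by (simp add: pos_le_divide_eq add_pos_nonneg mult_ac del: power_Suc)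
        next
          fix b :: "'d list" assume "length b \<le> length is"
          then have "cmod (pderivs b (cutoff 0 R) x) \<le> E" using E(2)[OF R] l by simp
          moreover have "cmod (pderivs b (\<lambda>x. 1) x) \<le> 1" by (cases "b = []") (auto simp: pderivs_const)
          moreover have "pderivs b ?e x = pderivs b (\<lambda>x. 1) x - pderivs b (cutoff 0 R) x"
            using pderivs_diff[OF z(2,1), of b] by simp
          ultimately show "cmod (pderivs b ?e x) \<le> 1 + E"
            using norm_triangle_ineq4[of "pderivs b (\<lambda>x. 1) x" "pderivs b (cutoff 0 R) x"] by simp
        qed
        also have "\<dots> \<le> 2 ^ m * (S / (1 + norm x) ^ Suc n * (1 + E))"
          using l S(1) E(1) by (intro mult_right_mono power_increasing) auto
        finally have "(1 + norm x) ^ n * cmod (pderivs is (\<lambda>x. \<xi> x * ?e x) x)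
            \<le> (1 + norm x) ^ n * (2 ^ m * (S / (1 + norm x) ^ Suc n * (1 + E)))"
          by (intro mult_left_mono) auto
        also have "\<dots> = 2 ^ m * (S * (1 + E)) / (1 + norm x)"
        proof -
          have "u ^ n * (A * (S / u ^ Suc n * B)) = A * (S * B) / u" if "u \<noteq> 0" for u A B :: real
            using that by (simp add: field_simps)
          moreover have "1 + norm x \<noteq> 0" using norm_ge_zero[of x] by linarith
          ultimately show ?thesis by blast
        qed
        also have "\<dots> \<le> 2 ^ m * (S * (1 + E)) / (1 + R)"
          using False R S(1) E(1) by (intro divide_left_mono mult_pos_pos) auto
        finally show ?thesis unfolding eq .
      qed
    qed
    then show "cmod (f \<xi> - f (\<lambda>x. \<xi> x * cutoff 0 R x)) \<le> C * (2 ^ m * (S * (1 + E))) / (1 + R)"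
      by (simp add: tempered_diff[OF f \<xi> rap])
  qed
qed

text \<open>The expansion holds on test functions only, so the bound is first proved for cut-off
  functions, uniformly in the radius, and then passed to the limit. A bound on all finite partial
  sums of \<open>w\<close> stands in for summability over the support.\<close>

lemma dirac_expansion_bound:
  fixes f :: "(real^'d::finite \<Rightarrow> complex) \<Rightarrow> complex"
  assumes f: "tempered_distribution f" and e: "dirac_expansion f m p" and d: "discrete_set (dist_supp f)"
    and B: "\<And>a k. a \<in> dist_supp f \<Longrightarrow> mi_abs k \<le> m \<Longrightarrow> cmod (p a k) \<le> B"
  obtains C where "0 < C" "\<And>\<xi> w W. rapid \<xi> \<Longrightarrow> (\<And>is x. length is \<le> m \<Longrightarrow> cmod (pderivs is \<xi> x) \<le> w x) \<Longrightarrow>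
    (\<And>F. finite F \<Longrightarrow> F \<subseteq> dist_supp f \<Longrightarrow> sum w F \<le> W) \<Longrightarrow> cmod (f \<xi>) \<le> C * W"
proof -
  let ?K = "{k :: 'd \<Rightarrow> nat. mi_abs k \<le> m}"
  obtain E where E: "0 < E" "\<And>R is (x::real^'d::finite). 1 \<le> R \<Longrightarrow> length is \<le> m \<Longrightarrow>
      cmod (pderivs is (cutoff 0 R) x) \<le> E"
    using cutoff_0_bound[of m, where 'd = 'd] by blast
  \<comment> \<open>Number of multi-indices times the coefficient bound, the Leibniz constant and
    the cutoff bound; the 1 keeps it positive.\<close>
  define C where "C = (real (card ?K) * \<bar>B\<bar> + 1) * (2 ^ m * E)"
  have C: "0 < C" unfolding C_def using E(1) by (intro mult_pos_pos add_nonneg_pos) auto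
  show thesis
  proof (rule that[OF C])
    fix \<xi> :: "real^'d \<Rightarrow> complex" and w W
    assume \<xi>: "rapid \<xi>" and w: "\<And>is x. length is \<le> m \<Longrightarrow> cmod (pderivs is \<xi> x) \<le> w x"
      and W: "\<And>F. finite F \<Longrightarrow> F \<subseteq> dist_supp f \<Longrightarrow> sum w F \<le> W"
    have s: "smooth \<xi>" using \<xi> by (rule rapid_smooth)
    have w0: "0 \<le> w x" for x using order_trans[OF norm_ge_zero w[of "[]" x]] by simp
    have cut: "cmod (f (\<lambda>x. \<xi> x * cutoff 0 R x)) \<le> C * W" if R: "1 \<le> R" for R
    proof -
      let ?\<xi> = "\<lambda>x. \<xi> x * cutoff 0 R x" and ?F = "dist_supp f \<inter> fun_supp (\<lambda>x. \<xi> x * cutoff 0 R x)"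
      have t: "?\<xi> \<in> test_functions"
      proof -
        have "(\<lambda>x. cutoff 0 R x * \<xi> x) \<in> test_functions" using R by (intro test_mult test_cutoff s) auto
        then show ?thesis by (simp add: mult.commute)
      qed
      have fin: "finite ?F"
        using t by (intro discrete_set_finite_Int d) (auto simp: test_functions_def compact_imp_bounded)
      have "cmod (f ?\<xi>) = cmod (\<Sum>a\<in>?F. \<Sum>k\<in>?K. p a k * dist_deriv k (dirac a) ?\<xi>)"
        using e t unfolding dirac_expansion_def by simp
      also have "\<dots> \<le> (\<Sum>a\<in>?F. \<Sum>k\<in>?K. \<bar>B\<bar> * (2 ^ m * (w a * E)))"
      proof (intro sum_norm_le)
        fix a k assume a: "a \<in> ?F" and k: "k \<in> ?K"
        have "cmod (multi_deriv k ?\<xi> a) \<le> 2 ^ length (mi_list k) * (w a * E)"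
          unfolding multi_deriv_eq
          by (rule norm_pderivs_mult_le[OF s smooth_cutoff])
            (use k R w E in \<open>auto simp: length_mi_list\<close>)
        also have "\<dots> \<le> 2 ^ m * (w a * E)"
          using k w0[of a] E(1) by (intro mult_right_mono power_increasing) (auto simp: length_mi_list)
        finally have "cmod (multi_deriv k ?\<xi> a) \<le> 2 ^ m * (w a * E)" .
        moreover have "cmod (p a k) \<le> \<bar>B\<bar>" using B[of a k] a k by auto
        ultimately show "cmod (p a k * dist_deriv k (dirac a) ?\<xi>) \<le> \<bar>B\<bar> * (2 ^ m * (w a * E))"
          by (auto simp: dist_deriv_def dirac_def norm_mult norm_power intro!: mult_mono)
      qed
      also have "\<dots> = (real (card ?K) * \<bar>B\<bar>) * (2 ^ m * E) * sum w ?F"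
        by (simp add: sum_distrib_left mult_ac)
      also have "\<dots> \<le> C * sum w ?F"
        unfolding C_def using E(1) by (intro mult_right_mono sum_nonneg w0) auto
      also have "\<dots> \<le> C * W" using C fin by (intro mult_left_mono W) auto
      finally show ?thesis .
    qed
    obtain K where K: "0 < K" "\<And>R. 1 \<le> R \<Longrightarrow> cmod (f \<xi> - f (\<lambda>x. \<xi> x * cutoff 0 R x)) \<le> K / (1 + R)"
      using tendsto_cutoff[OF f \<xi>] by blast
    show "cmod (f \<xi>) \<le> C * W"
    proof (rule field_le_epsilon)
      fix e :: real assume e: "0 < e"
      define R where "R = max 1 (K / e)"
      have R: "1 \<le> R" "K / e \<le> R" by (auto simp: R_def)
      have "K \<le> e * (1 + R)" using R e by (simp add: pos_divide_le_eq algebra_simps)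
      then have "K / (1 + R) \<le> e" using R by (simp add: pos_divide_le_eq)
      then have "cmod (f \<xi> - f (\<lambda>x. \<xi> x * cutoff 0 R x)) \<le> e" using K(2)[OF R(1)] by linarith
      then show "cmod (f \<xi>) \<le> C * W + e"
        using cut[OF R(1)] norm_triangle_ineq2[of "f \<xi>" "f (\<lambda>x. \<xi> x * cutoff 0 R x)"] by linarith
    qed
  qed
qed

subsection \<open>The Fourier transform of test functions\<close>

lemma fourier_character: "fourier \<psi> y = (LINT x|lborel. \<psi> x * character (- y) x)"
  unfolding fourier_def character_def
  by (intro Bochner_Integration.integral_cong refl) (simp add: inner_commute)

lemma integrable_compact_support:
  fixes h :: "real^'d::finite \<Rightarrow> complex"
  assumes "continuous_on UNIV h" "\<And>x. R < norm x \<Longrightarrow> h x = 0"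
  shows "integrable lborel h"
proof -
  have "integrable lborel (\<lambda>x. indicator (cball 0 R) x *\<^sub>R h x)"
    using assms(1) by (intro borel_integrable_compact) (auto intro: continuous_on_subset)
  moreover have "(\<lambda>x. indicator (cball 0 R) x *\<^sub>R h x) = h"
    using assms(2) by (auto simp: indicator_def fun_eq_iff not_le)
  ultimately show ?thesis by simp
qed

lemma integral_compact_support_bound:
  fixes h :: "real^'d::finite \<Rightarrow> complex"
  assumes "continuous_on UNIV h" "\<And>x. R < norm x \<Longrightarrow> h x = 0" "\<And>x. cmod (h x) \<le> M"
  shows "cmod (\<integral>x. h x \<partial>lborel) \<le> M * measure lborel (cball (0::real^'d) R)"
proof -
  have "cmod (\<integral>x. h x \<partial>lborel) \<le> (\<integral>x. cmod (h x) \<partial>lborel)"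
    by (rule integral_norm_bound)
  also have "\<dots> \<le> (\<integral>x. M * indicator (cball (0::real^'d) R) x \<partial>lborel)"
  proof (rule integral_mono)
    show "integrable lborel (\<lambda>x. cmod (h x))"
      by (intro integrable_norm integrable_compact_support[of h R] assms)
    show "integrable lborel (\<lambda>x::real^'d. M * indicator (cball 0 R) x)"
      using emeasure_lborel_cball_finite[of "0::real^'d" R]
      by (intro integrable_mult_right integrable_real_indicator) auto
    show "cmod (h x) \<le> M * indicator (cball 0 R) x" for x
      using assms(2)[of x] assms(3)[of x] by (auto simp: indicator_def not_le)
  qed
  finally show ?thesis by simp
qed

lemma test_integrable_mult:
  assumes "\<psi> \<in> test_functions" "continuous_on UNIV g"
  shows "integrable lborel (\<lambda>x. \<psi> x * g x)"
proof -
  obtain R where R: "\<And>x. R < norm x \<Longrightarrow> \<psi> x = 0" using test_bound[OF assms(1)] by metis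
  show ?thesis
  proof (rule integrable_compact_support[of _ R])
    show "continuous_on UNIV (\<lambda>x. \<psi> x * g x)"
      by (rule continuous_on_mult[OF smooth_continuous_on[OF test_smooth[OF assms(1)]] assms(2)])
  qed (simp add: R)
qed

lemma fourier_lin:
  assumes "\<phi> \<in> test_functions" "\<psi> \<in> test_functions"
  shows "fourier (\<lambda>x. a * \<phi> x + b * \<psi> x) = (\<lambda>y. a * fourier \<phi> y + b * fourier \<psi> y)"
proof
  fix y
  have i: "integrable lborel (\<lambda>x. \<phi> x * character (- y) x)" "integrable lborel (\<lambda>x. \<psi> x * character (- y) x)"
    by (intro test_integrable_mult assms continuous_character)+
  have "fourier (\<lambda>x. a * \<phi> x + b * \<psi> x) y
      = (\<integral>x. a * (\<phi> x * character (- y) x) + b * (\<psi> x * character (- y) x) \<partial>lborel)"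
    unfolding fourier_character by (intro Bochner_Integration.integral_cong) (auto simp: algebra_simps)
  also have "\<dots> = a * fourier \<phi> y + b * fourier \<psi> y"
    unfolding fourier_character using i
    by (subst Bochner_Integration.integral_add) auto
  finally show "fourier (\<lambda>x. a * \<phi> x + b * \<psi> x) y = a * fourier \<phi> y + b * fourier \<psi> y" .
qed

lemma fourier_cmult: "\<psi> \<in> test_functions \<Longrightarrow> fourier (\<lambda>x. a * \<psi> x) = (\<lambda>y. a * fourier \<psi> y)"
  using fourier_lin[of \<psi> \<psi> a 0] by simp

lemma fourier_mult_character:
  "fourier (\<lambda>x. \<psi> x * character t x) = (\<lambda>y. fourier \<psi> (y - t))"
proof
  fix y
  have "character (- (y - t)) x = character t x * character (- y) x" for x
    by (simp add: character_add[symmetric])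
  then show "fourier (\<lambda>x. \<psi> x * character t x) y = fourier \<psi> (y - t)"
    unfolding fourier_character by (simp add: mult.assoc)
qed

lemma fourier_affine:
  fixes \<psi> :: "real^'d::finite \<Rightarrow> complex"
  assumes "\<psi> \<in> test_functions" "0 < \<epsilon>"
  shows "fourier (\<lambda>x. \<psi> (- (1 / \<epsilon>) *\<^sub>R a + (1 / \<epsilon>) *\<^sub>R x)) y
    = of_real (\<epsilon> ^ CARD('d)) * (character (- a) y * fourier \<psi> (\<epsilon> *\<^sub>R y))"
proof -
  let ?g = "\<lambda>x. \<psi> (- (1 / \<epsilon>) *\<^sub>R a + (1 / \<epsilon>) *\<^sub>R x) * character (- y) x"
  have "continuous_on UNIV ?g"
    by (intro continuous_on_mult smooth_continuous_on smooth_affine test_smooth assms smooth_character)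
  then have "?g \<in> borel_measurable borel" by (rule borel_measurable_continuous_onI)
  from integral_lborel_affine[OF this, of \<epsilon> a] assms(2)
  have "(\<integral>x. ?g x \<partial>lborel) = \<epsilon> ^ CARD('d) *\<^sub>R (\<integral>x. ?g (a + \<epsilon> *\<^sub>R x) \<partial>lborel)" by simp
  also have "(\<integral>x. ?g (a + \<epsilon> *\<^sub>R x) \<partial>lborel)
      = (\<integral>x. character (- a) y * (\<psi> x * character (- (\<epsilon> *\<^sub>R y)) x) \<partial>lborel)"
  proof (intro Bochner_Integration.integral_cong refl)
    fix x
    have "character (- y) (a + \<epsilon> *\<^sub>R x) = character (- a) y * character (- (\<epsilon> *\<^sub>R y)) x"
      by (simp add: character_def exp_add[symmetric] inner_commute algebra_simps)
    moreover have "- (1 / \<epsilon>) *\<^sub>R a + (1 / \<epsilon>) *\<^sub>R (a + \<epsilon> *\<^sub>R x) = x"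
      using assms(2) by (simp add: scaleR_add_right)
    ultimately show "?g (a + \<epsilon> *\<^sub>R x) = character (- a) y * (\<psi> x * character (- (\<epsilon> *\<^sub>R y)) x)"
      by (simp add: mult_ac)
  qed
  also have "\<dots> = character (- a) y * fourier \<psi> (\<epsilon> *\<^sub>R y)"
    unfolding fourier_character by simp
  finally show ?thesis unfolding fourier_character by (simp add: scaleR_conv_of_real)
qed

section \<open>Derivatives and decay of the transform\<close>

lemma norm_exp_i_minus_1_le: "cmod (exp (\<i> * of_real \<theta>) - 1) \<le> \<bar>\<theta>\<bar>"
proof -
  have "cmod (exp (\<i> * of_real \<theta>) - 1) = 2 * \<bar>sin (\<theta> / 2)\<bar>" by (rule dist_exp_i_1)
  also have "\<dots> \<le> 2 * \<bar>\<theta> / 2\<bar>" using abs_sin_x_le_abs_x[of "\<theta> / 2"] by simp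
  finally show ?thesis by simp
qed

lemma norm_exp_i_taylor1: "cmod (exp (\<i> * of_real \<theta>) - 1 - \<i> * of_real \<theta>) \<le> \<theta> ^ 2"
proof -
  let ?g = "\<lambda>s. exp (\<i> * of_real (s * \<theta>)) - 1 - of_real s * (\<i> * of_real \<theta>)"
  have "norm (?g 1 - ?g 0) \<le> (\<theta> ^ 2) * 1"
  proof (rule has_vector_derivative_bound[where
        g' = "\<lambda>s. \<i> * of_real \<theta> * exp (\<i> * of_real (s * \<theta>)) - \<i> * of_real \<theta>"])
    fix s :: real assume s: "0 \<le> s" "s \<le> 1"
    have "((\<lambda>z. exp (\<i> * (z * of_real \<theta>)) - 1 - z * (\<i> * of_real \<theta>)) has_field_derivative
        \<i> * of_real \<theta> * exp (\<i> * (of_real s * of_real \<theta>)) - \<i> * of_real \<theta>) (at (complex_of_real s))"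
      by (auto intro!: derivative_eq_intros)
    from has_vector_derivative_real_field[OF this]
    show "(?g has_vector_derivative \<i> * of_real \<theta> * exp (\<i> * of_real (s * \<theta>)) - \<i> * of_real \<theta>) (at s)"
      by simp
    have "\<i> * of_real \<theta> * exp (\<i> * of_real (s * \<theta>)) - \<i> * of_real \<theta>
        = \<i> * of_real \<theta> * (exp (\<i> * of_real (s * \<theta>)) - 1)" by (simp add: algebra_simps)
    also have "cmod \<dots> \<le> \<bar>\<theta>\<bar> * \<bar>s * \<theta>\<bar>"
      unfolding norm_mult using norm_exp_i_minus_1_le[of "s * \<theta>"] by (auto intro!: mult_left_mono)
    also have "\<dots> = s * \<theta> ^ 2" using s by (simp add: abs_mult power2_eq_square mult_ac)
    also have "\<dots> \<le> 1 * \<theta> ^ 2" using s by (intro mult_right_mono) auto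
    finally show "norm (\<i> * of_real \<theta> * exp (\<i> * of_real (s * \<theta>)) - \<i> * of_real \<theta>) \<le> \<theta> ^ 2" by simp
  qed simp
  then show ?thesis by simp
qed

text \<open>Multiplication by the factor that a derivative of the Fourier kernel brings
  down.\<close>

definition coord_mult :: "'d::finite \<Rightarrow> (real^'d \<Rightarrow> complex) \<Rightarrow> real^'d \<Rightarrow> complex" where
  "coord_mult i \<psi> x = \<psi> x * ((- 2 * of_real pi * \<i>) * of_real (x $ i))"

lemma smooth_coord_factor: "smooth (\<lambda>x::real^'d::finite. (- 2 * of_real pi * \<i>) * of_real (x $ i))"
  by (intro smooth_cmult smooth_coord)

lemma test_coord_mult: "\<psi> \<in> test_functions \<Longrightarrow> coord_mult i \<psi> \<in> test_functions"
  unfolding coord_mult_def[abs_def] by (intro test_mult smooth_coord_factor)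

text \<open>The first-order Taylor error of the kernel is at most quadratic in \<open>h\<close> on
  the bounded support of \<open>\<psi>\<close>, so it can simply be integrated; no limit has to be
  exchanged with the integral.\<close>

lemma fourier_has_derivative:
  fixes \<psi> :: "real^'d::finite \<Rightarrow> complex"
  assumes \<psi>: "\<psi> \<in> test_functions"
  shows "(fourier \<psi> has_derivative (\<lambda>h. \<Sum>i\<in>UNIV. of_real (h $ i) * fourier (coord_mult i \<psi>) y)) (at y)"
proof -
  let ?L = "\<lambda>h. \<Sum>i\<in>UNIV. of_real (h $ i) * fourier (coord_mult i \<psi>) y"
  obtain R where R: "0 < R" "\<And>x. R < norm x \<Longrightarrow> \<psi> x = 0" using test_bound[OF \<psi>] by blast
  obtain M where M: "0 < M" "\<And>is x. length is \<le> 0 \<Longrightarrow> cmod (pderivs is \<psi> x) \<le> M"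
    using test_bounded[OF \<psi>, of 0] by blast
  have M0: "cmod (\<psi> x) \<le> M" for x using M(2)[of "[]"] by simp
  let ?V = "measure lborel (cball (0::real^'d) R)"
  define K where "K = M * (2 * pi * R) ^ 2 * ?V"
  have ci: "integrable lborel (\<lambda>x. \<psi> x * g x)" if "continuous_on UNIV g" for g
    using test_integrable_mult[OF \<psi> that] .
  have cc: "continuous_on UNIV (\<lambda>x. (- 2 * of_real pi * \<i>) * complex_of_real (x \<bullet> h))" for h :: "real^'d"
    by (intro continuous_intros)
  have L: "?L h = (\<integral>x. \<psi> x * ((- 2 * of_real pi * \<i>) * of_real (x \<bullet> h) * character (- y) x) \<partial>lborel)" for h
  proof -
    have "?L h = (\<Sum>i\<in>UNIV. \<integral>x. of_real (h $ i) * (coord_mult i \<psi> x * character (- y) x) \<partial>lborel)"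
      unfolding fourier_character by simp
    also have "\<dots> = (\<integral>x. (\<Sum>i\<in>UNIV. of_real (h $ i) * (coord_mult i \<psi> x * character (- y) x)) \<partial>lborel)"
      by (rule Bochner_Integration.integral_sum[symmetric])
        (intro integrable_mult_right test_integrable_mult test_coord_mult \<psi> continuous_character)
    also have "\<dots> = (\<integral>x. \<psi> x * ((- 2 * of_real pi * \<i>) * of_real (x \<bullet> h) * character (- y) x) \<partial>lborel)"
      by (intro Bochner_Integration.integral_cong refl)
        (simp add: coord_mult_def inner_vec_def sum_distrib_left sum_distrib_right sum_negf mult_ac)
    finally show ?thesis .
  qed
  have err: "cmod (fourier \<psi> (y + h) - fourier \<psi> y - ?L h) \<le> K * norm h ^ 2" for h
  proof -
    let ?e = "\<lambda>x. character (- (y + h)) x - character (- y) x - (- 2 * of_real pi * \<i>) * of_real (x \<bullet> h) * character (- y) x"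
    have "fourier \<psi> (y + h) - fourier \<psi> y - ?L h = (\<integral>x. \<psi> x * ?e x \<partial>lborel)"
    proof -
      have i: "integrable lborel (\<lambda>x. \<psi> x * character (- (y + h)) x)"
        "integrable lborel (\<lambda>x. \<psi> x * character (- y) x)"
        "integrable lborel (\<lambda>x. \<psi> x * ((- 2 * of_real pi * \<i>) * of_real (x \<bullet> h) * character (- y) x))"
        by (rule ci, rule continuous_character)+
          (rule ci, rule continuous_on_mult[OF cc continuous_character])
      have "(\<integral>x. \<psi> x * ?e x \<partial>lborel) = (\<integral>x. \<psi> x * character (- (y + h)) x - \<psi> x * character (- y) x
          - \<psi> x * ((- 2 * of_real pi * \<i>) * of_real (x \<bullet> h) * character (- y) x) \<partial>lborel)"
        by (simp only: right_diff_distrib)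
      then show ?thesis
        unfolding L unfolding fourier_character
        by (simp only: Bochner_Integration.integral_diff[OF Bochner_Integration.integrable_diff[OF i(1,2)] i(3)]
            Bochner_Integration.integral_diff[OF i(1,2)])
    qed
    also have "cmod \<dots> \<le> M * (2 * pi * R * norm h) ^ 2 * ?V"
    proof (rule integral_compact_support_bound)
      show "continuous_on UNIV (\<lambda>x. \<psi> x * ?e x)"
        by (intro continuous_on_mult continuous_on_diff cc continuous_character smooth_continuous_on test_smooth \<psi>)
      show "\<psi> x * ?e x = 0" if "R < norm x" for x using R(2)[OF that] by simp
      show "cmod (\<psi> x * ?e x) \<le> M * (2 * pi * R * norm h) ^ 2" for x
      proof (cases "R < norm x")
        case True
        then show ?thesis using R(2)[OF True] M(1) by simp
      next
        case False
        let ?t = "- (2 * pi * (x \<bullet> h))"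
        have "character (- (y + h)) x = character (- y) x * exp (\<i> * of_real ?t)"
          by (simp add: character_def exp_add[symmetric] inner_commute algebra_simps)
        then have "?e x = character (- y) x * (exp (\<i> * of_real ?t) - 1 - \<i> * of_real ?t)"
          by (simp add: algebra_simps)
        then have "cmod (?e x) = cmod (exp (\<i> * of_real ?t) - 1 - \<i> * of_real ?t)"
          by (simp only: norm_mult norm_character mult_1_left)
        also have "\<dots> \<le> ?t ^ 2" by (rule norm_exp_i_taylor1)
        also have "\<dots> = (2 * pi * \<bar>x \<bullet> h\<bar>) ^ 2" by (simp add: power_mult_distrib)
        also have "\<dots> \<le> (2 * pi * (R * norm h)) ^ 2"
          using False Cauchy_Schwarz_ineq2[of x h] mult_right_mono[of "norm x" R "norm h"]
          by (intro power_mono mult_left_mono) (auto intro: order_trans)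
        finally have "cmod (?e x) \<le> (2 * pi * R * norm h) ^ 2" by (simp add: mult_ac)
        then show ?thesis unfolding norm_mult using M(1) by (intro mult_mono M0) auto
      qed
    qed
    also have "\<dots> = K * norm h ^ 2" unfolding K_def by (simp add: power_mult_distrib mult_ac)
    finally show ?thesis .
  qed
  show ?thesis
  proof (rule has_derivativeI_sandwich[where e = 1 and H = "\<lambda>z. K * norm (z - y)"])
    show "bounded_linear ?L"
      by (intro bounded_linear_sum bounded_linear_mult_left[THEN bounded_linear_compose]
          bounded_linear_of_real[THEN bounded_linear_compose] bounded_linear_vec_nth)
    have "((\<lambda>z. K * norm (z - y)) \<longlongrightarrow> K * norm (y - y)) (at y)" by (intro tendsto_intros)
    then show "((\<lambda>z. K * norm (z - y)) \<longlongrightarrow> 0) (at y)" by simp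
    fix z assume z: "z \<noteq> y"
    have "norm (fourier \<psi> z - fourier \<psi> y - ?L (z - y)) \<le> K * norm (z - y) ^ 2"
      using err[of "z - y"] by simp
    then show "norm (fourier \<psi> z - fourier \<psi> y - ?L (z - y)) / norm (z - y) \<le> K * norm (z - y)"
      using z by (simp add: pos_divide_le_eq power2_eq_square mult_ac)
  qed simp
qed

lemma partial_deriv_fourier:
  assumes "\<psi> \<in> test_functions"
  shows "partial_deriv i (fourier \<psi>) = fourier (coord_mult i \<psi>)"
proof
  fix y
  have "partial_deriv i (fourier \<psi>) y = (\<Sum>j\<in>UNIV. of_real (axis i 1 $ j) * fourier (coord_mult j \<psi>) y)"
    by (rule partial_deriv_eq[OF fourier_has_derivative[OF assms]])
  also have "\<dots> = (\<Sum>j\<in>UNIV. if j = i then fourier (coord_mult i \<psi>) y else 0)"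
    by (intro sum.cong) (auto simp: axis_def)
  finally show "partial_deriv i (fourier \<psi>) y = fourier (coord_mult i \<psi>) y" by simp
qed

lemma smooth_fourier:
  assumes "\<psi> \<in> test_functions" shows "smooth (fourier \<psi>)"
proof (rule smooth_coinduct[where P = "\<lambda>\<xi>. \<exists>\<psi>\<in>test_functions. \<xi> = fourier \<psi>"])
  show "\<exists>\<psi>'\<in>test_functions. fourier \<psi> = fourier \<psi>'" using assms by blast
  show "\<xi> differentiable (at x)" if "\<exists>\<psi>\<in>test_functions. \<xi> = fourier \<psi>" for \<xi> :: "real^'a \<Rightarrow> complex" and x
    using that fourier_has_derivative unfolding differentiable_def by blast
  show "\<exists>\<psi>\<in>test_functions. partial_deriv i \<xi> = fourier \<psi>" if "\<exists>\<psi>\<in>test_functions. \<xi> = fourier \<psi>"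
    for \<xi> :: "real^'a \<Rightarrow> complex" and i
    using that partial_deriv_fourier test_coord_mult by metis
qed

text \<open>The multiplier is chosen before \<open>\<psi>\<close> and depends on the word alone,
  which later makes decay constants uniform over test functions with a common support
  radius.\<close>

lemma pderivs_fourier:
  obtains \<mu> where "smooth \<mu>" "\<And>\<psi>. \<psi> \<in> test_functions \<Longrightarrow> pderivs is (fourier \<psi>) = fourier (\<lambda>x. \<psi> x * \<mu> x)"
proof -
  have "\<exists>\<mu>. smooth \<mu> \<and> (\<forall>\<psi>\<in>test_functions. pderivs is (fourier \<psi>) = fourier (\<lambda>x. \<psi> x * \<mu> x))"
  proof (induction "is")
    case Nil
    show ?case by (intro exI[of _ "\<lambda>x. 1"]) (auto simp: smooth_const)
  next
    case (Cons i "is")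
    then obtain \<mu> where \<mu>: "smooth \<mu>" "\<And>\<psi>. \<psi> \<in> test_functions \<Longrightarrow> pderivs is (fourier \<psi>) = fourier (\<lambda>x. \<psi> x * \<mu> x)"
      by blast
    show ?case
    proof (intro exI[of _ "\<lambda>x. \<mu> x * ((- 2 * of_real pi * \<i>) * of_real (x $ i))"] conjI ballI)
      show "smooth (\<lambda>x. \<mu> x * ((- 2 * of_real pi * \<i>) * of_real (x $ i)))"
        by (intro smooth_mult \<mu> smooth_coord_factor)
      fix \<psi> :: "real^'a \<Rightarrow> complex" assume \<psi>: "\<psi> \<in> test_functions"
      have "pderivs (i # is) (fourier \<psi>) = fourier (coord_mult i (\<lambda>x. \<psi> x * \<mu> x))"
        unfolding pderivs_Cons \<mu>(2)[OF \<psi>] by (intro partial_deriv_fourier test_mult \<psi> \<mu>)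
      also have "coord_mult i (\<lambda>x. \<psi> x * \<mu> x) = (\<lambda>x. \<psi> x * (\<mu> x * ((- 2 * of_real pi * \<i>) * of_real (x $ i))))"
        by (simp add: coord_mult_def fun_eq_iff mult.assoc)
      finally show "pderivs (i # is) (fourier \<psi>) = fourier (\<lambda>x. \<psi> x * (\<mu> x * ((- 2 * of_real pi * \<i>) * of_real (x $ i))))" .
    qed
  qed
  then show thesis using that by blast
qed

text \<open>Translation invariance of the integral replaces integration by parts.\<close>

lemma integral_partial_deriv_0:
  fixes \<phi> :: "real^'d::finite \<Rightarrow> complex"
  assumes \<phi>: "\<phi> \<in> test_functions"
  shows "(\<integral>x. partial_deriv i \<phi> x \<partial>lborel) = 0"
proof -
  obtain R where R: "0 < R" "\<And>x. R < norm x \<Longrightarrow> \<phi> x = 0" using test_bound[OF \<phi>] by blast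
  obtain M where M: "0 < M" "\<And>is x. length is \<le> 2 \<Longrightarrow> cmod (pderivs is \<phi> x) \<le> M"
    using test_bounded[OF \<phi>, of 2] by blast
  have M2: "cmod (partial_deriv i (partial_deriv i \<phi>) x) \<le> M" for x
    using M(2)[of "[i, i]" x] by (simp add: pderivs_Cons)
  have s: "smooth \<phi>" "smooth (partial_deriv i \<phi>)" using \<phi> by (auto intro: test_smooth smooth_partial_deriv)
  have p0: "R < norm x \<Longrightarrow> partial_deriv i \<phi> x = 0" for x
    using pderivs_eq_0_norm[of R \<phi> x "[i]"] R(2) by (auto simp: pderivs_Cons)
  let ?a = "axis i 1 :: real^'d" and ?V = "measure lborel (cball (0::real^'d) (R + 1))"
  let ?I = "\<integral>x. partial_deriv i \<phi> x \<partial>lborel"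
  \<comment> \<open>The integral of the first-order Taylor error of the shift by \<open>u\<close>
    equals minus \<open>u\<close> times the integral in question. That error is O(u^2), so dividing
    by \<open>u\<close> gives the claim in the limit.\<close>
  have bound: "u * cmod ?I \<le> (M * u) * u * ?V" if u: "0 < u" "u \<le> 1" for u
  proof -
    have t: "(\<lambda>x. \<phi> (u *\<^sub>R ?a + 1 *\<^sub>R x)) \<in> test_functions" by (intro test_affine \<phi>) simp
    have "\<phi> \<in> borel_measurable borel"
      by (rule borel_measurable_continuous_onI[OF smooth_continuous_on[OF s(1)]])
    from integral_lborel_affine[OF this, of 1 "u *\<^sub>R ?a"]
    have "(\<integral>x. \<phi> x \<partial>lborel) = (\<integral>x. \<phi> (u *\<^sub>R ?a + 1 *\<^sub>R x) \<partial>lborel)" by simp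
    moreover have i: "integrable lborel \<phi>" "integrable lborel (\<lambda>x. \<phi> (u *\<^sub>R ?a + 1 *\<^sub>R x))"
      "integrable lborel (partial_deriv i \<phi>)"
      using test_integrable_mult[OF \<phi>, of "\<lambda>x. 1"] test_integrable_mult[OF t, of "\<lambda>x. 1"]
        test_integrable_mult[OF test_pderivs[OF \<phi>, of "[i]"], of "\<lambda>x. 1"] by (simp_all add: pderivs_Cons)
    ultimately have "- (of_real u * ?I) = (\<integral>x. \<phi> (u *\<^sub>R ?a + 1 *\<^sub>R x) - \<phi> x - of_real u * partial_deriv i \<phi> x \<partial>lborel)"
      by simp
    also have "cmod \<dots> \<le> (M * u) * u * ?V"
    proof (rule integral_compact_support_bound)
      show "continuous_on UNIV (\<lambda>x. \<phi> (u *\<^sub>R ?a + 1 *\<^sub>R x) - \<phi> x - of_real u * partial_deriv i \<phi> x)"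
        by (intro continuous_on_diff continuous_on_mult continuous_on_const smooth_continuous_on s test_smooth[OF t])
      show "\<phi> (u *\<^sub>R ?a + 1 *\<^sub>R x) - \<phi> x - of_real u * partial_deriv i \<phi> x = 0" if "R + 1 < norm x" for x
      proof -
        have "norm x \<le> norm (u *\<^sub>R ?a + x) + norm (u *\<^sub>R ?a)"
          using norm_triangle_ineq4[of "u *\<^sub>R ?a + x" "u *\<^sub>R ?a"] by simp
        then have "R < norm (u *\<^sub>R ?a + x)" using that u by simp
        then show ?thesis using R(2) p0 that by simp
      qed
      fix x
      let ?g = "\<lambda>s. \<phi> (x + s *\<^sub>R ?a) - s *\<^sub>R partial_deriv i \<phi> x"
      have "norm (?g u - ?g 0) \<le> (M * u) * u"
      proof (rule has_vector_derivative_bound[where g' = "\<lambda>s. partial_deriv i \<phi> (x + s *\<^sub>R ?a) - partial_deriv i \<phi> x"])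
        fix v assume v: "0 \<le> v" "v \<le> u"
        show "(?g has_vector_derivative partial_deriv i \<phi> (x + v *\<^sub>R ?a) - partial_deriv i \<phi> x) (at v)"
          by (intro has_vector_derivative_diff partial_deriv_line s) (auto intro!: derivative_eq_intros)
        have "norm (partial_deriv i \<phi> (x + v *\<^sub>R ?a) - partial_deriv i \<phi> (x + 0 *\<^sub>R ?a)) \<le> M * v"
          by (rule has_vector_derivative_bound[OF v(1) partial_deriv_line[OF s(2)] M2])
        also have "\<dots> \<le> M * u" using v M(1) by simp
        finally show "norm (partial_deriv i \<phi> (x + v *\<^sub>R ?a) - partial_deriv i \<phi> x) \<le> M * u" by simp
      qed (use u in simp)
      then show "cmod (\<phi> (u *\<^sub>R ?a + 1 *\<^sub>R x) - \<phi> x - of_real u * partial_deriv i \<phi> x) \<le> (M * u) * u"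
        by (simp add: algebra_simps scaleR_conv_of_real[where 'a = complex])
    qed
    finally show ?thesis using u by (simp add: norm_mult)
  qed
  have "cmod ?I \<le> 0"
  proof (rule field_le_epsilon)
    fix e :: real assume e: "0 < e"
    define u where "u = min 1 (e / (M * ?V + 1))"
    have MV: "0 < M * ?V + 1" using M(1) by (intro add_nonneg_pos mult_nonneg_nonneg) auto
    then have u: "0 < u" "u \<le> 1" "u \<le> e / (M * ?V + 1)" using e by (auto simp: u_def)
    have "u * cmod ?I \<le> u * (M * u * ?V)" using bound[OF u(1,2)] by (simp add: mult_ac)
    then have "cmod ?I \<le> M * u * ?V" using u(1) by simp
    also have "\<dots> \<le> u * (M * ?V + 1)" using u by (simp add: algebra_simps)
    also have "\<dots> \<le> e" using u(3) MV by (simp add: pos_le_divide_eq)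
    finally show "cmod ?I \<le> 0 + e" by simp
  qed
  then show ?thesis by simp
qed

lemma fourier_partial_deriv:
  fixes \<psi> :: "real^'d::finite \<Rightarrow> complex"
  assumes \<psi>: "\<psi> \<in> test_functions"
  shows "fourier (partial_deriv i \<psi>) y = 2 * of_real pi * \<i> * of_real (y $ i) * fourier \<psi> y"
proof -
  let ?c = "character (- y)"
  have "partial_deriv i (\<lambda>x. \<psi> x * ?c x) = (\<lambda>x. partial_deriv i \<psi> x * ?c x + \<psi> x * partial_deriv i ?c x)"
    by (rule partial_deriv_mult[OF test_smooth[OF \<psi>] smooth_character])
  also have "partial_deriv i ?c = (\<lambda>x. - (2 * of_real pi * \<i> * of_real (y $ i)) * ?c x)"
    using partial_deriv_character[of i 1 "- y"] by simp
  finally have eq: "partial_deriv i (\<lambda>x. \<psi> x * ?c x)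
      = (\<lambda>x. partial_deriv i \<psi> x * ?c x - (2 * of_real pi * \<i> * of_real (y $ i)) * (\<psi> x * ?c x))"
    by (simp add: algebra_simps)
  have "0 = (\<integral>x. partial_deriv i (\<lambda>x. \<psi> x * ?c x) x \<partial>lborel)"
    by (rule integral_partial_deriv_0[symmetric]) (intro test_mult \<psi> smooth_character)
  also have "\<dots> = fourier (partial_deriv i \<psi>) y - (2 * of_real pi * \<i> * of_real (y $ i)) * fourier \<psi> y"
  proof -
    have "integrable lborel (\<lambda>x. partial_deriv i \<psi> x * ?c x)"
      using test_integrable_mult[OF test_pderivs[OF \<psi>, of "[i]"] continuous_character, of "- y"]
      by (simp add: pderivs_Cons)
    moreover have "integrable lborel (\<lambda>x. \<psi> x * ?c x)"
      by (rule test_integrable_mult[OF \<psi> continuous_character])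
    ultimately show ?thesis unfolding eq fourier_character by simp
  qed
  finally show ?thesis by simp
qed

text \<open>Each power of 1 + |y| is spread over 1 and the coordinates, and a coordinate factor is
  traded for a derivative of \<open>\<psi>\<close>, as 2 pi is at least 1. There are d + 1 summands,
  whence the constant.\<close>

lemma fourier_decay:
  fixes \<psi> :: "real^'d::finite \<Rightarrow> complex"
  assumes "\<psi> \<in> test_functions" "\<And>x. R < norm x \<Longrightarrow> \<psi> x = 0"
    and "\<And>is x. length is \<le> N \<Longrightarrow> cmod (pderivs is \<psi> x) \<le> M"
  shows "(1 + norm y) ^ N * cmod (fourier \<psi> y)
    \<le> (1 + real CARD('d)) ^ N * (M * measure lborel (cball (0::real^'d) R))"
  using assms
proof (induction N arbitrary: \<psi>)
  case 0
  have "cmod (fourier \<psi> y) \<le> M * measure lborel (cball (0::real^'d) R)"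
    unfolding fourier_character
  proof (rule integral_compact_support_bound)
    show "continuous_on UNIV (\<lambda>x. \<psi> x * character (- y) x)"
      by (intro continuous_on_mult smooth_continuous_on test_smooth 0 smooth_character)
    show "\<psi> x * character (- y) x = 0" if "R < norm x" for x using 0(2)[OF that] by simp
    show "cmod (\<psi> x * character (- y) x) \<le> M" for x using 0(3)[of "[]" x] by (simp add: norm_mult)
  qed
  then show ?case by simp
next
  case (Suc N)
  let ?B = "(1 + real CARD('d)) ^ N * (M * measure lborel (cball (0::real^'d) R))"
  have 1: "(1 + norm y) ^ N * cmod (fourier \<psi> y) \<le> ?B"
    by (rule Suc.IH) (use Suc.prems in auto)
  have 2: "(1 + norm y) ^ N * (\<bar>y $ i\<bar> * cmod (fourier \<psi> y)) \<le> ?B" for i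
  proof -
    have "(1 + norm y) ^ N * cmod (fourier (partial_deriv i \<psi>) y) \<le> ?B"
    proof (rule Suc.IH)
      show "partial_deriv i \<psi> \<in> test_functions"
        using test_pderivs[OF Suc.prems(1), of "[i]"] by (simp add: pderivs_Cons)
      show "partial_deriv i \<psi> x = 0" if "R < norm x" for x
        using pderivs_eq_0_norm[of R \<psi> x "[i]"] Suc.prems(2) that by (auto simp: pderivs_Cons)
      show "cmod (pderivs is (partial_deriv i \<psi>) x) \<le> M" if "length is \<le> N" for "is" x
        using Suc.prems(3)[of "is @ [i]" x] that by (simp add: pderivs_append pderivs_Cons)
    qed
    moreover have "\<bar>y $ i\<bar> * cmod (fourier \<psi> y) \<le> cmod (fourier (partial_deriv i \<psi>) y)"
    proof -
      have "1 * (\<bar>y $ i\<bar> * cmod (fourier \<psi> y)) \<le> (2 * pi) * (\<bar>y $ i\<bar> * cmod (fourier \<psi> y))"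
        using pi_ge_two by (intro mult_right_mono) auto
      then show ?thesis by (simp add: fourier_partial_deriv[OF Suc.prems(1)] norm_mult mult_ac)
    qed
    ultimately show ?thesis
      by (meson mult_left_mono norm_ge_zero order_trans zero_le_power add_nonneg_nonneg zero_le_one)
  qed
  have "(1 + norm y) ^ Suc N * cmod (fourier \<psi> y)
      \<le> (1 + norm y) ^ N * ((1 + (\<Sum>i\<in>UNIV. \<bar>y $ i\<bar>)) * cmod (fourier \<psi> y))"
    using mult_left_mono[OF mult_right_mono[of "1 + norm y" "1 + (\<Sum>i\<in>UNIV. \<bar>y $ i\<bar>)" "cmod (fourier \<psi> y)"], of "(1 + norm y) ^ N"]
      norm_le_l1_cart[of y] by (simp add: mult_ac)
  also have "\<dots> = (1 + norm y) ^ N * cmod (fourier \<psi> y)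
      + (\<Sum>i\<in>UNIV. (1 + norm y) ^ N * (\<bar>y $ i\<bar> * cmod (fourier \<psi> y)))"
    by (simp add: algebra_simps sum_distrib_left sum_distrib_right)
  also have "\<dots> \<le> ?B + (\<Sum>i\<in>(UNIV::'d set). ?B)" by (intro add_mono sum_mono 1 2)
  also have "\<dots> = (1 + real CARD('d)) ^ Suc N * (M * measure lborel (cball (0::real^'d) R))"
    by (simp add: algebra_simps)
  finally show ?case .
qed

text \<open>The constant depends on \<open>R\<close>, \<open>N\<close> and \<open>m\<close> only, so
  the estimate applies uniformly to all blow-ups of a function.\<close>

lemma fourier_pderivs_decay:
  fixes R :: real
  obtains C where "0 < C" "\<And>\<psi> M is (y::real^'d::finite). \<psi> \<in> test_functions \<Longrightarrow> (\<And>x. R < norm x \<Longrightarrow> \<psi> x = 0) \<Longrightarrow>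
    0 < M \<Longrightarrow> (\<And>js x. length js \<le> N \<Longrightarrow> cmod (pderivs js \<psi> x) \<le> M) \<Longrightarrow> length is \<le> m \<Longrightarrow>
    (1 + norm y) ^ N * cmod (pderivs is (fourier \<psi>) y) \<le> C * M"
proof -
  have "\<exists>\<mu>. smooth \<mu> \<and> (\<forall>\<psi>\<in>test_functions. pderivs is (fourier \<psi>) = fourier (\<lambda>x. \<psi> x * \<mu> x))" for "is" :: "'d list"
  proof (rule pderivs_fourier[of "is"], goal_cases)
    case (1 \<mu>)
    then show ?case by (intro exI[of _ \<mu>]) simp
  qed
  then obtain \<mu> :: "'d list \<Rightarrow> real^'d \<Rightarrow> complex" where \<mu>: "\<And>is. smooth (\<mu> is)"
    "\<And>is \<psi>. \<psi> \<in> test_functions \<Longrightarrow> pderivs is (fourier \<psi>) = fourier (\<lambda>x. \<psi> x * \<mu> is x)" by metis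
  have "\<exists>B>0. \<forall>js x. length js \<le> N \<longrightarrow> x \<in> cball 0 R \<longrightarrow> cmod (pderivs js (\<mu> is) x) \<le> B" for "is"
  proof (rule smooth_bounded_on_compact[OF \<mu>(1)[of "is"] compact_cball[of 0 R], where m = N], goal_cases)
    case (1 M)
    then show ?case by (intro exI[of _ M]) simp
  qed
  then obtain B where B: "\<And>is. 0 < B is"
    "\<And>is js x. length js \<le> N \<Longrightarrow> x \<in> cball 0 R \<Longrightarrow> cmod (pderivs js (\<mu> is) x) \<le> B is" by metis
  let ?V = "measure lborel (cball (0::real^'d) R)"
  define D where "D = (\<lambda>is. (1 + real CARD('d)) ^ N * (2 ^ N * B is * ?V))"
  have D: "0 \<le> D is" for "is" unfolding D_def using B(1)[of "is"] by auto
  show thesis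
  proof (rule that[of "1 + (\<Sum>is\<in>{is. length is \<le> m}. D is)"])
    show "0 < 1 + (\<Sum>is\<in>{is. length is \<le> m}. D is)" by (intro add_pos_nonneg sum_nonneg D) simp
    fix \<psi> :: "real^'d \<Rightarrow> complex" and M :: real and "is" :: "'d list" and y :: "real^'d"
    assume \<psi>: "\<psi> \<in> test_functions" "\<And>x. R < norm x \<Longrightarrow> \<psi> x = 0" and M: "0 < M"
      "\<And>js x. length js \<le> N \<Longrightarrow> cmod (pderivs js \<psi> x) \<le> M" and l: "length is \<le> m"
    have "(1 + norm y) ^ N * cmod (fourier (\<lambda>x. \<psi> x * \<mu> is x) y) \<le> (1 + real CARD('d)) ^ N * (2 ^ N * (M * B is) * ?V)"
    proof (rule fourier_decay)
      show "(\<lambda>x. \<psi> x * \<mu> is x) \<in> test_functions" by (intro test_mult \<psi> \<mu>)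
      show "\<psi> x * \<mu> is x = 0" if "R < norm x" for x using \<psi>(2)[OF that] by simp
      fix js :: "'d list" and x assume js: "length js \<le> N"
      show "cmod (pderivs js (\<lambda>x. \<psi> x * \<mu> is x) x) \<le> 2 ^ N * (M * B is)"
      proof (cases "R < norm x")
        case True
        have "pderivs js (\<lambda>x. \<psi> x * \<mu> is x) x = 0"
          by (rule pderivs_eq_0_norm[OF _ True]) (simp add: \<psi>(2))
        then show ?thesis using M(1) B(1)[of "is"] by simp
      next
        case False
        have "cmod (pderivs js (\<lambda>x. \<psi> x * \<mu> is x) x) \<le> 2 ^ length js * (M * B is)"
          by (rule norm_pderivs_mult_le) (use \<psi>(1) \<mu>(1) M(2) B(2) js False in \<open>auto simp: test_smooth\<close>)
        also have "\<dots> \<le> 2 ^ N * (M * B is)"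
          using js M(1) B(1)[of "is"] by (intro mult_right_mono power_increasing) auto
        finally show ?thesis .
      qed
    qed
    also have "\<dots> = D is * M" unfolding D_def by (simp add: mult_ac)
    also have "\<dots> \<le> (1 + (\<Sum>is\<in>{is. length is \<le> m}. D is)) * M"
      using M(1) l member_le_sum[of "is" "{is. length is \<le> m}" D] D finite_lists_le[where 'd = 'd and m = m]
      by (intro mult_right_mono) (auto intro: add_increasing)
    finally show "(1 + norm y) ^ N * cmod (pderivs is (fourier \<psi>) y) \<le> (1 + (\<Sum>is\<in>{is. length is \<le> m}. D is)) * M"
      unfolding \<mu>(2)[OF \<psi>(1)] .
  qed
qed

lemma rapid_fourier:
  fixes \<psi> :: "real^'d::finite \<Rightarrow> complex"
  assumes \<psi>: "\<psi> \<in> test_functions" shows "rapid (fourier \<psi>)"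
  unfolding rapid_def
proof (intro conjI allI)
  show "smooth (fourier \<psi>)" by (rule smooth_fourier[OF \<psi>])
  fix n and "is" :: "'d list"
  obtain R where R: "0 < R" "\<And>x. R < norm x \<Longrightarrow> \<psi> x = 0" using test_bound[OF \<psi>] by blast
  obtain M where M: "0 < M" "\<And>is x. length is \<le> n \<Longrightarrow> cmod (pderivs is \<psi> x) \<le> M"
    using test_bounded[OF \<psi>, of n] by blast
  obtain C where C: "\<And>\<psi> M js' (y::real^'d::finite). \<psi> \<in> test_functions \<Longrightarrow> (\<And>x. R < norm x \<Longrightarrow> \<psi> x = 0) \<Longrightarrow>
    0 < M \<Longrightarrow> (\<And>js x. length js \<le> n \<Longrightarrow> cmod (pderivs js \<psi> x) \<le> M) \<Longrightarrow> length js' \<le> length is \<Longrightarrow>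
    (1 + norm y) ^ n * cmod (pderivs js' (fourier \<psi>) y) \<le> C * M"
  proof (rule fourier_pderivs_decay[where R = R and N = n and m = "length is" and 'd = 'd], goal_cases)
    case (1 C)
    show ?case by (rule 1(1)) (rule 1(3))
  qed
  show "\<exists>M. \<forall>x. (1 + norm x) ^ n * cmod (pderivs is (fourier \<psi>) x) \<le> M"
    using C[OF \<psi> R(2) M(1) M(2) order_refl] by blast
qed

lemma dist_fourier_lin_on_test:
  "tempered_distribution f \<Longrightarrow> lin_on_test (dist_fourier f)"
  unfolding lin_on_test_def dist_fourier_def by (simp add: fourier_lin tempered_lin rapid_fourier)

subsection \<open>The order of the Fourier transform at its support\<close>

text \<open>The parameter \<epsilon> is a resolution: a function spread over a region of size
  1/\<epsilon> meets about \<epsilon>^(-d) points of a separated support. The constant is the same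
  for all centres \<open>t\<close>.\<close>

definition translation_bounded :: "((real^'d::finite \<Rightarrow> complex) \<Rightarrow> complex) \<Rightarrow> nat \<Rightarrow> real \<Rightarrow> bool" where
  "translation_bounded f m C \<longleftrightarrow> 0 < C \<and> (\<forall>\<xi> M \<epsilon> t. rapid \<xi> \<longrightarrow> 0 < \<epsilon> \<longrightarrow> \<epsilon> \<le> 1 \<longrightarrow> 0 \<le> M \<longrightarrow>
     (\<forall>is x. length is \<le> m \<longrightarrow> cmod (pderivs is \<xi> x) \<le> M / (1 + \<epsilon> * norm (x - t)) ^ (CARD('d) + 2)) \<longrightarrow>
     cmod (f \<xi>) \<le> C * M / \<epsilon> ^ CARD('d))"

lemma translation_boundedD:
  fixes f :: "(real^'d::finite \<Rightarrow> complex) \<Rightarrow> complex"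
  assumes "translation_bounded f m C" "rapid \<xi>" "0 < \<epsilon>" "\<epsilon> \<le> 1" "0 \<le> M"
    "\<And>is x. length is \<le> m \<Longrightarrow> cmod (pderivs is \<xi> x) \<le> M / (1 + \<epsilon> * norm (x - t)) ^ (CARD('d) + 2)"
  shows "cmod (f \<xi>) \<le> C * M / \<epsilon> ^ CARD('d)"
  using assms unfolding translation_bounded_def by blast

text \<open>Bounded coefficients reduce the pairing to a sum of the weight over the support, which
  \<open>separated_sum_bound\<close> controls.\<close>

lemma translation_boundedI:
  fixes f :: "(real^'d::finite \<Rightarrow> complex) \<Rightarrow> complex"
  assumes f: "tempered_distribution f" and e: "dirac_expansion f m p" and d: "discrete_set (dist_supp f)"
    and B: "\<And>a k. a \<in> dist_supp f \<Longrightarrow> mi_abs k \<le> m \<Longrightarrow> cmod (p a k) \<le> B"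
    and s: "0 < s" "\<And>a b. a \<in> dist_supp f \<Longrightarrow> b \<in> dist_supp f \<Longrightarrow> a \<noteq> b \<Longrightarrow> s \<le> dist a b"
  shows "\<exists>C. translation_bounded f m C"
proof -
  obtain C1 where C1: "0 < C1" "\<And>\<xi> w W. rapid \<xi> \<Longrightarrow> (\<And>is x. length is \<le> m \<Longrightarrow> cmod (pderivs is \<xi> x) \<le> w x) \<Longrightarrow>
    (\<And>F. finite F \<Longrightarrow> F \<subseteq> dist_supp f \<Longrightarrow> sum w F \<le> W) \<Longrightarrow> cmod (f \<xi>) \<le> C1 * W"
  proof (rule dirac_expansion_bound[OF f e d B], goal_cases)
    case (3 C)
    show ?case by (rule 3(1)[OF 3(2,3)])
  qed
  obtain C2 where C2: "0 < C2" "\<And>\<epsilon> t F. 0 < \<epsilon> \<Longrightarrow> \<epsilon> \<le> 1 \<Longrightarrow> finite F \<Longrightarrow> F \<subseteq> dist_supp f \<Longrightarrow>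
    (\<Sum>a\<in>F. 1 / (1 + \<epsilon> * norm (a - t)) ^ (CARD('d) + 2)) \<le> C2 / \<epsilon> ^ CARD('d)"
  proof (rule separated_sum_bound[OF s(1), of "dist_supp f"], goal_cases)
    case (1 a b)
    show ?case by (rule s(2)[OF 1(2-4)])
  next
    case (2 C)
    show ?case by (rule 2(1)[OF 2(2,3)])
  qed
  have "translation_bounded f m (C1 * C2)"
    unfolding translation_bounded_def
  proof (intro conjI allI impI)
    show "0 < C1 * C2" using C1(1) C2(1) by simp
    fix \<xi> :: "real^'d \<Rightarrow> complex" and M \<epsilon> :: real and t
    assume \<xi>: "rapid \<xi>" and \<epsilon>: "0 < \<epsilon>" "\<epsilon> \<le> 1" and M: "0 \<le> M"
      and b: "\<forall>is x. length is \<le> m \<longrightarrow> cmod (pderivs is \<xi> x) \<le> M / (1 + \<epsilon> * norm (x - t)) ^ (CARD('d) + 2)"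
    have "cmod (f \<xi>) \<le> C1 * (M * (C2 / \<epsilon> ^ CARD('d)))"
    proof (rule C1(2)[OF \<xi>])
      show "cmod (pderivs is \<xi> x) \<le> M / (1 + \<epsilon> * norm (x - t)) ^ (CARD('d) + 2)" if "length is \<le> m" for "is" x
        using b that by blast
      fix F assume F: "finite F" "F \<subseteq> dist_supp f"
      have "(\<Sum>x\<in>F. M / (1 + \<epsilon> * norm (x - t)) ^ (CARD('d) + 2))
          = M * (\<Sum>x\<in>F. 1 / (1 + \<epsilon> * norm (x - t)) ^ (CARD('d) + 2))"
        by (subst sum_distrib_left) (rule sum.cong[OF refl], simp only: times_divide_eq_right mult_1_right)
      also have "\<dots> \<le> M * (C2 / \<epsilon> ^ CARD('d))" by (intro mult_left_mono C2(2) \<epsilon> F M)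
      finally show "(\<Sum>x\<in>F. M / (1 + \<epsilon> * norm (x - t)) ^ (CARD('d) + 2)) \<le> M * (C2 / \<epsilon> ^ CARD('d))" .
    qed
    then show "cmod (f \<xi>) \<le> C1 * C2 * M / \<epsilon> ^ CARD('d)" by (simp add: mult_ac)
  qed
  then show ?thesis by blast
qed

lemma character_pderivs_bound:
  obtains A where "0 < A" "\<And>is (y::real^'d::finite). length is \<le> m \<Longrightarrow> cmod (pderivs is (character t) y) \<le> A"
proof -
  obtain B :: "'d list \<Rightarrow> real" where B: "\<And>is y. cmod (pderivs is (character t) y) \<le> B is"
    using norm_pderivs_character[where t = t] by metis
  show thesis
  proof (rule that[of "1 + (\<Sum>is\<in>{is. length is \<le> m}. \<bar>B is\<bar>)"])
    show "0 < 1 + (\<Sum>is\<in>{is. length is \<le> m}. \<bar>B is\<bar>)" by (intro add_pos_nonneg sum_nonneg) auto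
    fix "is" :: "'d list" and y assume "length is \<le> m"
    then have "\<bar>B is\<bar> \<le> (\<Sum>is\<in>{is. length is \<le> m}. \<bar>B is\<bar>)"
      using finite_lists_le by (intro member_le_sum) auto
    then show "cmod (pderivs is (character t) y) \<le> 1 + (\<Sum>is\<in>{is. length is \<le> m}. \<bar>B is\<bar>)"
      using B[of "is" y] by linarith
  qed
qed

text \<open>The factor \<epsilon> has two origins: at order 0 it comes from the zero of
  \<open>\<psi>\<close> at \<open>a\<close> and the mean value inequality, at higher orders from the
  chain rule.\<close>

lemma blow_up_bound:
  fixes \<psi> :: "real^'d::finite \<Rightarrow> complex"
  assumes \<psi>: "\<psi> \<in> test_functions" "\<psi> a = 0"
  obtains K where "0 < K" "\<And>\<epsilon> is z. 0 < \<epsilon> \<Longrightarrow> \<epsilon> \<le> 1 \<Longrightarrow> length is \<le> N \<Longrightarrow>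
    cmod (pderivs is (\<lambda>z. \<psi> (a + \<epsilon> *\<^sub>R z) * jet (\<lambda>_. 0) z) z) \<le> K * \<epsilon>"
proof -
  let ?\<rho> = "2 * real CARD('d)"
  obtain M where M: "0 < M" "\<And>is x. length is \<le> Suc N \<Longrightarrow> cmod (pderivs is \<psi> x) \<le> M"
    using test_bounded[OF \<psi>(1), of "Suc N"] by blast
  obtain B where B: "0 < B" "\<And>is x. length is \<le> N \<Longrightarrow> cmod (pderivs is (jet (\<lambda>_. 0)) (x :: real^'d)) \<le> B"
    using test_bounded[OF test_jet, of N "\<lambda>_. 0"] by blast
  have s: "smooth \<psi>" using \<psi> by (intro test_smooth)
  define L where "L = real CARD('d) * M * ?\<rho> + M"
  have L: "0 < L" unfolding L_def using M(1) by (intro add_nonneg_pos) auto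
  show thesis
  proof (rule that[of "2 ^ N * (L * B)"])
    show "0 < 2 ^ N * (L * B)" using L B(1) by simp
    fix \<epsilon> :: real and "is" :: "'d list" and z :: "real^'d"
    assume \<epsilon>: "0 < \<epsilon>" "\<epsilon> \<le> 1" and l: "length is \<le> N"
    show "cmod (pderivs is (\<lambda>z. \<psi> (a + \<epsilon> *\<^sub>R z) * jet (\<lambda>_. 0) z) z) \<le> 2 ^ N * (L * B) * \<epsilon>"
    proof (cases "?\<rho> < norm z")
      case True
      have "pderivs is (\<lambda>z. \<psi> (a + \<epsilon> *\<^sub>R z) * jet (\<lambda>_. 0) z) z = 0"
        by (rule pderivs_eq_0_norm[OF _ True]) (simp add: jet_eq_0)
      then show ?thesis using L B(1) \<epsilon> by simp
    next
      case False
      have "cmod (pderivs is (\<lambda>z. \<psi> (a + \<epsilon> *\<^sub>R z) * jet (\<lambda>_. 0) z) z) \<le> 2 ^ length is * ((L * \<epsilon>) * B)"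
      proof (rule norm_pderivs_mult_le)
        fix c :: "'d list" assume c: "length c \<le> length is"
        show "cmod (pderivs c (\<lambda>z. \<psi> (a + \<epsilon> *\<^sub>R z)) z) \<le> L * \<epsilon>"
        proof (cases c)
          case Nil
          have "cmod (\<psi> (a + \<epsilon> *\<^sub>R z) - \<psi> a) \<le> real CARD('d) * M * norm (a + \<epsilon> *\<^sub>R z - a)"
            by (rule smooth_mean_value_bound[OF s convex_UNIV])
              (use M(2)[of "[i]" for i] in \<open>auto simp: pderivs_Cons\<close>)
          also have "\<dots> = real CARD('d) * M * (\<epsilon> * norm z)" using \<epsilon> by simp
          also have "\<dots> \<le> real CARD('d) * M * (\<epsilon> * ?\<rho>)"
            using False \<epsilon> M(1) by (intro mult_left_mono) auto
          also have "\<dots> \<le> L * \<epsilon>" unfolding L_def using M(1) \<epsilon> by (simp add: algebra_simps)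
          finally show ?thesis using \<psi>(2) Nil by simp
        next
          case (Cons i c')
          have "\<epsilon> ^ length c * cmod (pderivs c \<psi> (a + \<epsilon> *\<^sub>R z)) \<le> \<epsilon> * M"
          proof (intro mult_mono M(2))
            show "\<epsilon> ^ length c \<le> \<epsilon>" using \<epsilon> Cons by (simp add: mult_left_le power_le_one)
            show "length c \<le> Suc N" using c l by simp
          qed (use \<epsilon> in auto)
          also have "\<dots> \<le> L * \<epsilon>" unfolding L_def using M(1) \<epsilon> by (simp add: algebra_simps)
          finally show ?thesis unfolding pderivs_affine[OF s] using \<epsilon> by (simp add: norm_mult norm_power)
        qed
      qed (use l B in \<open>auto intro: smooth_affine s smooth_jet\<close>)
      also have "\<dots> \<le> 2 ^ N * ((L * \<epsilon>) * B)"
        using l L B(1) \<epsilon> by (intro mult_right_mono power_increasing) auto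
      finally show ?thesis by (simp add: mult_ac)
    qed
  qed
qed

text \<open>Rescaling around \<open>\<gamma>\<close> gains a factor \<open>\<epsilon>\<close> from \<open>\<psi> \<gamma> = 0\<close>, while translation boundedness
  of \<open>f\<close> makes the remaining factors cancel: the transform of \<open>f\<close> has order zero at \<open>\<gamma>\<close>.\<close>

lemma dist_fourier_order_0:
  fixes f :: "(real^'d::finite \<Rightarrow> complex) \<Rightarrow> complex"
  assumes f: "tempered_distribution f" and tb: "translation_bounded f m C"
    and \<psi>: "\<psi> \<in> test_functions" "\<psi> \<gamma> = 0"
    and r: "0 < r" "\<And>b. b \<in> dist_supp (dist_fourier f) \<Longrightarrow> dist \<gamma> b \<le> 2 * real CARD('d) * r \<Longrightarrow> b = \<gamma>"
  shows "dist_fourier f (\<lambda>x. \<psi> x * cutoff \<gamma> r x) = 0"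
proof -
  let ?d = "CARD('d)" and ?N = "CARD('d) + 2" and ?\<rho> = "2 * real CARD('d)"
  have C: "0 < C" using tb by (simp add: translation_bounded_def)
  obtain K where K: "0 < K" "\<And>\<epsilon> is z. 0 < \<epsilon> \<Longrightarrow> \<epsilon> \<le> 1 \<Longrightarrow> length is \<le> ?N \<Longrightarrow>
    cmod (pderivs is (\<lambda>z. \<psi> (\<gamma> + \<epsilon> *\<^sub>R z) * jet (\<lambda>_. 0) z) z) \<le> K * \<epsilon>"
    by (rule blow_up_bound[OF \<psi>, where N = ?N]) blast
  obtain C1 where C1: "0 < C1" "\<And>\<psi> M is (y::real^'d::finite). \<psi> \<in> test_functions \<Longrightarrow> (\<And>x. ?\<rho> < norm x \<Longrightarrow> \<psi> x = 0) \<Longrightarrow>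
    0 < M \<Longrightarrow> (\<And>js x. length js \<le> ?N \<Longrightarrow> cmod (pderivs js \<psi> x) \<le> M) \<Longrightarrow> length is \<le> m \<Longrightarrow>
    (1 + norm y) ^ ?N * cmod (pderivs is (fourier \<psi>) y) \<le> C1 * M"
  proof (rule fourier_pderivs_decay[where R = ?\<rho> and N = ?N and m = m and 'd = 'd], goal_cases)
    case (1 C)
    show ?case by (rule 1(1)[OF 1(2,3)])
  qed
  obtain A where A: "0 < A" "\<And>is (y::real^'d::finite). length is \<le> m \<Longrightarrow> cmod (pderivs is (character (- \<gamma>)) y) \<le> A"
    by (rule character_pderivs_bound[where m = m and t = "- \<gamma>"]) blast
  define Q where "Q = 2 ^ m * (A * (C1 * K))"
  have Q: "0 < Q" unfolding Q_def using A(1) C1(1) K(1) by simp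
  have bound: "cmod (dist_fourier f (\<lambda>x. \<psi> x * cutoff \<gamma> r x)) \<le> C * Q * \<epsilon>" if \<epsilon>: "0 < \<epsilon>" "\<epsilon> \<le> min r 1" for \<epsilon>
  proof -
    let ?\<Psi> = "\<lambda>z. \<psi> (\<gamma> + \<epsilon> *\<^sub>R z) * jet (\<lambda>_. 0) z"
    have t: "?\<Psi> \<in> test_functions"
    proof -
      have "(\<lambda>z. \<psi> (\<gamma> + \<epsilon> *\<^sub>R z)) \<in> test_functions" using \<epsilon> by (intro test_affine \<psi>) simp
      then show ?thesis by (rule test_mult[OF _ smooth_jet])
    qed
    have eq: "(\<lambda>x. \<psi> x * cutoff \<gamma> \<epsilon> x) = (\<lambda>x. ?\<Psi> (- (1 / \<epsilon>) *\<^sub>R \<gamma> + (1 / \<epsilon>) *\<^sub>R x))"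
      using \<epsilon>(1) by (simp add: cutoff_def fun_eq_iff scaleR_add_right scaleR_diff_right)
    \<comment> \<open>A bump of size \<epsilon> has a transform of height \<epsilon>^d and width
      1/\<epsilon>; the height offsets the \<epsilon>^(-d) in
      \<open>translation_bounded\<close>.\<close>
    have F: "fourier (\<lambda>x. \<psi> x * cutoff \<gamma> \<epsilon> x)
        = (\<lambda>y. of_real (\<epsilon> ^ ?d) * (character (- \<gamma>) y * fourier ?\<Psi> (0 + \<epsilon> *\<^sub>R y)))"
      unfolding eq by (rule ext) (simp only: fourier_affine[OF t \<epsilon>(1)] add_0_left)
    have sF: "smooth (fourier ?\<Psi>)" by (rule smooth_fourier[OF t])
    have "cmod (f (fourier (\<lambda>x. \<psi> x * cutoff \<gamma> \<epsilon> x))) \<le> C * (\<epsilon> ^ ?d * (Q * \<epsilon>)) / \<epsilon> ^ ?d"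
    proof (rule translation_boundedD[OF tb, where t = 0])
      show "rapid (fourier (\<lambda>x. \<psi> x * cutoff \<gamma> \<epsilon> x))" by (intro rapid_fourier test_mult \<psi> smooth_cutoff)
      show "0 \<le> \<epsilon> ^ ?d * (Q * \<epsilon>)" using Q \<epsilon> by simp
      fix "is" :: "'d list" and y :: "real^'d" assume l: "length is \<le> m"
      let ?P = "(1 + \<epsilon> * norm y) ^ ?N"
      have P: "0 < ?P" using \<epsilon> by (intro zero_less_power add_pos_nonneg) auto
      have "cmod (pderivs is (\<lambda>y. character (- \<gamma>) y * fourier ?\<Psi> (0 + \<epsilon> *\<^sub>R y)) y)
          \<le> 2 ^ length is * (A * (C1 * (K * \<epsilon>) / ?P))"
      proof (rule norm_pderivs_mult_le)
        fix b :: "'d list" assume b: "length b \<le> length is"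
        have "cmod (pderivs b (\<lambda>y. fourier ?\<Psi> (0 + \<epsilon> *\<^sub>R y)) y) \<le> 1 * cmod (pderivs b (fourier ?\<Psi>) (\<epsilon> *\<^sub>R y))"
          unfolding pderivs_affine[OF sF] norm_mult norm_of_real
          using \<epsilon> by (intro mult_mono) (auto simp: power_le_one)
        also have "(1 + norm (\<epsilon> *\<^sub>R y)) ^ ?N * cmod (pderivs b (fourier ?\<Psi>) (\<epsilon> *\<^sub>R y)) \<le> C1 * (K * \<epsilon>)"
          by (rule C1(2)[OF t]) (use K \<epsilon> b l in \<open>auto simp: jet_eq_0\<close>)
        then have "1 * cmod (pderivs b (fourier ?\<Psi>) (\<epsilon> *\<^sub>R y)) \<le> C1 * (K * \<epsilon>) / ?P"
          using \<epsilon>(1) by (simp only: mult_1_left pos_le_divide_eq[OF P] norm_scaleR abs_of_pos mult.commute)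
        finally show "cmod (pderivs b (\<lambda>y. fourier ?\<Psi> (0 + \<epsilon> *\<^sub>R y)) y) \<le> C1 * (K * \<epsilon>) / ?P" .
      qed (use A l smooth_character smooth_affine[OF sF, of 0 \<epsilon>] in auto)
      also have "\<dots> \<le> 2 ^ m * (A * (C1 * (K * \<epsilon>) / ?P))"
        using l A(1) C1(1) K(1) \<epsilon> P by (intro mult_right_mono power_increasing) auto
      also have "\<dots> = Q * \<epsilon> / ?P" unfolding Q_def by (simp only: times_divide_eq_right mult_ac)
      finally have "cmod (pderivs is (\<lambda>y. character (- \<gamma>) y * fourier ?\<Psi> (0 + \<epsilon> *\<^sub>R y)) y) \<le> Q * \<epsilon> / ?P" .
      then have "\<epsilon> ^ ?d * cmod (pderivs is (\<lambda>y. character (- \<gamma>) y * fourier ?\<Psi> (0 + \<epsilon> *\<^sub>R y)) y) \<le> \<epsilon> ^ ?d * (Q * \<epsilon> / ?P)"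
        using \<epsilon> by (intro mult_left_mono) auto
      moreover have "pderivs is (fourier (\<lambda>x. \<psi> x * cutoff \<gamma> \<epsilon> x)) y = of_real (\<epsilon> ^ ?d)
          * pderivs is (\<lambda>y. character (- \<gamma>) y * fourier ?\<Psi> (0 + \<epsilon> *\<^sub>R y)) y"
        unfolding F by (subst pderivs_cmult) (intro smooth_mult smooth_character smooth_affine sF refl)+
      ultimately show "cmod (pderivs is (fourier (\<lambda>x. \<psi> x * cutoff \<gamma> \<epsilon> x)) y)
          \<le> \<epsilon> ^ ?d * (Q * \<epsilon>) / (1 + \<epsilon> * norm (y - 0)) ^ ?N"
        using \<epsilon> by (simp only: norm_mult norm_of_real diff_zero times_divide_eq_right abs_of_nonneg zero_le_power less_imp_le)
    qed (use \<epsilon> in auto)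
    also have "\<dots> = C * Q * \<epsilon>" using \<epsilon> by simp
    finally have "cmod (dist_fourier f (\<lambda>x. \<psi> x * cutoff \<gamma> \<epsilon> x)) \<le> C * Q * \<epsilon>" by (simp add: dist_fourier_def)
    moreover have "dist_fourier f (\<lambda>x. \<psi> x * cutoff \<gamma> r x) = dist_fourier f (\<lambda>x. \<psi> x * cutoff \<gamma> \<epsilon> x)"
      using \<epsilon> by (intro cutoff_shrink dist_fourier_lin_on_test f \<psi> r(2)) auto
    ultimately show ?thesis by simp
  qed
  have "cmod (dist_fourier f (\<lambda>x. \<psi> x * cutoff \<gamma> r x)) \<le> 0"
  proof (rule field_le_epsilon)
    fix e :: real assume e: "0 < e"
    define \<epsilon> where "\<epsilon> = min (min r 1) (e / (C * Q))"
    have \<epsilon>: "0 < \<epsilon>" "\<epsilon> \<le> min r 1" "\<epsilon> \<le> e / (C * Q)" using e r(1) C Q by (auto simp: \<epsilon>_def)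
    then have "C * Q * \<epsilon> \<le> e" using C Q by (simp add: pos_le_divide_eq mult_ac)
    with bound[OF \<epsilon>(1,2)] show "cmod (dist_fourier f (\<lambda>x. \<psi> x * cutoff \<gamma> r x)) \<le> 0 + e" by simp
  qed
  then show ?thesis by simp
qed

text \<open>By order zero, near each spectral point the character may be replaced by its value
  there. Characters have no zeros, so the support of the product and hence \<open>W\<close> is the
  same for all \<open>t\<close>; the coefficients involve \<open>\<psi>\<close> alone.\<close>

lemma dist_fourier_mult_character:
  fixes f :: "(real^'d::finite \<Rightarrow> complex) \<Rightarrow> complex"
  assumes f: "tempered_distribution f" and tb: "translation_bounded f m C"
    and d: "discrete_set (dist_supp (dist_fourier f))" and \<psi>: "\<psi> \<in> test_functions"
  obtains W c where "finite W" "\<And>t. dist_fourier f (\<lambda>x. \<psi> x * character t x) = (\<Sum>\<gamma>\<in>W. c \<gamma> * character \<gamma> t)"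
proof -
  let ?A = "dist_supp (dist_fourier f)"
  note lin = dist_fourier_lin_on_test[OF f]
  obtain r where r: "\<And>a. 0 < r a" "\<And>a b. b \<in> ?A \<Longrightarrow> dist a b \<le> 2 * real CARD('d) * r a \<Longrightarrow> b = a"
    using discrete_set_isolating_radius[OF d] by blast
  show thesis
  proof (rule that[of "?A \<inter> fun_supp \<psi>" "\<lambda>\<gamma>. dist_fourier f (\<lambda>x. \<psi> x * cutoff \<gamma> (r \<gamma>) x)"])
    show "finite (?A \<inter> fun_supp \<psi>)"
      using \<psi> by (intro discrete_set_finite_Int d) (auto simp: test_functions_def compact_imp_bounded)
    fix t
    let ?\<phi> = "\<lambda>x. \<psi> x * character t x"
    have t: "?\<phi> \<in> test_functions" by (intro test_mult \<psi> smooth_character)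
    have "fun_supp ?\<phi> = fun_supp \<psi>"
      unfolding fun_supp_def by (simp add: character_def)
    then have "dist_fourier f ?\<phi> = (\<Sum>\<gamma>\<in>?A \<inter> fun_supp \<psi>. dist_fourier f (\<lambda>x. ?\<phi> x * cutoff \<gamma> (r \<gamma>) x))"
      using localize_at_dist_supp[OF lin refl d t r] by simp
    also have "\<dots> = (\<Sum>\<gamma>\<in>?A \<inter> fun_supp \<psi>. dist_fourier f (\<lambda>x. \<psi> x * cutoff \<gamma> (r \<gamma>) x) * character \<gamma> t)"
    proof (rule sum.cong[OF refl])
      fix \<gamma>
      let ?u = "\<lambda>x. ?\<phi> x * cutoff \<gamma> (r \<gamma>) x" and ?v = "\<lambda>x. \<psi> x * cutoff \<gamma> (r \<gamma>) x"
      have uv: "?u \<in> test_functions" "?v \<in> test_functions" by (intro test_mult t \<psi> smooth_cutoff)+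
      \<comment> \<open>The function multiplying the cutoff vanishes at \<open>\<gamma>\<close>,
        which is the premise of \<open>dist_fourier_order_0\<close>.\<close>
      have "dist_fourier f (\<lambda>x. (?\<phi> x - character t \<gamma> * \<psi> x) * cutoff \<gamma> (r \<gamma>) x) = 0"
        by (rule dist_fourier_order_0[OF f tb _ _ r]) (intro test_diff test_cmult t \<psi>, simp)
      moreover have "(\<lambda>x. (?\<phi> x - character t \<gamma> * \<psi> x) * cutoff \<gamma> (r \<gamma>) x) = (\<lambda>x. 1 * ?u x + (- character t \<gamma>) * ?v x)"
        by (simp add: algebra_simps)
      ultimately have "1 * dist_fourier f ?u + (- character t \<gamma>) * dist_fourier f ?v = 0"
        using lin_on_testD[OF lin uv, of 1 "- character t \<gamma>"] by simp
      then show "dist_fourier f ?u = dist_fourier f ?v * character \<gamma> t"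
        by (simp add: character_commute[of t] mult.commute)
    qed
    finally show "dist_fourier f ?\<phi> = (\<Sum>\<gamma>\<in>?A \<inter> fun_supp \<psi>. dist_fourier f (\<lambda>x. \<psi> x * cutoff \<gamma> (r \<gamma>) x) * character \<gamma> t)" .
  qed
qed

subsection \<open>Approximation by transforms of test functions\<close>

lemma borel_measurable_character_prod:
  "(\<lambda>(x, y). character x y) \<in> borel_measurable (lborel \<Otimes>\<^sub>M (lborel :: (real^'d::finite) measure))"
  unfolding character_def by measurable

lemma fubini_character:
  fixes f g :: "real^'d::finite \<Rightarrow> complex"
  assumes f: "integrable lborel f" and g: "integrable lborel g"
  shows "(\<integral>y. (\<integral>x. f x * g y * character x y \<partial>lborel) \<partial>lborel)
    = (\<integral>x. (\<integral>y. f x * g y * character x y \<partial>lborel) \<partial>lborel)"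
proof (rule lborel_pair.Fubini_integral)
  have mf: "f \<in> borel_measurable lborel" and mg: "g \<in> borel_measurable lborel"
    using f g by (auto dest: borel_measurable_integrable)
  show "integrable (lborel \<Otimes>\<^sub>M lborel) (\<lambda>(x, y). f x * g y * character x y)"
  proof (rule lborel_pair.Fubini_integrable)
    have "(\<lambda>p. f (fst p)) \<in> borel_measurable (lborel \<Otimes>\<^sub>M lborel)" "(\<lambda>p. g (snd p)) \<in> borel_measurable (lborel \<Otimes>\<^sub>M lborel)"
      by (rule measurable_compose[OF measurable_fst mf], rule measurable_compose[OF measurable_snd mg])
    then show "(\<lambda>(x, y). f x * g y * character x y) \<in> borel_measurable (lborel \<Otimes>\<^sub>M lborel)"
      using borel_measurable_character_prod[where 'd = 'd] unfolding case_prod_unfold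
      by (intro borel_measurable_times) auto
    have "(\<lambda>x. \<integral>y. norm (case (x, y) of (x, y) \<Rightarrow> f x * g y * character x y) \<partial>lborel)
        = (\<lambda>x. cmod (f x) * (\<integral>y. cmod (g y) \<partial>lborel))"
      by (simp add: norm_mult)
    then show "integrable lborel (\<lambda>x. \<integral>y. norm (case (x, y) of (x, y) \<Rightarrow> f x * g y * character x y) \<partial>lborel)"
      using f by (simp add: integrable_norm)
    show "AE x in lborel. integrable lborel (\<lambda>y. case (x, y) of (x, y) \<Rightarrow> f x * g y * character x y)"
    proof (rule AE_I2)
      fix x
      have "(\<lambda>y. f x * g y * character x y) \<in> borel_measurable lborel"
        using mg borel_measurable_continuous_onI[OF continuous_character[of UNIV x]] by measurable
      moreover have "integrable lborel (\<lambda>y. cmod (f x) * cmod (g y))" using g by (simp add: integrable_norm)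
      ultimately have "integrable lborel (\<lambda>y. f x * g y * character x y)"
        by (rule_tac Bochner_Integration.integrable_bound[where f = "\<lambda>y. cmod (f x) * cmod (g y)"])
          (auto simp: norm_mult)
      then show "integrable lborel (\<lambda>y. case (x, y) of (x, y) \<Rightarrow> f x * g y * character x y)" by simp
    qed
  qed
qed

lemma rapid_integrable:
  fixes \<phi> :: "real^'d::finite \<Rightarrow> complex"
  assumes "rapid \<phi>"
  shows "integrable lborel (\<lambda>x. (1 + norm x) ^ k * cmod (\<phi> x))" "integrable lborel \<phi>"
proof -
  have m: "\<phi> \<in> borel_measurable lborel"
    using borel_measurable_continuous_onI[OF smooth_continuous_on[OF rapid_smooth[OF assms]]] by simp
  have *: "integrable lborel (\<lambda>x. (1 + norm x) ^ k * cmod (\<phi> x))" for k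
  proof -
    obtain S where S: "0 < S" "\<And>is x. length is \<le> 0 \<Longrightarrow> (1 + norm x) ^ (k + (CARD('d) + 2)) * cmod (pderivs is \<phi> x) \<le> S"
      using rapid_uniform[OF assms, of 0 "k + (CARD('d) + 2)"] by blast
    show ?thesis
    proof (rule Bochner_Integration.integrable_bound)
      show "integrable lborel (\<lambda>x::real^'d. S * (1 / (1 + norm x) ^ (CARD('d) + 2)))"
        by (intro integrable_mult_right integrable_decay)
      show "(\<lambda>x. (1 + norm x) ^ k * cmod (\<phi> x)) \<in> borel_measurable lborel" using m by measurable
      show "AE x in lborel. norm ((1 + norm x) ^ k * cmod (\<phi> x)) \<le> norm (S * (1 / (1 + norm x) ^ (CARD('d) + 2)))"
      proof (rule AE_I2)
        fix x :: "real^'d"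
        have p: "0 < (1 + norm x) ^ q" for q by (intro zero_less_power add_pos_nonneg) auto
        have "(1 + norm x) ^ k * cmod (\<phi> x) * (1 + norm x) ^ (CARD('d) + 2) \<le> S"
          using S(2)[of "[]" x] by (simp only: power_add pderivs_Nil list.size(3) order_refl simp_thms mult_ac)
        then have "(1 + norm x) ^ k * cmod (\<phi> x) \<le> S * (1 / (1 + norm x) ^ (CARD('d) + 2))"
          using p[of "CARD('d) + 2"] by (simp only: pos_le_divide_eq times_divide_eq_right mult_1_right)
        then show "norm ((1 + norm x) ^ k * cmod (\<phi> x)) \<le> norm (S * (1 / (1 + norm x) ^ (CARD('d) + 2)))"
          using p[of k] S(1) by (simp only: real_norm_def) (simp add: abs_mult)
      qed
    qed
  qed
  show "integrable lborel (\<lambda>x. (1 + norm x) ^ k * cmod (\<phi> x))" by (rule *)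
  show "integrable lborel \<phi>"
    using *[of 0] m by (simp add: integrable_norm_iff)
qed

text \<open>If all transforms of test functions had mean zero, Plancherel's identity, which here is just
  Fubini's theorem, would make them vanish.\<close>

lemma exists_mean_one_fourier:
  obtains \<psi> :: "real^'d::finite \<Rightarrow> complex" where "\<psi> \<in> test_functions" "(\<integral>x. fourier \<psi> x \<partial>lborel) = 1"
proof -
  have "\<exists>\<psi>\<in>test_functions. (\<integral>x. fourier \<psi> x \<partial>(lborel :: (real^'d) measure)) \<noteq> 0"
  proof (rule ccontr)
    assume "\<not> ?thesis"
    then have Z: "(\<integral>x. fourier \<psi> x \<partial>(lborel :: (real^'d) measure)) = 0" if "\<psi> \<in> test_functions" for \<psi>
      using that by blast
    \<comment> \<open>A nonnegative plateau: its transform at 0 is its integral, hence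
      positive.\<close>
    let ?h = "jet (\<lambda>_. 0) :: real^'d \<Rightarrow> complex"
    let ?H = "fourier ?h"
    have h: "?h \<in> test_functions" by (rule test_jet)
    have ih: "integrable lborel ?h" and iH: "integrable lborel ?H"
      by (intro rapid_integrable test_rapid rapid_fourier h)+
    have hreal: "\<exists>c\<ge>0. ?h x = of_real c" for x
      by (intro exI[of _ "\<Prod>i\<in>UNIV. plateau1 (x $ i)"])
        (simp add: jet_def tens_def jet1_def prod_nonneg plateau1_simps)
    then have cnjh: "cnj (?h x) = ?h x" for x by (metis complex_cnj_complex_of_real)
    have cnjH: "cnj (?H x) = (\<integral>y. ?h y * character x y \<partial>lborel)" for x
    proof -
      have "cnj (?H x) = (\<integral>y. cnj (?h y * character (- x) y) \<partial>lborel)"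
        unfolding fourier_character by (rule Bochner_Integration.integral_cnj[symmetric])
      also have "\<dots> = (\<integral>y. ?h y * character x y \<partial>lborel)"
        by (intro Bochner_Integration.integral_cong refl) (simp add: cnjh character_def exp_cnj)
      finally show ?thesis .
    qed
    \<comment> \<open>The left side is the mean of the transform of a translate of
      \<open>?h\<close>, which is 0 by assumption.\<close>
    have shift: "(\<integral>x. ?H x * character x y \<partial>lborel) = 0" for y
    proof -
      have t: "(\<lambda>x. ?h (y + 1 *\<^sub>R x)) \<in> test_functions" by (intro test_affine h) simp
      have "fourier (\<lambda>x. ?h (y + 1 *\<^sub>R x)) z = ?H z * character z y" for z
        using fourier_affine[OF h, of 1 "- y" z] by (simp add: character_commute mult.commute)
      with Z[OF t] show ?thesis by simp
    qed
    have "(\<integral>x. ?H x * cnj (?H x) \<partial>lborel) = (\<integral>x. (\<integral>y. ?H x * ?h y * character x y \<partial>lborel) \<partial>lborel)"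
      unfolding cnjH by (simp add: mult.assoc)
    also have "\<dots> = (\<integral>y. (\<integral>x. ?H x * ?h y * character x y \<partial>lborel) \<partial>lborel)"
      by (rule fubini_character[OF iH ih, symmetric])
    also have "\<dots> = (\<integral>y. ?h y * (\<integral>x. ?H x * character x y \<partial>lborel) \<partial>lborel)"
    proof (intro Bochner_Integration.integral_cong refl)
      fix y
      have "(\<integral>x. ?H x * ?h y * character x y \<partial>lborel) = (\<integral>x. ?h y * (?H x * character x y) \<partial>lborel)"
        by (intro Bochner_Integration.integral_cong) (simp_all add: mult_ac)
      then show "(\<integral>x. ?H x * ?h y * character x y \<partial>lborel) = ?h y * (\<integral>x. ?H x * character x y \<partial>lborel)" by simp
    qed
    also have "\<dots> = 0" by (simp add: shift)
    finally have "(\<integral>x. complex_of_real ((cmod (?H x))\<^sup>2) \<partial>lborel) = 0"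
      by (simp only: complex_norm_square)
    then have int0: "(\<integral>x. (cmod (?H x))\<^sup>2 \<partial>lborel) = 0"
      by (simp only: integral_complex_of_real of_real_eq_0_iff)
    obtain S where S: "0 < S" "\<And>is x. length is \<le> 0 \<Longrightarrow> (1 + norm x) ^ 0 * cmod (pderivs is ?H x) \<le> S"
      using rapid_uniform[OF rapid_fourier[OF h], of 0 0] by blast
    have iH2: "integrable lborel (\<lambda>x. (cmod (?H x))\<^sup>2)"
    proof (rule Bochner_Integration.integrable_bound)
      show "integrable lborel (\<lambda>x. S * cmod (?H x))" using iH by (simp add: integrable_norm)
      show "(\<lambda>x. (cmod (?H x))\<^sup>2) \<in> borel_measurable lborel"
        using borel_measurable_integrable[OF iH] by measurable
      show "AE x in lborel. norm ((cmod (?H x))\<^sup>2) \<le> norm (S * cmod (?H x))"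
        using S(2)[of "[]"] S(1) by (intro AE_I2) (auto simp: power2_eq_square abs_mult intro!: mult_right_mono)
    qed
    have "AE x in lborel. (cmod (?H x))\<^sup>2 = 0"
      using integral_nonneg_eq_0_iff_AE[OF iH2] int0 by simp
    then have ae: "AE x in lborel. ?H x = 0" by simp
    have "?H 0 = 0"
    proof (rule ccontr)
      assume "?H 0 \<noteq> 0"
      let ?U = "{x. ?H x \<noteq> 0}"
      have op: "open ?U"
        using smooth_continuous_on[OF smooth_fourier[OF h], of UNIV]
        by (intro open_Collect_neq continuous_on_const) auto
      have U0: "emeasure lborel ?U = 0"
        using ae op by (subst (asm) AE_iff_measurable[of ?U]) auto
      have "0 \<in> ?U" using \<open>?H 0 \<noteq> 0\<close> by simp
      from openE[OF op this] obtain e where e: "0 < e" "ball 0 e \<subseteq> ?U" by blast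
      have "emeasure lborel (ball (0::real^'d) e) \<le> 0"
        unfolding U0[symmetric] by (rule emeasure_mono[OF e(2)]) (use op in simp)
      with e(1) have "unit_ball_vol (real CARD('d)) = 0" by (simp add: emeasure_ball)
      with unit_ball_vol_pos[of "real CARD('d)"] show False by linarith
    qed
    moreover have "Re (?H 0) > 0"
    proof -
      have "?H 0 = (\<integral>x. ?h x \<partial>lborel)" by (simp add: fourier_character)
      then have "Re (?H 0) = (\<integral>x. Re (?h x) \<partial>lborel)" using ih by (simp add: integral_Re)
      moreover have "(\<integral>x. indicator (ball (0::real^'d) 1) x \<partial>lborel) \<le> (\<integral>x. Re (?h x) \<partial>lborel)"
      proof (rule integral_mono)
        show "integrable lborel (indicator (ball (0::real^'d) 1) :: _ \<Rightarrow> real)"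
          using emeasure_lborel_ball_finite[of "0::real^'d" 1] by (intro integrable_real_indicator) auto
        show "integrable lborel (\<lambda>x. Re (?h x))" using ih by (rule integrable_Re)
        fix x :: "real^'d"
        show "indicator (ball 0 1) x \<le> Re (?h x)"
          using hreal[of x] jet_0_eq_1[of x] by (auto simp: indicator_def)
      qed
      moreover have "(\<integral>x. indicator (ball (0::real^'d) 1) x \<partial>lborel) > (0::real)"
        by (simp add: content_ball)
      ultimately show ?thesis by linarith
    qed
    ultimately show False by simp
  qed
  then obtain \<psi> :: "real^'d \<Rightarrow> complex" where \<psi>: "\<psi> \<in> test_functions" "(\<integral>x. fourier \<psi> x \<partial>lborel) \<noteq> 0" by blast
  define c where "c = (\<integral>x. fourier \<psi> x \<partial>lborel)"
  show thesis
  proof (rule that[of "\<lambda>x. inverse c * \<psi> x"])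
    show "(\<lambda>x. inverse c * \<psi> x) \<in> test_functions" by (rule test_cmult[OF \<psi>(1)])
    show "(\<integral>x. fourier (\<lambda>x. inverse c * \<psi> x) x \<partial>lborel) = 1"
      unfolding fourier_cmult[OF \<psi>(1)] using \<psi>(2) by (simp add: c_def)
  qed
qed

text \<open>This is the convolution of \<open>\<phi>\<close> with the transform of
  \<open>\<psi>\<close> (\<open>mollified_convolution\<close>), written so that it is visibly the
  transform of a test function.\<close>

definition mollified :: "(real^'d::finite \<Rightarrow> complex) \<Rightarrow> (real^'d \<Rightarrow> complex) \<Rightarrow> real^'d \<Rightarrow> complex" where
  "mollified \<psi> \<phi> = fourier (\<lambda>y. \<psi> y * fourier \<phi> (0 + (-1) *\<^sub>R y))"

lemma test_mollifier:
  "\<psi> \<in> test_functions \<Longrightarrow> \<phi> \<in> test_functions \<Longrightarrow> (\<lambda>y. \<psi> y * fourier \<phi> (0 + (-1) *\<^sub>R y)) \<in> test_functions"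
  by (intro test_mult smooth_affine smooth_fourier)

text \<open>Differentiating the outer transform multiplies by a coordinate, and at the reflected
  argument this is exactly the factor by which the inner transform of a derivative differs.\<close>

lemma pderivs_mollified:
  assumes \<psi>: "\<psi> \<in> test_functions"
  shows "\<phi> \<in> test_functions \<Longrightarrow> pderivs is (mollified \<psi> \<phi>) = mollified \<psi> (pderivs is \<phi>)"
proof (induction "is")
  case (Cons i "is")
  have t: "pderivs is \<phi> \<in> test_functions" by (rule test_pderivs[OF Cons.prems])
  have "pderivs (i # is) (mollified \<psi> \<phi>)
      = fourier (coord_mult i (\<lambda>y. \<psi> y * fourier (pderivs is \<phi>) (0 + (-1) *\<^sub>R y)))"
    unfolding pderivs_Cons Cons.IH[OF Cons.prems] unfolding mollified_def
    by (rule partial_deriv_fourier[OF test_mollifier[OF \<psi> t]])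
  also have "coord_mult i (\<lambda>y. \<psi> y * fourier (pderivs is \<phi>) (0 + (-1) *\<^sub>R y))
      = (\<lambda>y. \<psi> y * fourier (partial_deriv i (pderivs is \<phi>)) (0 + (-1) *\<^sub>R y))"
    by (simp add: fun_eq_iff coord_mult_def fourier_partial_deriv[OF t] mult_ac)
  finally show ?case unfolding mollified_def pderivs_Cons .
qed simp

text \<open>After Fubini, dilating \<open>\<psi>\<close> by \<open>r\<close> concentrates its
  transform at scale \<open>r\<close> without changing the integral of the transform, so the kernels
  form an approximate identity as \<open>r\<close> tends to 0.\<close>

lemma mollified_convolution:
  fixes \<psi> \<phi> :: "real^'d::finite \<Rightarrow> complex"
  assumes \<psi>: "\<psi> \<in> test_functions" and \<phi>: "\<phi> \<in> test_functions" and r: "0 < r"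
  shows "mollified (\<lambda>y. \<psi> (0 + r *\<^sub>R y)) \<phi> x = (\<integral>u. \<phi> (x - r *\<^sub>R u) * fourier \<psi> u \<partial>lborel)"
proof -
  let ?\<psi> = "\<lambda>y. \<psi> (0 + r *\<^sub>R y)"
  have t: "?\<psi> \<in> test_functions" using r by (intro test_affine \<psi>) simp
  have i1: "integrable lborel (\<lambda>y. ?\<psi> y * character (- x) y)"
    by (rule test_integrable_mult[OF t continuous_character])
  have i2: "integrable lborel \<phi>" by (intro rapid_integrable test_rapid \<phi>)
  have "mollified ?\<psi> \<phi> x = (\<integral>y. (\<integral>u. (?\<psi> y * character (- x) y) * \<phi> u * character y u \<partial>lborel) \<partial>lborel)"
    unfolding mollified_def fourier_character[of _ x]
  proof (intro Bochner_Integration.integral_cong refl)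
    fix y
    have "(\<integral>u. (?\<psi> y * character (- x) y) * \<phi> u * character y u \<partial>lborel)
        = (\<integral>u. (?\<psi> y * character (- x) y) * (\<phi> u * character y u) \<partial>lborel)" by (simp add: mult.assoc)
    also have "\<dots> = (?\<psi> y * character (- x) y) * fourier \<phi> (0 + (-1) *\<^sub>R y)"
      unfolding fourier_character by simp
    finally show "?\<psi> y * fourier \<phi> (0 + (-1) *\<^sub>R y) * character (- x) y
        = (\<integral>u. (?\<psi> y * character (- x) y) * \<phi> u * character y u \<partial>lborel)" by (simp add: mult_ac)
  qed
  also have "\<dots> = (\<integral>u. (\<integral>y. (?\<psi> y * character (- x) y) * \<phi> u * character y u \<partial>lborel) \<partial>lborel)"
    by (rule fubini_character[OF i1 i2, symmetric])
  also have "\<dots> = (\<integral>u. \<phi> u * fourier ?\<psi> (x - u) \<partial>lborel)"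
  proof (intro Bochner_Integration.integral_cong refl)
    fix u
    have c: "character (- (x - u)) y = character (- x) y * character y u" for y
      by (simp add: character_commute[of y] character_add[symmetric])
    have "(\<integral>y. (?\<psi> y * character (- x) y) * \<phi> u * character y u \<partial>lborel)
        = (\<integral>y. \<phi> u * (?\<psi> y * character (- (x - u)) y) \<partial>lborel)"
      unfolding c by (intro Bochner_Integration.integral_cong refl) (simp add: mult_ac)
    then show "(\<integral>y. (?\<psi> y * character (- x) y) * \<phi> u * character y u \<partial>lborel) = \<phi> u * fourier ?\<psi> (x - u)"
      unfolding fourier_character by simp
  qed
  also have "\<dots> = \<bar>- r\<bar> ^ DIM(real^'d) *\<^sub>R (\<integral>u. \<phi> (x + (- r) *\<^sub>R u) * fourier ?\<psi> (x - (x + (- r) *\<^sub>R u)) \<partial>lborel)"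
  proof (rule integral_lborel_affine)
    have "continuous_on UNIV (\<lambda>u. \<phi> u * fourier ?\<psi> (x - u))"
    proof (intro continuous_on_mult smooth_continuous_on)
      show "smooth \<phi>" by (rule test_smooth[OF \<phi>])
      show "smooth (\<lambda>u. fourier ?\<psi> (x - u))"
        using smooth_affine[OF smooth_fourier[OF t], of x "-1"] by simp
    qed
    then show "(\<lambda>u. \<phi> u * fourier ?\<psi> (x - u)) \<in> borel_measurable borel" by (rule borel_measurable_continuous_onI)
  qed (use r in simp)
  also have "\<dots> = (\<integral>u. \<phi> (x - r *\<^sub>R u) * fourier \<psi> u \<partial>lborel)"
  proof -
    have "fourier ?\<psi> (r *\<^sub>R u) = of_real ((1 / r) ^ CARD('d)) * fourier \<psi> u" for u
      using fourier_affine[OF \<psi>, of "1 / r" 0 "r *\<^sub>R u"] r by simp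
    then have "\<phi> (x + (- r) *\<^sub>R u) * fourier ?\<psi> (x - (x + (- r) *\<^sub>R u))
        = of_real ((1 / r) ^ CARD('d)) * (\<phi> (x - r *\<^sub>R u) * fourier \<psi> u)" for u
      by (simp add: mult_ac)
    then show ?thesis using r by (simp add: scaleR_conv_of_real power_one_over)
  qed
  finally show ?thesis .
qed

text \<open>Since the kernel has integral 1, the error averages the differences of
  \<open>\<phi>\<close> over shifts \<open>r u\<close>. The Lipschitz bound yields the factor
  \<open>r\<close>, and the decay in \<open>x\<close> comes from the compact support of
  \<open>\<phi>\<close>.\<close>

lemma mollified_approx:
  fixes \<phi> \<psi> :: "real^'d::finite \<Rightarrow> complex"
  assumes \<psi>: "\<psi> \<in> test_functions" "(\<integral>x. fourier \<psi> x \<partial>lborel) = 1" and \<phi>: "\<phi> \<in> test_functions"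
  obtains K where "0 < K" "\<And>r x. 0 < r \<Longrightarrow> r \<le> 1 \<Longrightarrow>
    cmod (\<phi> x - mollified (\<lambda>y. \<psi> (0 + r *\<^sub>R y)) \<phi> x) \<le> K * r / (1 + norm x) ^ N"
proof -
  obtain R where R: "0 < R" "\<And>x. R < norm x \<Longrightarrow> \<phi> x = 0" using test_bound[OF \<phi>] by blast
  obtain M where M: "0 < M" "\<And>is x. length is \<le> 1 \<Longrightarrow> cmod (pderivs is \<phi> x) \<le> M"
    using test_bounded[OF \<phi>, of 1] by blast
  let ?L = "real CARD('d) * M"
  have L: "0 < ?L" using M(1) by simp
  have lip: "cmod (\<phi> x - \<phi> y) \<le> ?L * norm (x - y)" for x y
    by (rule smooth_mean_value_bound[OF test_smooth[OF \<phi>] convex_UNIV])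
      (use M(2)[of "[i]" for i] in \<open>auto simp: pderivs_Cons\<close>)
  note rap = rapid_fourier[OF \<psi>(1)]
  define Q where "Q = (\<integral>u. (1 + norm u) ^ Suc N * cmod (fourier \<psi> u) \<partial>lborel)"
  have Q: "0 \<le> Q" unfolding Q_def by (intro integral_nonneg_AE) auto
  let ?K = "?L * (1 + R) ^ N"
  \<comment> \<open>Either both values vanish, or |x| is at most R + |s| and the weight at
    \<open>x\<close> is paid for by powers of 1 + |s|.\<close>
  have pw: "(1 + norm x) ^ N * cmod (\<phi> x - \<phi> (x - s)) \<le> ?K * (norm s * (1 + norm s) ^ N)" for x s
  proof (cases "R + norm s < norm x")
    case True
    have "norm x \<le> norm (x - s) + norm s" using norm_triangle_ineq[of "x - s" s] by simp
    with True have "R < norm (x - s)" "R < norm x" using norm_ge_zero[of s] by linarith+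
    then have "\<phi> x = 0" "\<phi> (x - s) = 0" by (auto intro: R(2))
    then show ?thesis using L R(1) by simp
  next
    case False
    have "(1 + R) * (1 + norm s) = 1 + R + norm s + R * norm s" by (simp add: algebra_simps)
    moreover have "0 \<le> R * norm s" using R(1) by simp
    ultimately have "1 + norm x \<le> (1 + R) * (1 + norm s)" using False by linarith
    then have "(1 + norm x) ^ N \<le> ((1 + R) * (1 + norm s)) ^ N" by (intro power_mono) auto
    moreover have "cmod (\<phi> x - \<phi> (x - s)) \<le> ?L * norm s" using lip[of x "x - s"] by simp
    ultimately have "(1 + norm x) ^ N * cmod (\<phi> x - \<phi> (x - s)) \<le> ((1 + R) * (1 + norm s)) ^ N * (?L * norm s)"
      using R(1) by (intro mult_mono) auto
    then show ?thesis by (simp add: power_mult_distrib mult_ac)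
  qed
  show thesis
  proof (rule that[of "?K * Q + 1"])
    show "0 < ?K * Q + 1" using L M(1) Q R(1) by (intro add_nonneg_pos mult_nonneg_nonneg) auto
    fix r :: real and x :: "real^'d" assume r: "0 < r" "r \<le> 1"
    have iF: "integrable lborel (fourier \<psi>)" by (rule rapid_integrable(2)[OF rap])
    have cont: "continuous_on UNIV (\<lambda>u. \<phi> (x - r *\<^sub>R u))"
      using smooth_continuous_on[OF smooth_affine[OF test_smooth[OF \<phi>], of x "- r"]] by simp
    have i1: "integrable lborel (\<lambda>u. \<phi> (x - r *\<^sub>R u) * fourier \<psi> u)"
    proof -
      have "(\<lambda>u. \<phi> (x + (- r) *\<^sub>R u)) \<in> test_functions" using r by (intro test_affine \<phi>) simp
      from test_integrable_mult[OF this smooth_continuous_on[OF smooth_fourier[OF \<psi>(1)]]] show ?thesis by simp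
    qed
    have i2: "integrable lborel (\<lambda>u. \<phi> x * fourier \<psi> u)" using iF by simp
    have "\<phi> x - mollified (\<lambda>y. \<psi> (0 + r *\<^sub>R y)) \<phi> x
        = (\<integral>u. \<phi> x * fourier \<psi> u \<partial>lborel) - (\<integral>u. \<phi> (x - r *\<^sub>R u) * fourier \<psi> u \<partial>lborel)"
      unfolding mollified_convolution[OF \<psi>(1) \<phi> r(1)] using \<psi>(2) by simp
    also have "\<dots> = (\<integral>u. (\<phi> x - \<phi> (x - r *\<^sub>R u)) * fourier \<psi> u \<partial>lborel)"
      unfolding Bochner_Integration.integral_diff[OF i2 i1, symmetric] by (simp add: algebra_simps)
    finally have eq: "\<phi> x - mollified (\<lambda>y. \<psi> (0 + r *\<^sub>R y)) \<phi> x
        = (\<integral>u. (\<phi> x - \<phi> (x - r *\<^sub>R u)) * fourier \<psi> u \<partial>lborel)" .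
    have i3: "integrable lborel (\<lambda>u. (\<phi> x - \<phi> (x - r *\<^sub>R u)) * fourier \<psi> u)"
      using Bochner_Integration.integrable_diff[OF i2 i1] by (simp add: algebra_simps)
    have "(1 + norm x) ^ N * cmod (\<integral>u. (\<phi> x - \<phi> (x - r *\<^sub>R u)) * fourier \<psi> u \<partial>lborel)
        \<le> (1 + norm x) ^ N * (\<integral>u. cmod ((\<phi> x - \<phi> (x - r *\<^sub>R u)) * fourier \<psi> u) \<partial>lborel)"
      by (intro mult_left_mono integral_norm_bound) auto
    also have "\<dots> = (\<integral>u. (1 + norm x) ^ N * cmod ((\<phi> x - \<phi> (x - r *\<^sub>R u)) * fourier \<psi> u) \<partial>lborel)"
      by simp
    also have "\<dots> \<le> (\<integral>u. (?K * r) * ((1 + norm u) ^ Suc N * cmod (fourier \<psi> u)) \<partial>lborel)"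
    proof (rule integral_mono)
      show "integrable lborel (\<lambda>u. (1 + norm x) ^ N * cmod ((\<phi> x - \<phi> (x - r *\<^sub>R u)) * fourier \<psi> u))"
        using integrable_norm[OF i3] by (intro integrable_mult_right)
      show "integrable lborel (\<lambda>u. (?K * r) * ((1 + norm u) ^ Suc N * cmod (fourier \<psi> u)))"
        by (intro integrable_mult_right rapid_integrable(1)[OF rap])
      fix u :: "real^'d"
      have "(1 + norm x) ^ N * cmod (\<phi> x - \<phi> (x - r *\<^sub>R u)) \<le> ?K * (norm (r *\<^sub>R u) * (1 + norm (r *\<^sub>R u)) ^ N)"
        by (rule pw)
      also have "\<dots> \<le> ?K * ((r * (1 + norm u)) * (1 + norm u) ^ N)"
      proof (intro mult_left_mono mult_mono power_mono)
        show "norm (r *\<^sub>R u) \<le> r * (1 + norm u)" using r by simp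
        have "r * norm u \<le> 1 * norm u" using r by (intro mult_right_mono) auto
        then show "1 + norm (r *\<^sub>R u) \<le> 1 + norm u" using r by simp
      qed (use r L R(1) in auto)
      finally have "(1 + norm x) ^ N * cmod (\<phi> x - \<phi> (x - r *\<^sub>R u)) \<le> (?K * r) * (1 + norm u) ^ Suc N"
        by (simp add: mult_ac)
      then have "((1 + norm x) ^ N * cmod (\<phi> x - \<phi> (x - r *\<^sub>R u))) * cmod (fourier \<psi> u)
          \<le> ((?K * r) * (1 + norm u) ^ Suc N) * cmod (fourier \<psi> u)" by (intro mult_right_mono) auto
      then show "(1 + norm x) ^ N * cmod ((\<phi> x - \<phi> (x - r *\<^sub>R u)) * fourier \<psi> u)
          \<le> (?K * r) * ((1 + norm u) ^ Suc N * cmod (fourier \<psi> u))"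
        unfolding norm_mult by (simp only: mult.assoc)
    qed
    also have "\<dots> = (?K * r) * Q" unfolding Q_def by (rule integral_mult_right_zero)
    also have "\<dots> \<le> (?K * Q + 1) * r" using r by (simp add: algebra_simps)
    finally have "(1 + norm x) ^ N * cmod (\<phi> x - mollified (\<lambda>y. \<psi> (0 + r *\<^sub>R y)) \<phi> x) \<le> (?K * Q + 1) * r"
      unfolding eq .
    moreover have "0 < (1 + norm x) ^ N" by (intro zero_less_power add_pos_nonneg) auto
    ultimately show "cmod (\<phi> x - mollified (\<lambda>y. \<psi> (0 + r *\<^sub>R y)) \<phi> x) \<le> (?K * Q + 1) * r / (1 + norm x) ^ N"
      by (simp add: pos_le_divide_eq mult.commute)
  qed
qed

text \<open>Mollification commutes with derivatives, so finitely many derivatives are approximated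
  at once with a single \<open>r\<close>.\<close>

lemma fourier_test_dense:
  fixes \<phi> :: "real^'d::finite \<Rightarrow> complex"
  assumes \<phi>: "\<phi> \<in> test_functions" and \<delta>: "0 < \<delta>"
  obtains \<xi> where "\<xi> \<in> test_functions" "\<And>is x. length is \<le> m \<Longrightarrow>
    cmod (pderivs is \<phi> x - pderivs is (fourier \<xi>) x) \<le> \<delta> / (1 + norm x) ^ N"
proof -
  obtain \<psi> :: "real^'d \<Rightarrow> complex" where \<psi>: "\<psi> \<in> test_functions" "(\<integral>x. fourier \<psi> x \<partial>lborel) = 1"
    by (rule exists_mean_one_fourier)
  have "\<exists>K>0. \<forall>r x. 0 < r \<longrightarrow> r \<le> 1 \<longrightarrow>
    cmod (pderivs is \<phi> x - mollified (\<lambda>y. \<psi> (0 + r *\<^sub>R y)) (pderivs is \<phi>) x) \<le> K * r / (1 + norm x) ^ N" for "is"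
  proof (rule mollified_approx[OF \<psi> test_pderivs[OF \<phi>, of "is"], where N = N], goal_cases)
    case (1 K)
    then show ?case by (intro exI[of _ K]) simp
  qed
  then obtain K where K: "\<And>is. 0 < K is" "\<And>is r x. 0 < r \<Longrightarrow> r \<le> 1 \<Longrightarrow>
    cmod (pderivs is \<phi> x - mollified (\<lambda>y. \<psi> (0 + r *\<^sub>R y)) (pderivs is \<phi>) x) \<le> K is * r / (1 + norm x) ^ N"
    by metis
  define K0 where "K0 = 1 + (\<Sum>is\<in>{is. length is \<le> m}. K is)"
  have K0: "0 < K0" unfolding K0_def using K(1) by (intro add_pos_nonneg sum_nonneg) (auto intro: less_imp_le)
  define r where "r = min 1 (\<delta> / K0)"
  have r: "0 < r" "r \<le> 1" "r \<le> \<delta> / K0" using \<delta> K0 by (auto simp: r_def)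
  let ?\<psi> = "\<lambda>y. \<psi> (0 + r *\<^sub>R y)"
  have t: "?\<psi> \<in> test_functions" using r by (intro test_affine \<psi>) simp
  show thesis
  proof (rule that[of "\<lambda>y. ?\<psi> y * fourier \<phi> (0 + (-1) *\<^sub>R y)"])
    show "(\<lambda>y. ?\<psi> y * fourier \<phi> (0 + (-1) *\<^sub>R y)) \<in> test_functions" by (rule test_mollifier[OF t \<phi>])
    fix "is" :: "'d list" and x assume l: "length is \<le> m"
    have "pderivs is (fourier (\<lambda>y. ?\<psi> y * fourier \<phi> (0 + (-1) *\<^sub>R y))) = mollified ?\<psi> (pderivs is \<phi>)"
      using pderivs_mollified[OF t \<phi>, of "is"] unfolding mollified_def .
    moreover have "cmod (pderivs is \<phi> x - mollified ?\<psi> (pderivs is \<phi>) x) \<le> K is * r / (1 + norm x) ^ N"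
      by (rule K(2)[OF r(1,2)])
    moreover have "K is * r / (1 + norm x) ^ N \<le> \<delta> / (1 + norm x) ^ N"
    proof (rule divide_right_mono)
      have "K is \<le> (\<Sum>is\<in>{is. length is \<le> m}. K is)"
        using finite_lists_le l K(1) by (intro member_le_sum) (auto intro: less_imp_le)
      then have "K is * r \<le> K0 * r" using r unfolding K0_def by (intro mult_right_mono) auto
      also have "\<dots> \<le> \<delta>" using r(3) K0 by (simp add: pos_le_divide_eq mult.commute)
      finally show "K is * r \<le> \<delta>" .
    qed simp
    ultimately show "cmod (pderivs is \<phi> x - pderivs is (fourier (\<lambda>y. ?\<psi> y * fourier \<phi> (0 + (-1) *\<^sub>R y))) x)
        \<le> \<delta> / (1 + norm x) ^ N" by simp
  qed
qed

text \<open>The distance from \<open>\<phi>\<close> to some transform is made small in exactly the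
  norm that \<open>translation_bounded\<close> controls. Centring the weight at \<open>t\<close>
  makes the error uniform in \<open>t\<close>, while translates of the transform pair to a
  trigonometric polynomial.\<close>

lemma almost_periodic_approx:
  fixes f :: "(real^'d::finite \<Rightarrow> complex) \<Rightarrow> complex"
  assumes f: "tempered_distribution f" and tb: "translation_bounded f m C"
    and d: "discrete_set (dist_supp (dist_fourier f))" and \<phi>: "\<phi> \<in> test_functions" and \<delta>: "0 < \<delta>"
  obtains W c where "finite W" "\<And>t. cmod (f (\<lambda>x. \<phi> (x - t)) - (\<Sum>\<gamma>\<in>W. c \<gamma> * character \<gamma> t)) \<le> \<delta>"
proof -
  have C: "0 < C" using tb by (simp add: translation_bounded_def)
  have "0 < \<delta> / C" using \<delta> C by simp
  obtain \<xi> where \<xi>: "\<xi> \<in> test_functions" "\<And>is x. length is \<le> m \<Longrightarrow>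
    cmod (pderivs is \<phi> x - pderivs is (fourier \<xi>) x) \<le> (\<delta> / C) / (1 + norm x) ^ (CARD('d) + 2)"
    by (rule fourier_test_dense[OF \<phi> \<open>0 < \<delta> / C\<close>, where m = m and N = "CARD('d) + 2"]) blast
  obtain W c where W: "finite W" "\<And>t. dist_fourier f (\<lambda>x. \<xi> x * character t x) = (\<Sum>\<gamma>\<in>W. c \<gamma> * character \<gamma> t)"
    by (rule dist_fourier_mult_character[OF f tb d \<xi>(1)]) blast
  show thesis
  proof (rule that[OF W(1)])
    fix t
    have r: "rapid (\<lambda>x. \<phi> (x - t))" "rapid (\<lambda>x. fourier \<xi> (x - t))"
      by (intro rapid_shift test_rapid rapid_fourier \<phi> \<xi>)+
    have s: "smooth \<phi>" "smooth (fourier \<xi>)" by (intro test_smooth smooth_fourier \<phi> \<xi>)+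
    have "cmod (f (\<lambda>x. \<phi> (x - t) - fourier \<xi> (x - t))) \<le> C * (\<delta> / C) / 1 ^ CARD('d)"
    proof (rule translation_boundedD[OF tb rapid_diff[OF r], where t = t])
      fix "is" :: "'d list" and x assume l: "length is \<le> m"
      show "cmod (pderivs is (\<lambda>x. \<phi> (x - t) - fourier \<xi> (x - t)) x) \<le> \<delta> / C / (1 + 1 * norm (x - t)) ^ (CARD('d) + 2)"
        using \<xi>(2)[OF l, of "x - t"]
        by (simp only: pderivs_diff[OF r[THEN rapid_smooth]] pderivs_shift[OF s(1)] pderivs_shift[OF s(2)] mult_1_left)
    qed (use \<delta> C in auto)
    moreover have "f (\<lambda>x. fourier \<xi> (x - t)) = (\<Sum>\<gamma>\<in>W. c \<gamma> * character \<gamma> t)"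
      using W(2)[of t] by (simp add: dist_fourier_def fourier_mult_character)
    ultimately show "cmod (f (\<lambda>x. \<phi> (x - t)) - (\<Sum>\<gamma>\<in>W. c \<gamma> * character \<gamma> t)) \<le> \<delta>"
      using C by (simp add: tempered_diff[OF f r])
  qed
qed

subsection \<open>Common almost periods\<close>

text \<open>Two fractional parts in the same cell of length 1/M differ by at most 1/M, and integer
  parts do not affect the character.\<close>

lemma character_near_1:
  assumes "0 < M" "\<lfloor>real M * frac (\<gamma> \<bullet> x)\<rfloor> = \<lfloor>real M * frac (\<gamma> \<bullet> s)\<rfloor>"
  shows "cmod (character \<gamma> (x - s) - 1) \<le> 2 * pi / real M"
proof -
  define \<theta> where "\<theta> = frac (\<gamma> \<bullet> x) - frac (\<gamma> \<bullet> s)"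
  have "\<bar>real M * frac (\<gamma> \<bullet> x) - real M * frac (\<gamma> \<bullet> s)\<bar> \<le> 1"
    using assms(2) by linarith
  then have "real M * \<bar>\<theta>\<bar> \<le> 1" unfolding \<theta>_def by (simp add: abs_mult right_diff_distrib[symmetric])
  then have \<theta>: "\<bar>\<theta>\<bar> \<le> 1 / real M" using assms(1) by (simp add: pos_le_divide_eq mult.commute)
  define n where "n = \<lfloor>\<gamma> \<bullet> x\<rfloor> - \<lfloor>\<gamma> \<bullet> s\<rfloor>"
  have inner: "\<gamma> \<bullet> (x - s) = \<theta> + of_int n"
    by (simp add: \<theta>_def n_def frac_def inner_diff_right)
  have "2 * of_real pi * \<i> * of_real (\<gamma> \<bullet> (x - s)) = \<i> * of_real (2 * pi * \<theta>) + 2 * of_int n * of_real pi * \<i>"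
    unfolding inner by (simp add: algebra_simps)
  then have "character \<gamma> (x - s) = exp (\<i> * of_real (2 * pi * \<theta>)) * exp (2 * of_int n * of_real pi * \<i>)"
    unfolding character_def by (simp only: exp_add)
  also have "exp (2 * of_int n * of_real pi * \<i>) = 1"
    using exp_integer_2pi[of "of_int n"] by simp
  finally have "cmod (character \<gamma> (x - s) - 1) \<le> \<bar>2 * pi * \<theta>\<bar>"
    using norm_exp_i_minus_1_le[of "2 * pi * \<theta>"] by simp
  also have "\<dots> = 2 * pi * \<bar>\<theta>\<bar>" by (simp add: abs_mult)
  also have "\<dots> \<le> 2 * pi * (1 / real M)" using \<theta> by (intro mult_left_mono) auto
  finally show ?thesis by simp
qed

text \<open>Pigeonhole: \<open>x\<close> is sorted by the cells of the fractional parts of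
  \<open>\<gamma> \<bullet> x\<close>, only finitely many patterns occur, and subtracting a fixed
  representative of its pattern from \<open>x\<close> gives an almost period at bounded
  distance.\<close>

lemma common_almost_periods:
  fixes W :: "(real^'d::finite) set"
  assumes "finite W" "0 < \<delta>"
  obtains R where "\<And>x. \<exists>\<tau>. dist x \<tau> \<le> R \<and> (\<forall>\<gamma>\<in>W. cmod (character \<gamma> \<tau> - 1) \<le> \<delta>)"
proof -
  obtain M :: nat where M: "2 * pi / \<delta> < real M" using reals_Archimedean2 by blast
  have M0: "0 < M"
  proof -
    have "0 < 2 * pi / \<delta>" using assms(2) by simp
    with M have "0 < real M" by linarith
    then show ?thesis by simp
  qed
  have M\<delta>: "2 * pi / real M \<le> \<delta>" using M assms(2) M0 by (simp add: field_simps)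
  \<comment> \<open>The value 0 off \<open>W\<close> makes the set of patterns finite although
    \<open>h x\<close> is a function on the whole space.\<close>
  define h where "h = (\<lambda>x \<gamma>. if \<gamma> \<in> W then \<lfloor>real M * frac (\<gamma> \<bullet> x)\<rfloor> else (0::int))"
  have "range h \<subseteq> {g. \<forall>\<gamma>. (\<gamma> \<in> W \<longrightarrow> g \<gamma> \<in> {0..int M}) \<and> (\<gamma> \<notin> W \<longrightarrow> g \<gamma> = 0)}"
  proof
    fix g assume "g \<in> range h"
    then obtain x where g: "g = h x" by blast
    have "0 \<le> \<lfloor>real M * frac (\<gamma> \<bullet> x)\<rfloor> \<and> \<lfloor>real M * frac (\<gamma> \<bullet> x)\<rfloor> \<le> int M" for \<gamma>
    proof -
      have "real M * frac (\<gamma> \<bullet> x) \<le> real M * 1"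
        using frac_lt_1[of "\<gamma> \<bullet> x"] by (intro mult_left_mono) auto
      moreover have "0 \<le> real M * frac (\<gamma> \<bullet> x)" by simp
      ultimately show ?thesis by linarith
    qed
    then show "g \<in> {g. \<forall>\<gamma>. (\<gamma> \<in> W \<longrightarrow> g \<gamma> \<in> {0..int M}) \<and> (\<gamma> \<notin> W \<longrightarrow> g \<gamma> = 0)}"
      by (auto simp: g h_def)
  qed
  then have fin: "finite (range h)"
    by (rule finite_subset) (intro finite_set_of_finite_funs assms finite_atLeastAtMost_int)
  define S where "S = inv h ` range h"
  have "finite S" unfolding S_def by (rule finite_imageI[OF fin])
  then obtain R where R: "\<And>s. s \<in> S \<Longrightarrow> norm s \<le> R"
    using finite_imp_bounded[of S] unfolding bounded_iff by blast
  show thesis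
  proof (rule that[of R])
    fix x
    define s where "s = inv h (h x)"
    have hs: "h s = h x" unfolding s_def by (rule f_inv_into_f) simp
    have "s \<in> S" unfolding S_def s_def by blast
    have "cmod (character \<gamma> (x - s) - 1) \<le> \<delta>" if "\<gamma> \<in> W" for \<gamma>
    proof -
      have "h s \<gamma> = h x \<gamma>" by (simp add: hs)
      then have "\<lfloor>real M * frac (\<gamma> \<bullet> x)\<rfloor> = \<lfloor>real M * frac (\<gamma> \<bullet> s)\<rfloor>" using that by (simp add: h_def)
      from character_near_1[OF M0 this] M\<delta> show ?thesis by linarith
    qed
    moreover have "dist x (x - s) \<le> R" using R[OF \<open>s \<in> S\<close>] by (simp add: dist_norm)
    ultimately show "\<exists>\<tau>. dist x \<tau> \<le> R \<and> (\<forall>\<gamma>\<in>W. cmod (character \<gamma> \<tau> - 1) \<le> \<delta>)" by blast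
  qed
qed

lemma character_uminus_near_1: "cmod (character \<gamma> (- \<tau>) - 1) = cmod (character \<gamma> \<tau> - 1)"
proof -
  have "character \<gamma> (- \<tau>) = cnj (character \<gamma> \<tau>)" by (simp add: character_def exp_cnj)
  then have "character \<gamma> (- \<tau>) - 1 = cnj (character \<gamma> \<tau> - 1)" by simp
  then show ?thesis by (simp only: complex_mod_cnj)
qed

text \<open>The approximation error is spent twice and the change of the polynomial once, each at
  most c/4, which leaves a strict inequality.\<close>

lemma almost_periods_of_pairing:
  fixes f :: "(real^'d::finite \<Rightarrow> complex) \<Rightarrow> complex"
  assumes f: "tempered_distribution f" and tb: "translation_bounded f m C"
    and d: "discrete_set (dist_supp (dist_fourier f))" and \<phi>: "\<phi> \<in> test_functions" and c: "0 < c"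
  shows "\<exists>W \<delta>. finite W \<and> 0 < \<delta> \<and> (\<forall>\<tau> t. (\<forall>\<gamma>\<in>W. cmod (character \<gamma> \<tau> - 1) \<le> \<delta>) \<longrightarrow>
    cmod (f (\<lambda>x. \<phi> (x - (t + \<tau>))) - f (\<lambda>x. \<phi> (x - t))) < c)"
proof -
  have "0 < c / 4" using c by simp
  obtain W b where W: "finite W" "\<And>t. cmod (f (\<lambda>x. \<phi> (x - t)) - (\<Sum>\<gamma>\<in>W. b \<gamma> * character \<gamma> t)) \<le> c / 4"
    by (rule almost_periodic_approx[OF f tb d \<phi> \<open>0 < c / 4\<close>]) blast
  define \<delta> where "\<delta> = c / 4 / (1 + (\<Sum>\<gamma>\<in>W. cmod (b \<gamma>)))"
  have pos: "0 < 1 + (\<Sum>\<gamma>\<in>W. cmod (b \<gamma>))" by (intro add_pos_nonneg sum_nonneg) auto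
  have \<delta>: "0 < \<delta>" unfolding \<delta>_def using c pos by simp
  show ?thesis
  proof (intro exI conjI allI impI)
    fix \<tau> t assume \<tau>: "\<forall>\<gamma>\<in>W. cmod (character \<gamma> \<tau> - 1) \<le> \<delta>"
    let ?g = "\<lambda>t. f (\<lambda>x. \<phi> (x - t))" and ?s = "\<lambda>t. \<Sum>\<gamma>\<in>W. b \<gamma> * character \<gamma> t"
    have "?s (t + \<tau>) - ?s t = (\<Sum>\<gamma>\<in>W. b \<gamma> * character \<gamma> t * (character \<gamma> \<tau> - 1))"
    proof -
      have "character \<gamma> (t + \<tau>) = character \<gamma> t * character \<gamma> \<tau>" for \<gamma>
        by (metis character_add character_commute)
      then show ?thesis by (simp add: sum_subtractf[symmetric] algebra_simps)
    qed
    also have "cmod \<dots> \<le> (\<Sum>\<gamma>\<in>W. cmod (b \<gamma>) * \<delta>)"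
      using \<tau> by (intro sum_norm_le) (auto simp: norm_mult intro: mult_left_mono)
    also have "\<dots> \<le> \<delta> * (1 + (\<Sum>\<gamma>\<in>W. cmod (b \<gamma>)))"
      using \<delta> by (simp add: sum_distrib_left algebra_simps)
    also have "\<dots> = c / 4" unfolding \<delta>_def using pos by (metis less_irrefl nonzero_eq_divide_eq)
    finally have s: "cmod (?s (t + \<tau>) - ?s t) \<le> c / 4" .
    have tri: "cmod (X + Y - Z) \<le> cmod X + cmod Y + cmod Z" for X Y Z
      using norm_triangle_ineq4[of "X + Y" Z] norm_triangle_ineq[of X Y] by linarith
    have eq: "?g (t + \<tau>) - ?g t = (?g (t + \<tau>) - ?s (t + \<tau>)) + (?s (t + \<tau>) - ?s t) - (?g t - ?s t)" by simp
    have "cmod (?g (t + \<tau>) - ?g t) \<le> cmod (?g (t + \<tau>) - ?s (t + \<tau>)) + cmod (?s (t + \<tau>) - ?s t) + cmod (?g t - ?s t)"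
      unfolding eq by (rule tri)
    then show "cmod (?g (t + \<tau>) - ?g t) < c" using s W(2)[of "t + \<tau>"] W(2)[of t] c by linarith
  qed (use W \<delta> in auto)
qed

text \<open>At a support point some scaled jet has a pairing of modulus at least \<open>c\<close>.
  An almost period changes it by less than \<open>c\<close>, so the translated pairing is nonzero
  and the translated jet must touch the support.\<close>

lemma almost_periods_of_support:
  fixes f :: "(real^'d::finite \<Rightarrow> complex) \<Rightarrow> complex"
  assumes f: "tempered_distribution f" and e: "dirac_expansion f m p" and tb: "translation_bounded f m C"
    and d: "discrete_set (dist_supp (dist_fourier f))"
    and c: "0 < c" "\<And>a. a \<in> dist_supp f \<Longrightarrow> \<exists>k. mi_abs k \<le> m \<and> c \<le> cmod (p a k)"
    and s: "\<And>a b. a \<in> dist_supp f \<Longrightarrow> b \<in> dist_supp f \<Longrightarrow> a \<noteq> b \<Longrightarrow> \<epsilon> < dist a b" and \<epsilon>: "0 < \<epsilon>"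
  shows "\<exists>W \<delta>. finite W \<and> 0 < \<delta> \<and> (\<forall>\<tau> a. (\<forall>\<gamma>\<in>W. cmod (character \<gamma> \<tau> - 1) \<le> \<delta>) \<longrightarrow> a \<in> dist_supp f \<longrightarrow>
    (\<exists>b\<in>dist_supp f. dist (a + \<tau>) b \<le> \<epsilon>))"
proof -
  \<comment> \<open>Makes the support radius of the scaled jet equal to
    \<open>\<epsilon>\<close>.\<close>
  define q where "q = \<epsilon> / (2 * real CARD('d))"
  have q: "0 < q" "2 * real CARD('d) * q = \<epsilon>" using \<epsilon> by (simp_all add: q_def)
  let ?K = "{k :: 'd \<Rightarrow> nat. mi_abs k \<le> m}"
  have "\<exists>W \<delta>. finite W \<and> 0 < \<delta> \<and> (\<forall>\<tau> t. (\<forall>\<gamma>\<in>W. cmod (character \<gamma> \<tau> - 1) \<le> \<delta>) \<longrightarrow>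
    cmod (f (\<lambda>x. scaled_jet k q (x - (t + \<tau>))) - f (\<lambda>x. scaled_jet k q (x - t))) < c)" for k
    by (rule almost_periods_of_pairing[OF f tb d test_scaled_jet[OF q(1)] c(1)])
  then obtain W \<delta> where W: "\<And>k. finite (W k)" "\<And>k. 0 < \<delta> k" "\<And>k \<tau> t. \<forall>\<gamma>\<in>W k. cmod (character \<gamma> \<tau> - 1) \<le> \<delta> k \<Longrightarrow>
    cmod (f (\<lambda>x. scaled_jet k q (x - (t + \<tau>))) - f (\<lambda>x. scaled_jet k q (x - t))) < c" by metis
  have fK: "finite (\<delta> ` ?K)" "\<delta> ` ?K \<noteq> {}"
  proof -
    show "finite (\<delta> ` ?K)" by (intro finite_imageI finite_mi_abs_le)
    have "(\<lambda>_. 0) \<in> ?K" by (simp add: mi_abs_def)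
    then show "\<delta> ` ?K \<noteq> {}" by blast
  qed
  show ?thesis
  proof (intro exI conjI allI impI)
    \<comment> \<open>The multi-index \<open>k\<close> depends on the point \<open>a\<close>, so the
      conditions for all admissible \<open>k\<close> are imposed together.\<close>
    show "finite (\<Union>k\<in>?K. W k)" by (intro finite_UN_I finite_mi_abs_le W)
    show "0 < Min (\<delta> ` ?K)" using fK W(2) by (simp add: Min_gr_iff)
    fix \<tau> a assume \<tau>: "\<forall>\<gamma>\<in>(\<Union>k\<in>?K. W k). cmod (character \<gamma> \<tau> - 1) \<le> Min (\<delta> ` ?K)" and a: "a \<in> dist_supp f"
    obtain k where k: "mi_abs k \<le> m" "c \<le> cmod (p a k)" using c(2)[OF a] by blast
    have le: "Min (\<delta> ` ?K) \<le> \<delta> k" using fK k(1) by (intro Min_le) auto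
    have "\<forall>\<gamma>\<in>W k. cmod (character \<gamma> \<tau> - 1) \<le> \<delta> k"
    proof
      fix \<gamma> assume "\<gamma> \<in> W k"
      then have "\<gamma> \<in> (\<Union>k\<in>?K. W k)" using k(1) by blast
      from bspec[OF \<tau> this] le show "cmod (character \<gamma> \<tau> - 1) \<le> \<delta> k" by (rule order_trans)
    qed
    from W(3)[OF this, of a]
    have "cmod (f (\<lambda>x. scaled_jet k q (x - (a + \<tau>))) - f (\<lambda>x. scaled_jet k q (x - a))) < c" .
    moreover have "cmod (f (\<lambda>x. scaled_jet k q (x - a))) = cmod (p a k)"
    proof (rule coeff_eq_scaled_jet[OF e a k(1) q(1)])
      fix b assume b: "b \<in> dist_supp f" "dist a b \<le> 2 * real CARD('d) * q"
      show "b = a" using s[OF a b(1)] b(2) unfolding q(2) by (cases "a = b") auto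
    qed
    ultimately have "f (\<lambda>x. scaled_jet k q (x - (a + \<tau>))) \<noteq> 0" using k(2) by auto
    then show "\<exists>b\<in>dist_supp f. dist (a + \<tau>) b \<le> \<epsilon>"
    proof (rule meets_support_if_nonzero[OF tempered_lin_on_test[OF f] _ q(1)])
      fix b assume "b \<in> dist_supp f" "dist (a + \<tau>) b \<le> 2 * real CARD('d) * q"
      then show ?thesis unfolding q(2) by blast
    qed
  qed
qed

subsection \<open>From almost periods to periods\<close>

lemma finite_gap:
  fixes S :: "'a::metric_space set"
  assumes "finite S"
  obtains \<eta> where "0 < \<eta>" "\<And>u v. u \<in> S \<Longrightarrow> v \<in> S \<Longrightarrow> u \<noteq> v \<Longrightarrow> \<eta> \<le> dist u v"
proof -
  \<comment> \<open>The element 1 keeps the minimum defined when \<open>S\<close> has at most one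
    point.\<close>
  let ?D = "insert 1 ((\<lambda>(u, v). dist u v) ` {p \<in> S \<times> S. fst p \<noteq> snd p})"
  have "finite {p \<in> S \<times> S. fst p \<noteq> snd p}" by (rule finite_Collect_conjI) (simp add: assms)
  then have f: "finite ?D" by (intro finite.insertI finite_imageI)
  show thesis
  proof (rule that[of "Min ?D"])
    have "Min ?D \<in> ?D" by (rule Min_in[OF f]) simp
    then show "0 < Min ?D" by auto
    fix u v assume "u \<in> S" "v \<in> S" "u \<noteq> v"
    then have "dist u v \<in> ?D" by (intro insertI2 image_eqI[where x = "(u, v)"]) auto
    then show "Min ?D \<le> dist u v" by (rule Min_le[OF f])
  qed
qed

text \<open>Two points of \<open>A\<close> at distance below 1 lie near a common point of
  \<open>B\<close>, so both differences belong to a finite part of the discrete difference set,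
  where distinct elements have a positive gap.\<close>

lemma separated_if_differences_discrete:
  fixes A B :: "(real^'d::finite) set"
  assumes "discrete_set {a - b | a b. a \<in> A \<and> b \<in> B}" "relatively_dense B"
  obtains s where "0 < s" "\<And>a a'. a \<in> A \<Longrightarrow> a' \<in> A \<Longrightarrow> a \<noteq> a' \<Longrightarrow> s \<le> dist a a'"
proof -
  obtain R where R: "\<And>x. ball x R \<inter> B \<noteq> {}" using assms(2) unfolding relatively_dense_def by blast
  let ?S = "{a - b | a b. a \<in> A \<and> b \<in> B} \<inter> cball 0 (R + 1)"
  obtain \<eta> where \<eta>: "0 < \<eta>" "\<And>u v. u \<in> ?S \<Longrightarrow> v \<in> ?S \<Longrightarrow> u \<noteq> v \<Longrightarrow> \<eta> \<le> dist u v"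
    by (rule finite_gap[OF discrete_set_finite_Int[OF assms(1) bounded_cball[of 0 "R + 1"]]]) blast
  show thesis
  proof (rule that[of "min 1 \<eta>"])
    show "0 < min 1 \<eta>" using \<eta>(1) by simp
    fix a a' assume a: "a \<in> A" "a' \<in> A" "a \<noteq> a'"
    show "min 1 \<eta> \<le> dist a a'"
    proof (cases "dist a a' < 1")
      case True
      obtain b where b: "b \<in> B" "dist a b < R" using R[of a] by auto
      have "dist a' b \<le> dist a' a + dist a b" by (rule dist_triangle)
      then have "a - b \<in> ?S" "a' - b \<in> ?S" using a b True by (auto simp: dist_norm[symmetric] dist_commute)
      moreover have "a - b \<noteq> a' - b" using a(3) by simp
      ultimately have "\<eta> \<le> dist (a - b) (a' - b)" by (rule \<eta>(2))
      then show ?thesis by (simp add: dist_norm)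
    qed simp
  qed
qed

text \<open>For close \<open>a\<close> and \<open>b\<close> the differences before and after the
  shift are at most 2\<epsilon> apart, hence coincide by the gap; so the corrections of
  \<open>a\<close> and \<open>b\<close> agree. Local agreement spreads to all points through
  connectedness of the space.\<close>

lemma common_period_near_almost_period:
  fixes A B :: "(real^'d::finite) set"
  assumes R: "\<And>x. ball x R \<inter> A \<noteq> {}" "\<And>x. ball x R \<inter> B \<noteq> {}"
    and gap: "\<And>u v. u \<in> {a - b | a b. a \<in> A \<and> b \<in> B} \<Longrightarrow> v \<in> {a - b | a b. a \<in> A \<and> b \<in> B} \<Longrightarrow>
      norm u \<le> 4 * R + 2 \<Longrightarrow> norm v \<le> 4 * R + 2 \<Longrightarrow> u \<noteq> v \<Longrightarrow> 2 * \<epsilon> < dist u v"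
    and \<epsilon>: "0 < \<epsilon>" "\<epsilon> \<le> 1"
    and A: "\<And>a. a \<in> A \<Longrightarrow> \<exists>b\<in>A. dist (a + \<tau>) b \<le> \<epsilon>" and B: "\<And>a. a \<in> B \<Longrightarrow> \<exists>b\<in>B. dist (a + \<tau>) b \<le> \<epsilon>"
  obtains v where "dist \<tau> v \<le> \<epsilon>" "\<And>a. a \<in> A \<Longrightarrow> a + v \<in> A" "\<And>b. b \<in> B \<Longrightarrow> b + v \<in> B"
proof -
  have "\<exists>e. a \<in> A \<longrightarrow> a + \<tau> + e \<in> A \<and> norm e \<le> \<epsilon>" for a
  proof (cases "a \<in> A")
    case True
    then obtain b where b: "b \<in> A" "dist (a + \<tau>) b \<le> \<epsilon>" using A by blast
    then show ?thesis
      by (intro exI[of _ "b - (a + \<tau>)"]) (simp add: dist_norm norm_minus_commute)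
  qed simp
  then obtain e1 where e1: "\<And>a. a \<in> A \<Longrightarrow> a + \<tau> + e1 a \<in> A" "\<And>a. a \<in> A \<Longrightarrow> norm (e1 a) \<le> \<epsilon>" by metis
  have "\<exists>e. a \<in> B \<longrightarrow> a + \<tau> + e \<in> B \<and> norm e \<le> \<epsilon>" for a
  proof (cases "a \<in> B")
    case True
    then obtain b where b: "b \<in> B" "dist (a + \<tau>) b \<le> \<epsilon>" using B by blast
    then show ?thesis
      by (intro exI[of _ "b - (a + \<tau>)"]) (simp add: dist_norm norm_minus_commute)
  qed simp
  then obtain e2 where e2: "\<And>a. a \<in> B \<Longrightarrow> a + \<tau> + e2 a \<in> B" "\<And>a. a \<in> B \<Longrightarrow> norm (e2 a) \<le> \<epsilon>" by metis
  \<comment> \<open>The distance bound 4 R plus an error of at most 2 is the radius in the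
    assumption on the gap.\<close>
  have e12: "e1 a = e2 b" if ab: "a \<in> A" "b \<in> B" "dist a b < 4 * R" for a b
  proof (rule ccontr)
    assume ne: "e1 a \<noteq> e2 b"
    let ?u = "a - b" and ?v = "(a + \<tau> + e1 a) - (b + \<tau> + e2 b)"
    have v: "?v = ?u + (e1 a - e2 b)" by simp
    have n: "norm (e1 a - e2 b) \<le> 2 * \<epsilon>"
      using norm_triangle_ineq4[of "e1 a" "e2 b"] e1(2)[OF ab(1)] e2(2)[OF ab(2)] by linarith
    have "2 * \<epsilon> < dist ?u ?v"
    proof (rule gap)
      show "?u \<in> {a - b | a b. a \<in> A \<and> b \<in> B}" using ab by blast
      show "?v \<in> {a - b | a b. a \<in> A \<and> b \<in> B}" using e1(1)[OF ab(1)] e2(1)[OF ab(2)] by blast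
      show "norm ?u \<le> 4 * R + 2" using ab(3) by (simp add: dist_norm)
      show "norm ?v \<le> 4 * R + 2"
        unfolding v using norm_triangle_ineq[of ?u "e1 a - e2 b"] n ab(3) \<epsilon> by (simp add: dist_norm)
      show "?u \<noteq> ?v" unfolding v using ne by simp
    qed
    also have "dist ?u ?v = norm (e1 a - e2 b)" unfolding v by (simp add: dist_norm norm_minus_commute)
    finally show False using n by simp
  qed
  \<comment> \<open>A point of \<open>B\<close> near \<open>a\<close> serves as intermediary; it is
    within 4 R of \<open>a'\<close>.\<close>
  have e11: "e1 a = e1 a'" if "a \<in> A" "a' \<in> A" "dist a a' < 3 * R" for a a'
  proof -
    obtain b where b: "b \<in> B" "dist a b < R" using R(2)[of a] by auto
    have "dist a' b \<le> dist a' a + dist a b" by (rule dist_triangle)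
    moreover have "dist a b < 4 * R" using b(2) zero_le_dist[of a b] by linarith
    ultimately have "dist a b < 4 * R" "dist a' b < 4 * R" using b(2) that(3) by (auto simp: dist_commute)
    then show ?thesis using e12 b(1) that(1,2) by metis
  qed
  \<comment> \<open>Extends \<open>e1\<close> from \<open>A\<close> to the whole space via a nearby
    point, so that connectedness becomes applicable; by \<open>e11\<close> the choice does not
    matter.\<close>
  define E where "E = (\<lambda>x. e1 (SOME a. a \<in> A \<and> dist x a < R))"
  have E: "\<exists>a. a \<in> A \<and> dist x a < R \<and> E x = e1 a" for x
  proof -
    have "\<exists>a. a \<in> A \<and> dist x a < R" using R(1)[of x] by auto
    from someI_ex[OF this] show ?thesis unfolding E_def by blast
  qed
  have "E constant_on (UNIV :: (real^'d) set)"
  proof (rule locally_constant_imp_constant[OF connected_UNIV])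
    fix x :: "real^'d"
    obtain a where a: "a \<in> A" "dist x a < R" "E x = e1 a" using E by blast
    have "E y = E x" if "y \<in> ball x R" for y
    proof -
      obtain a' where a': "a' \<in> A" "dist y a' < R" "E y = e1 a'" using E by blast
      have "dist a a' \<le> dist a x + dist x a'" "dist x a' \<le> dist x y + dist y a'" by (rule dist_triangle)+
      then have "dist a a' < 3 * R" using a(2) a'(2) that by (simp add: dist_commute)
      then show ?thesis using e11[OF a(1) a'(1)] a(3) a'(3) by simp
    qed
    then have "\<forall>y\<in>ball x R. E y = E x" by blast
    moreover have "x \<in> ball x R" using le_less_trans[OF zero_le_dist a(2)] by simp
    moreover have "openin (top_of_set UNIV) (ball x R)" by (simp only: subtopology_UNIV open_openin[symmetric] open_ball)
    ultimately show "\<exists>T. openin (top_of_set UNIV) T \<and> x \<in> T \<and> (\<forall>y\<in>T. E y = E x)"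
      by (intro exI[of _ "ball x R"] conjI)
  qed
  then obtain e where "\<forall>x\<in>UNIV. E x = e" unfolding constant_on_def by (rule exE)
  then have e: "E x = e" for x by simp
  have a1: "e1 a = e" if "a \<in> A" for a
  proof -
    obtain a' where a': "a' \<in> A" "dist a a' < R" "E a = e1 a'" using E by blast
    then have "dist a a' < 3 * R" using zero_le_dist[of a a'] by linarith
    then show ?thesis using e11[OF that a'(1)] a'(3) e by simp
  qed
  have a2: "e2 b = e" if "b \<in> B" for b
  proof -
    obtain a where a: "a \<in> A" "dist b a < R" using R(1)[of b] by auto
    then have "dist a b < 4 * R" using zero_le_dist[of b a] unfolding dist_commute[of a b] by linarith
    then show ?thesis using e12[OF a(1) that] a1[OF a(1)] by simp
  qed
  obtain a0 where a0: "a0 \<in> A" using R(1)[of 0] by auto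
  show thesis
  proof (rule that[of "\<tau> + e"])
    show "dist \<tau> (\<tau> + e) \<le> \<epsilon>" using e1(2)[OF a0] a1[OF a0] by (simp add: dist_norm)
    show "a + (\<tau> + e) \<in> A" if "a \<in> A" for a using e1(1)[OF that] a1[OF that] by (simp add: add.assoc)
    show "b + (\<tau> + e) \<in> B" if "b \<in> B" for b using e2(1)[OF that] a2[OF that] by (simp add: add.assoc)
  qed
qed

subsection \<open>Lattices of periods\<close>

text \<open>A relatively dense set cannot lie in a hyperplane, so \<open>P\<close> spans the space
  and contains a basis. Integer combinations of this basis stay in the subgroup.\<close>

lemma lattice_in_relatively_dense_subgroup:
  fixes P :: "(real^'d::finite) set"
  assumes add: "\<And>u v. u \<in> P \<Longrightarrow> v \<in> P \<Longrightarrow> u + v \<in> P" and neg: "\<And>u. u \<in> P \<Longrightarrow> - u \<in> P" and z: "0 \<in> P"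
    and R: "\<And>x. \<exists>v\<in>P. dist x v \<le> R"
  obtains T :: "real^'d \<Rightarrow> real^'d" where "linear T" "inj T" "surj T" "T ` {x. \<forall>i. x $ i \<in> \<int>} \<subseteq> P"
proof -
  have span: "span P = UNIV"
  proof (rule ccontr)
    assume "span P \<noteq> UNIV"
    then obtain a where a: "a \<noteq> 0" "\<forall>x\<in>span P. a \<bullet> x = 0" using span_not_UNIV_orthogonal by blast
    \<comment> \<open>A point at distance R + 1 from the hyperplane orthogonal to
      \<open>a\<close>.\<close>
    define x where "x = ((R + 1) / norm a) *\<^sub>R a"
    obtain v where v: "v \<in> P" "dist x v \<le> R" using R by blast
    have "a \<bullet> v = 0" using a(2) v(1) span_base by blast
    then have "a \<bullet> (x - v) = (R + 1) * norm a"
      using a(1) by (simp add: x_def inner_diff_right power2_norm_eq_inner[symmetric] power2_eq_square)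
    moreover have "a \<bullet> (x - v) \<le> norm a * R"
      using Cauchy_Schwarz_ineq2[of a "x - v"] v(2) mult_left_mono[of "norm (x - v)" R "norm a"]
      by (simp add: dist_norm)
    ultimately show False using a(1) by (simp add: algebra_simps)
  qed
  obtain B where B: "B \<subseteq> P" "independent B" "P \<subseteq> span B" "card B = dim P" by (rule basis_exists)
  have spB: "span B = UNIV" using B(3) span by (metis span_mono span_span top.extremum_uniqueI)
  have "dim P = CARD('d)" using dim_span[of P] span by simp
  then have cB: "card B = CARD('d)" using B(4) by simp
  have "finite B" using B(2) by (rule independent_imp_finite)
  then obtain g where g: "bij_betw g (UNIV :: 'd set) B"
    using finite_same_card_bij[of "UNIV :: 'd set" B] cB by auto
  have gB: "g i \<in> B" for i using bij_betw_apply[OF g] by blast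
  define T where "T = (\<lambda>x :: real^'d. \<Sum>i\<in>UNIV. (x $ i) *\<^sub>R g i)"
  have lin: "linear T"
    unfolding T_def by (intro linear_compose_sum ballI linearI) (auto simp: scaleR_add_left)
  have Tax: "T (axis i 1) = g i" for i
  proof -
    have "T (axis i 1) = (\<Sum>j\<in>UNIV. if j = i then g i else 0)"
      unfolding T_def by (intro sum.cong) (auto simp: axis_def)
    then show ?thesis by simp
  qed
  have "B \<subseteq> range T"
  proof
    fix b assume "b \<in> B"
    then obtain i where "b = g i" using bij_betw_imp_surj_on[OF g] by blast
    then show "b \<in> range T" using Tax by (metis rangeI)
  qed
  then have "span B \<subseteq> range T" by (rule span_minimal[OF _ linear_subspace_image[OF lin subspace_UNIV]])
  then have surj: "surj T" using spB by blast
  have inj: "inj T" by (rule linear_surjective_imp_injective[OF lin surj]) simp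
  have nat: "real n *\<^sub>R v \<in> P" if "v \<in> P" for n v
    by (induction n) (use z add[OF that] in \<open>auto simp: scaleR_add_left\<close>)
  have int: "of_int k *\<^sub>R v \<in> P" if "v \<in> P" for k :: int and v
  proof (cases "0 \<le> k")
    case True
    then show ?thesis using nat[OF that, of "nat k"] by simp
  next
    case False
    then show ?thesis using neg[OF nat[OF that, of "nat (- k)"]] by simp
  qed
  have "T x \<in> P" if "\<forall>i. x $ i \<in> \<int>" for x
  proof -
    have "(\<Sum>i\<in>I. (x $ i) *\<^sub>R g i) \<in> P" if "finite I" for I
      using that
    proof (induction I rule: finite_induct)
      case (insert i I)
      obtain k where "x $ i = of_int k" using \<open>\<forall>i. x $ i \<in> \<int>\<close> by (metis Ints_cases)
      then have "(x $ i) *\<^sub>R g i \<in> P" using int gB B(1) by auto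
      then show ?case using insert add by simp
    qed (simp add: z)
    then show ?thesis unfolding T_def by simp
  qed
  then show thesis using that[OF lin inj surj] by blast
qed

text \<open>Every coset of the lattice meets the image of the unit cube, and a discrete set has only
  finitely many points in that compact set. The closed cube may contain several representatives of
  one coset, which does no harm to a union.\<close>

lemma pure_crystalI:
  fixes A :: "(real^'d::finite) set" and T :: "real^'d \<Rightarrow> real^'d"
  assumes T: "linear T" "surj T" and A: "discrete_set A"
    and per: "\<And>a v. a \<in> A \<Longrightarrow> v \<in> T ` {x. \<forall>i. x $ i \<in> \<int>} \<Longrightarrow> a + v \<in> A"
  shows "pure_crystal (T ` {x. \<forall>i. x $ i \<in> \<int>}) A"
proof -
  let ?L = "T ` {x. \<forall>i. x $ i \<in> \<int>}"
  let ?F = "A \<inter> T ` cbox 0 1"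
  have "bounded (T ` cbox 0 1)"
    using T(1) by (intro compact_imp_bounded compact_continuous_image compact_cbox linear_continuous_on)
      (simp add: linear_conv_bounded_linear)
  then have "finite ?F" by (rule discrete_set_finite_Int[OF A])
  moreover have "A = (\<Union>a\<in>?F. (+) a ` ?L)"
  proof
    show "(\<Union>a\<in>?F. (+) a ` ?L) \<subseteq> A" using per by auto
    show "A \<subseteq> (\<Union>a\<in>?F. (+) a ` ?L)"
    proof
      fix a assume a: "a \<in> A"
      obtain x where x: "a = T x" using T(2) by (metis surjD)
      \<comment> \<open>Integer part, so that \<open>x - n\<close> lies in the unit cube.\<close>
      define n :: "real^'d" where "n = (\<chi> i. of_int \<lfloor>x $ i\<rfloor>)"
      have n: "T n \<in> ?L" "T (- n) \<in> ?L" by (auto simp: n_def)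
      have "a + T (- n) \<in> A" by (rule per[OF a n(2)])
      moreover have eq: "a + T (- n) = T (x - n)" unfolding x using T(1) by (simp add: linear_diff linear_neg)
      moreover have "x - n \<in> cbox 0 1"
      proof -
        have "0 \<le> x $ i - of_int \<lfloor>x $ i\<rfloor> \<and> x $ i - of_int \<lfloor>x $ i\<rfloor> \<le> 1" for i by linarith
        then show ?thesis by (simp add: mem_box_cart n_def)
      qed
      ultimately have "a + T (- n) \<in> ?F" by blast
      moreover have "a = (a + T (- n)) + T n" using T(1) by (simp add: linear_neg)
      ultimately show "a \<in> (\<Union>a\<in>?F. (+) a ` ?L)" using n(1) by blast
    qed
  qed
  ultimately show ?thesis unfolding pure_crystal_def by blast
qed

text \<open>The premise \<open>ap\<close> may assume that \<epsilon> is below the separation of both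
  sets, because \<epsilon> is fixed only after these separations are known. Asking for \<tau> and
  -\<tau> at once provides the inverse of each exact period.\<close>

lemma common_lattice:
  fixes A B :: "(real^'d::finite) set"
  assumes d: "discrete_set A" "discrete_set B" and rd: "relatively_dense A" "relatively_dense B"
    and diff: "discrete_set {a - b | a b. a \<in> A \<and> b \<in> B}"
    and ap: "\<And>\<epsilon>. 0 < \<epsilon> \<Longrightarrow> (\<And>a b. a \<in> A \<Longrightarrow> b \<in> A \<Longrightarrow> a \<noteq> b \<Longrightarrow> \<epsilon> < dist a b) \<Longrightarrow>
       (\<And>a b. a \<in> B \<Longrightarrow> b \<in> B \<Longrightarrow> a \<noteq> b \<Longrightarrow> \<epsilon> < dist a b) \<Longrightarrow>
       \<exists>R. \<forall>x. \<exists>\<tau>. dist x \<tau> \<le> R \<and> (\<forall>\<sigma>\<in>{\<tau>, - \<tau>}. (\<forall>a\<in>A. \<exists>b\<in>A. dist (a + \<sigma>) b \<le> \<epsilon>) \<and>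
         (\<forall>a\<in>B. \<exists>b\<in>B. dist (a + \<sigma>) b \<le> \<epsilon>))"
  shows "\<exists>L. full_rank_lattice L \<and> pure_crystal L A \<and> pure_crystal L B"
proof -
  let ?D = "{a - b | a b. a \<in> A \<and> b \<in> B}"
  have diff': "discrete_set {b - a | b a. b \<in> B \<and> a \<in> A}"
  proof -
    have "{b - a | b a. b \<in> B \<and> a \<in> A} = uminus ` ?D"
    proof (intro subset_antisym subsetI)
      fix x assume "x \<in> {b - a | b a. b \<in> B \<and> a \<in> A}"
      then obtain a b where x: "x = b - a" "a \<in> A" "b \<in> B" by blast
      then have "x = - (a - b)" by simp
      with x(2,3) show "x \<in> uminus ` ?D" by blast
    next
      fix x assume "x \<in> uminus ` ?D"
      then obtain a b where x: "x = - (a - b)" "a \<in> A" "b \<in> B" by blast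
      then have "x = b - a" by simp
      with x(2,3) show "x \<in> {b - a | b a. b \<in> B \<and> a \<in> A}" by blast
    qed
    moreover have "x islimpt uminus ` ?D \<Longrightarrow> (- x) islimpt ?D" for x
      unfolding islimpt_approachable
    proof (intro allI impI)
      fix e :: real assume *: "\<forall>e>0. \<exists>y\<in>uminus ` ?D. y \<noteq> x \<and> dist y x < e" and "0 < e"
      then obtain y where y: "y \<in> ?D" "- y \<noteq> x" "dist (- y) x < e" by blast
      have "dist y (- x) = dist (- y) x" using norm_minus_cancel[of "y + x"] by (simp add: dist_norm)
      then show "\<exists>y\<in>?D. y \<noteq> - x \<and> dist y (- x) < e" using y by (intro bexI[of _ y]) auto
    qed
    ultimately show ?thesis using diff unfolding discrete_set_def by auto
  qed
  obtain s1 where s1: "0 < s1" "\<And>a a'. a \<in> A \<Longrightarrow> a' \<in> A \<Longrightarrow> a \<noteq> a' \<Longrightarrow> s1 \<le> dist a a'"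
    by (rule separated_if_differences_discrete[OF diff rd(2)]) blast
  obtain s2 where s2: "0 < s2" "\<And>a a'. a \<in> B \<Longrightarrow> a' \<in> B \<Longrightarrow> a \<noteq> a' \<Longrightarrow> s2 \<le> dist a a'"
    by (rule separated_if_differences_discrete[OF diff' rd(1)]) blast
  obtain R1 R2 where R12: "\<And>x. ball x R1 \<inter> A \<noteq> {}" "\<And>x. ball x R2 \<inter> B \<noteq> {}"
    using rd unfolding relatively_dense_def by blast
  define R where "R = max R1 R2"
  have R: "ball x R \<inter> A \<noteq> {}" "ball x R \<inter> B \<noteq> {}" for x
  proof -
    have "ball x R1 \<subseteq> ball x R" "ball x R2 \<subseteq> ball x R" by (auto simp: R_def)
    then show "ball x R \<inter> A \<noteq> {}" "ball x R \<inter> B \<noteq> {}" using R12[of x] by blast+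
  qed
  let ?S = "?D \<inter> cball 0 (4 * R + 2)"
  obtain \<eta> where \<eta>: "0 < \<eta>" "\<And>u v. u \<in> ?S \<Longrightarrow> v \<in> ?S \<Longrightarrow> u \<noteq> v \<Longrightarrow> \<eta> \<le> dist u v"
    by (rule finite_gap[OF discrete_set_finite_Int[OF diff bounded_cball[of 0 "4 * R + 2"]]]) blast
  \<comment> \<open>Small against both separations and against the gap between differences, and at
    most 1 for the radius 4 R + 2.\<close>
  define \<epsilon> where "\<epsilon> = min (min s1 s2) (min \<eta> 1) / 4"
  have \<epsilon>: "0 < \<epsilon>" "2 * \<epsilon> < s1" "2 * \<epsilon> < s2" "2 * \<epsilon> < \<eta>" "\<epsilon> \<le> 1"
    using s1(1) s2(1) \<eta>(1) by (auto simp: \<epsilon>_def)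
  have gap: "2 * \<epsilon> < dist u v" if "u \<in> ?D" "v \<in> ?D" "norm u \<le> 4 * R + 2" "norm v \<le> 4 * R + 2" "u \<noteq> v" for u v
  proof -
    have "\<eta> \<le> dist u v" using that by (intro \<eta>(2)) auto
    with \<epsilon>(4) show ?thesis by linarith
  qed
  have sepA: "\<epsilon> < dist a b" if "a \<in> A" "b \<in> A" "a \<noteq> b" for a b using s1(2)[OF that] \<epsilon> by linarith
  have sepB: "\<epsilon> < dist a b" if "a \<in> B" "b \<in> B" "a \<noteq> b" for a b using s2(2)[OF that] \<epsilon> by linarith
  obtain Q where Q: "\<forall>x. \<exists>\<tau>. dist x \<tau> \<le> Q \<and> (\<forall>\<sigma>\<in>{\<tau>, - \<tau>}. (\<forall>a\<in>A. \<exists>b\<in>A. dist (a + \<sigma>) b \<le> \<epsilon>) \<and>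
         (\<forall>a\<in>B. \<exists>b\<in>B. dist (a + \<sigma>) b \<le> \<epsilon>))"
    using ap[OF \<epsilon>(1) sepA sepB] by blast
  \<comment> \<open>Both signs are built in, so closure under negation is immediate and density is
    the point to prove.\<close>
  define P where "P = {v. (\<forall>a\<in>A. a + v \<in> A \<and> a + (- v) \<in> A) \<and> (\<forall>b\<in>B. b + v \<in> B \<and> b + (- v) \<in> B)}"
  have dense: "\<exists>v\<in>P. dist x v \<le> Q + 1" for x
  proof -
    from spec[OF Q, of x] obtain \<tau> where \<tau>: "dist x \<tau> \<le> Q" "\<forall>\<sigma>\<in>{\<tau>, - \<tau>}. (\<forall>a\<in>A. \<exists>b\<in>A. dist (a + \<sigma>) b \<le> \<epsilon>) \<and>
         (\<forall>a\<in>B. \<exists>b\<in>B. dist (a + \<sigma>) b \<le> \<epsilon>)" by (elim exE conjE)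
    have per: "\<exists>v. dist \<sigma> v \<le> \<epsilon> \<and> (\<forall>a\<in>A. a + v \<in> A) \<and> (\<forall>b\<in>B. b + v \<in> B)" if "\<sigma> \<in> {\<tau>, - \<tau>}" for \<sigma>
    proof -
      have 1: "\<And>a. a \<in> A \<Longrightarrow> \<exists>b\<in>A. dist (a + \<sigma>) b \<le> \<epsilon>" and 2: "\<And>a. a \<in> B \<Longrightarrow> \<exists>b\<in>B. dist (a + \<sigma>) b \<le> \<epsilon>"
        using bspec[OF \<tau>(2) that] by blast+
      show ?thesis
      proof (rule common_period_near_almost_period[of R A B \<epsilon> \<sigma>], goal_cases)
        case (3 u v)
        then show ?case by (rule gap)
      next
        case (8 v)
        show ?case by (intro exI[of _ v] conjI ballI 8)
      qed (rule R \<epsilon>(1,5) 1 2 | assumption)+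
    qed
    obtain v where v: "dist \<tau> v \<le> \<epsilon>" "\<forall>a\<in>A. a + v \<in> A" "\<forall>b\<in>B. b + v \<in> B" using per[of \<tau>] by blast
    obtain w where w: "dist (- \<tau>) w \<le> \<epsilon>" "\<forall>a\<in>A. a + w \<in> A" "\<forall>b\<in>B. b + w \<in> B" using per[of "- \<tau>"] by blast
    have vw: "norm (v + w) \<le> 2 * \<epsilon>"
    proof -
      have "norm (v + w) = norm ((v - \<tau>) + (w - - \<tau>))" by simp
      also have "\<dots> \<le> norm (v - \<tau>) + norm (w - - \<tau>)" by (rule norm_triangle_ineq)
      also have "\<dots> \<le> 2 * \<epsilon>" using v(1) w(1) by (simp add: dist_norm norm_minus_commute)
      finally show ?thesis .
    qed
    obtain a0 where a0: "a0 \<in> A" using R(1)[of 0] by auto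
    \<comment> \<open>The exact periods near \<tau> and -\<tau> add up to a period of length at most
      2\<epsilon>, below the separation of \<open>A\<close>, hence to 0.\<close>
    have "a0 + v + w = a0"
    proof (rule ccontr)
      assume ne: "a0 + v + w \<noteq> a0"
      have "a0 + v + w \<in> A" using a0 v(2) w(2) by blast
      from s1(2)[OF this a0 ne] have "s1 \<le> norm (v + w)" by (simp add: dist_norm add.assoc)
      with vw \<epsilon>(2) show False by linarith
    qed
    then have "w = - v" by (simp add: add.assoc add_eq_0_iff)
    then have "v \<in> P" using v w unfolding P_def by blast
    moreover have "dist x v \<le> dist x \<tau> + dist \<tau> v" by (rule dist_triangle)
    then have "dist x v \<le> Q + 1" using \<tau>(1) v(1) \<epsilon>(5) by linarith
    ultimately show ?thesis by blast
  qed
  obtain T :: "real^'d \<Rightarrow> real^'d" where T: "linear T" "inj T" "surj T" "T ` {x. \<forall>i. x $ i \<in> \<int>} \<subseteq> P"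
  proof (rule lattice_in_relatively_dense_subgroup[of P "Q + 1"])
    fix u v assume uv: "u \<in> P" "v \<in> P"
    have "a + (u + v) = (a + u) + v" "a + - (u + v) = (a + - u) + - v" for a :: "real^'d" by simp_all
    with uv show "u + v \<in> P" unfolding P_def by (smt (verit, ccfv_threshold) mem_Collect_eq)
  next
    fix u assume "u \<in> P" then show "- u \<in> P" unfolding P_def by simp
  next
    show "0 \<in> P" unfolding P_def by simp
  next
    fix x show "\<exists>v\<in>P. dist x v \<le> Q + 1" by (rule dense)
  qed
  let ?L = "T ` {x. \<forall>i. x $ i \<in> \<int>}"
  have "full_rank_lattice ?L" unfolding full_rank_lattice_def using T(1,2) by blast
  moreover have "pure_crystal ?L A"
  proof (rule pure_crystalI[OF T(1,3) d(1)])
    fix a v assume "a \<in> A" "v \<in> ?L"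
    then show "a + v \<in> A" using T(4) unfolding P_def by blast
  qed
  moreover have "pure_crystal ?L B"
  proof (rule pure_crystalI[OF T(1,3) d(2)])
    fix a v assume "a \<in> B" "v \<in> ?L"
    then show "a + v \<in> B" using T(4) unfolding P_def by blast
  qed
  ultimately show ?thesis by blast
qed

text \<open>The supremum of \<open>kappa\<close> supplies the coefficient bound behind
  \<open>translation_bounded\<close>, the infimum the constant \<open>c\<close> that keeps pairings
  away from 0. The separation \<open>\<epsilon>\<close> serves in both places.\<close>

lemma almost_periods_from_kappa:
  fixes f :: "(real^'d::finite \<Rightarrow> complex) \<Rightarrow> complex"
  assumes f: "tempered_distribution f" and d: "discrete_set (dist_supp f)"
    and df: "discrete_set (dist_supp (dist_fourier f))"
    and inf: "(INF a\<in>dist_supp f. kappa f a) > 0" and sup: "bdd_above (kappa f ` dist_supp f)"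
    and \<epsilon>: "0 < \<epsilon>" and sep: "\<And>a b. a \<in> dist_supp f \<Longrightarrow> b \<in> dist_supp f \<Longrightarrow> a \<noteq> b \<Longrightarrow> \<epsilon> < dist a b"
  shows "\<exists>W \<delta>. finite W \<and> 0 < \<delta> \<and> (\<forall>\<tau> a. (\<forall>\<gamma>\<in>W. cmod (character \<gamma> \<tau> - 1) \<le> \<delta>) \<longrightarrow> a \<in> dist_supp f \<longrightarrow>
    (\<exists>b\<in>dist_supp f. dist (a + \<tau>) b \<le> \<epsilon>))"
proof -
  note e = dirac_expansion_coeff[OF f d]
  obtain B where B: "\<And>a. a \<in> dist_supp f \<Longrightarrow> kappa f a \<le> B"
    using sup unfolding bdd_above_def by blast
  have kB: "cmod (dirac_coeff f a k) \<le> B" if "a \<in> dist_supp f" "mi_abs k \<le> dist_ord f" for a k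
    using kappa_bound[OF that(2), of a] B[OF that(1)] by linarith
  have sep': "\<epsilon> \<le> dist a b" if "a \<in> dist_supp f" "b \<in> dist_supp f" "a \<noteq> b" for a b
    using sep[OF that] by simp
  obtain C where tb: "translation_bounded f (dist_ord f) C"
    using translation_boundedI[OF f e d kB \<epsilon> sep'] by blast
  have nonneg: "0 \<le> kappa f a" for a
    by (rule kappa_attained[of f a]) (metis norm_ge_zero)
  show ?thesis
  proof (rule almost_periods_of_support[OF f e tb df inf _ sep \<epsilon>])
    fix a assume a: "a \<in> dist_supp f"
    \<comment> \<open>\<open>INF\<close> over the reals is a lower bound only for a set bounded
      below, here by 0.\<close>
    have le: "(INF a\<in>dist_supp f. kappa f a) \<le> kappa f a"
      by (rule cINF_lower[OF bdd_belowI2[of _ 0] a]) (rule nonneg)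
    show "\<exists>k. mi_abs k \<le> dist_ord f \<and> (INF a\<in>dist_supp f. kappa f a) \<le> cmod (dirac_coeff f a k)"
      by (rule kappa_attained[of f a]) (use le in auto)
  qed
qed

theorem theorem5:
  fixes f1 f2 :: "(real^'d::finite \<Rightarrow> complex) \<Rightarrow> complex"
    and \<Lambda>1 \<Lambda>2 \<Gamma>1 \<Gamma>2 :: "(real^'d) set"
  assumes "tempered_distribution f1" and "tempered_distribution f2"
    and "\<Lambda>1 = dist_supp f1" and "\<Lambda>2 = dist_supp f2"
    and "\<Gamma>1 = dist_supp (dist_fourier f1)" and "\<Gamma>2 = dist_supp (dist_fourier f2)"
    and "discrete_set \<Lambda>1" and "relatively_dense \<Lambda>1"
    and "discrete_set \<Lambda>2" and "relatively_dense \<Lambda>2"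
    and "discrete_set \<Gamma>1" and "discrete_set \<Gamma>2"
    and "discrete_set {a - b | a b. a \<in> \<Lambda>1 \<and> b \<in> \<Lambda>2}"
    and "\<exists>T::real. (\<lambda>r. real (counting \<Gamma>1 r) + real (counting \<Gamma>2 r)) \<in> O[at_top](\<lambda>r. r powr T)"
    and "(INF a\<in>\<Lambda>1. kappa f1 a) > 0" and "bdd_above (kappa f1 ` \<Lambda>1)"
    and "(INF a\<in>\<Lambda>2. kappa f2 a) > 0" and "bdd_above (kappa f2 ` \<Lambda>2)"
  shows "\<exists>L. full_rank_lattice L \<and> pure_crystal L \<Lambda>1 \<and> pure_crystal L \<Lambda>2"
proof (rule common_lattice[OF assms(7,9,8,10,13)])
  fix \<epsilon> :: real
  assume \<epsilon>: "0 < \<epsilon>" and sep1: "\<And>a b. a \<in> \<Lambda>1 \<Longrightarrow> b \<in> \<Lambda>1 \<Longrightarrow> a \<noteq> b \<Longrightarrow> \<epsilon> < dist a b"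
    and sep2: "\<And>a b. a \<in> \<Lambda>2 \<Longrightarrow> b \<in> \<Lambda>2 \<Longrightarrow> a \<noteq> b \<Longrightarrow> \<epsilon> < dist a b"
  let ?near = "\<lambda>W \<delta> \<tau>. \<forall>\<gamma>\<in>W. cmod (character \<gamma> \<tau> - 1) \<le> \<delta>"
  let ?ap = "\<lambda>A \<tau>. \<forall>a\<in>A. \<exists>b\<in>A. dist (a + \<tau>) b \<le> \<epsilon>"
  have "\<exists>W \<delta>. finite W \<and> 0 < \<delta> \<and> (\<forall>\<tau> a. ?near W \<delta> \<tau> \<longrightarrow> a \<in> \<Lambda>1 \<longrightarrow> (\<exists>b\<in>\<Lambda>1. dist (a + \<tau>) b \<le> \<epsilon>))"
    unfolding assms(3) by (rule almost_periods_from_kappa) (use assms \<epsilon> sep1 in simp_all)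
  then obtain W1 \<delta>1 where 1: "finite W1" "0 < \<delta>1" "\<And>\<tau>. ?near W1 \<delta>1 \<tau> \<Longrightarrow> ?ap \<Lambda>1 \<tau>" by auto
  have "\<exists>W \<delta>. finite W \<and> 0 < \<delta> \<and> (\<forall>\<tau> a. ?near W \<delta> \<tau> \<longrightarrow> a \<in> \<Lambda>2 \<longrightarrow> (\<exists>b\<in>\<Lambda>2. dist (a + \<tau>) b \<le> \<epsilon>))"
    unfolding assms(4) by (rule almost_periods_from_kappa) (use assms \<epsilon> sep2 in simp_all)
  then obtain W2 \<delta>2 where 2: "finite W2" "0 < \<delta>2" "\<And>\<tau>. ?near W2 \<delta>2 \<tau> \<Longrightarrow> ?ap \<Lambda>2 \<tau>" by auto
  \<comment> \<open>Merging the frequency sets and tolerances makes one \<tau> serve both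
    distributions.\<close>
  have "finite (W1 \<union> W2)" "0 < min \<delta>1 \<delta>2" using 1 2 by auto
  then obtain R where R: "\<And>x. \<exists>\<tau>. dist x \<tau> \<le> R \<and> ?near (W1 \<union> W2) (min \<delta>1 \<delta>2) \<tau>"
    by (rule common_almost_periods) blast
  show "\<exists>R. \<forall>x. \<exists>\<tau>. dist x \<tau> \<le> R \<and> (\<forall>\<sigma>\<in>{\<tau>, - \<tau>}. ?ap \<Lambda>1 \<sigma> \<and> ?ap \<Lambda>2 \<sigma>)"
  proof (intro exI[of _ R] allI)
    fix x
    from R[of x] obtain \<tau> where \<tau>: "dist x \<tau> \<le> R" "?near (W1 \<union> W2) (min \<delta>1 \<delta>2) \<tau>" by (elim exE conjE)
    have "?ap \<Lambda>1 \<sigma> \<and> ?ap \<Lambda>2 \<sigma>" if "\<sigma> \<in> {\<tau>, - \<tau>}" for \<sigma>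
    proof -
      \<comment> \<open>Characters at -\<tau> are complex conjugates of those at \<tau>, so
        closeness to 1 is shared by both signs.\<close>
      have "?near (W1 \<union> W2) (min \<delta>1 \<delta>2) \<sigma>" using that \<tau>(2) by (auto simp: character_uminus_near_1)
      then have "?near W1 \<delta>1 \<sigma>" "?near W2 \<delta>2 \<sigma>" by auto
      then show ?thesis using 1(3) 2(3) by simp
    qed
    with \<tau>(1) show "\<exists>\<tau>. dist x \<tau> \<le> R \<and> (\<forall>\<sigma>\<in>{\<tau>, - \<tau>}. ?ap \<Lambda>1 \<sigma> \<and> ?ap \<Lambda>2 \<sigma>)" by (intro exI[of _ \<tau>]) simp
  qed
qed

end
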